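(* Let $\alpha,\beta>0$, let $$I(u)=\int_0^\infty \Big\{ 2(u')^2+\frac{(1-u^2)^2}{r^2} +\alpha\beta u^2\Big\}\,dr,$$ and consider the boundary value problem $$u''=\frac12\alpha\beta u+\frac1{r^2}(u^2-1)u,\quad r>0;\qquad \lim_{r\to0}u(r)=1,\quad \lim_{r\to\infty}u(r)=0.\tag{$**$}$$ Then: (a) $( ** )$ has a solution $u$ which minimizes $I$ over the class of functions $u$ on $(0,\infty)$ that are absolutely continuous on every compact subinterval of $(0,\infty)$, have $I(u)<\infty$, and satisfy $u(0^+)=1$, $u(\infty)=0$; such a solution satisfies $0<u(r)<1$ for $r>0$, is strictly decreasing, and $$1<\frac{I(u)}{\sqrt{2\alpha\beta}}<\sqrt{1+4\ln 2}.$$ (b) Every finite-energy solution $u$ of $( ** )$ satisfies $\lim_{r\to0}u'(r)=0$ and, for every $\varepsilon\in(0,1)$, $u(r),u'(r)=O\big(e^{-\sqrt{\frac{\alpha\beta}{2}}(1-\varepsilon)r}\big)$ as $r\to\infty$. (c) Every nonnegative solution $u$ of $( ** )$ satisfies $$e^{-\sqrt{\frac{\alpha\beta}{2}}\,r}<u(r)<1,\qquad r>0,$$ and a nonnegative (finite-energy) solution of $( ** )$ is unique. In particular, $I$ has a unique minimizer subject to the boundary conditions in $( ** )$.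
   Context: This is the limiting case $\gamma=\infty$ (infinite Higgs coupling, Higgs profile frozen at $f\equiv1$) of a radially reduced dark-monopole energy; $u(r)$ is the gauge-field profile function. *)

theory Defs
  imports "HOL-Analysis.Analysis" "HOL-Library.Landau_Symbols"
begin

definition abs_cont_on :: "real set \<Rightarrow> (real \<Rightarrow> real) \<Rightarrow> bool" where
  "abs_cont_on S u \<longleftrightarrow>
     (\<forall>\<epsilon>>0. \<exists>\<delta>>0. \<forall>(n::nat) (x::nat\<Rightarrow>real) (y::nat\<Rightarrow>real).
        (\<forall>k<n. x k \<le> y k \<and> x k \<in> S \<and> y k \<in> S) \<longrightarrow>
        (\<forall>i<n. \<forall>j<n. i \<noteq> j \<longrightarrow> y i \<le> x j \<or> y j \<le> x i) \<longrightarrow>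
        (\<Sum>k<n. y k - x k) < \<delta> \<longrightarrow> (\<Sum>k<n. \<bar>u (y k) - u (x k)\<bar>) < \<epsilon>)"

text \<open>Energy I(u) (u' taken as the pointwise derivative, which exists a.e. for
  locally absolutely continuous u); value in [0,\<infinity>].\<close>
definition energy :: "real \<Rightarrow> real \<Rightarrow> (real \<Rightarrow> real) \<Rightarrow> ennreal" where
  "energy \<alpha> \<beta> u = (\<integral>\<^sup>+ r \<in> {0<..}.
      ennreal (2 * (deriv u r)\<^sup>2 + (1 - (u r)\<^sup>2)\<^sup>2 / r\<^sup>2 + \<alpha> * \<beta> * (u r)\<^sup>2) \<partial>lebesgue)"

definition admissible :: "real \<Rightarrow> real \<Rightarrow> (real \<Rightarrow> real) \<Rightarrow> bool" where
  "admissible \<alpha> \<beta> u \<longleftrightarrow>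
     (\<forall>a b. 0 < a \<longrightarrow> a \<le> b \<longrightarrow> abs_cont_on {a..b} u) \<and>
     energy \<alpha> \<beta> u < \<infinity> \<and>
     (u \<longlongrightarrow> 1) (at_right 0) \<and> (u \<longlongrightarrow> 0) at_top"

definition is_solution :: "real \<Rightarrow> real \<Rightarrow> (real \<Rightarrow> real) \<Rightarrow> bool" where
  "is_solution \<alpha> \<beta> u \<longleftrightarrow>
     (\<forall>r>0. u differentiable (at r) \<and>
        (deriv u has_real_derivative
           (1/2 * \<alpha> * \<beta> * u r + 1 / r\<^sup>2 * ((u r)\<^sup>2 - 1) * u r)) (at r)) \<and>
     (u \<longlongrightarrow> 1) (at_right 0) \<and> (u \<longlongrightarrow> 0) at_top"

end

theory Submission
  imports Defs "HOL-Real_Asymp.Real_Asymp"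
begin

text \<open>
  Along a positive solution \<open>u\<close> put \<open>w = u' / u\<close>. The energy density of a competitor \<open>v\<close> minus that of \<open>u\<close> is
  \<open>2 (v' - w v)\<^sup>2 + (u\<^sup>2 - v\<^sup>2)\<^sup>2 / r\<^sup>2\<close> plus the derivative of \<open>2 (v\<^sup>2 - u\<^sup>2) w\<close>. Since \<open>w\<close> is bounded, the exact term
  integrates to zero, so every nonnegative solution is the unique minimizer, and no compactness argument is needed.
  It remains to produce one nonnegative solution: the equation is a fixed point problem for a monotone
  Green operator with subsolution \<open>exp (- r)\<close> and supersolution \<open>1\<close> (after scaling), solved by Knaster-Tarski.
  Qualitative properties follow from the maximum principle; the upper energy bound comes from the best trial
  function \<open>exp (- l r)\<close>. For merely absolutely continuous competitors, differentiability almost everywhere and the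
  fundamental theorem of calculus are obtained from Vitali's covering theorem.
\<close>

section \<open>Absolutely continuous functions\<close>

text \<open>\<open>I\<close> is not convex in \<open>v\<close>, yet its potential part is quadratic
  in \<open>v^2\<close>. Expanded about \<open>u^2\<close> it leaves exactly the remainder
  \<open>(u^2 - v^2)^2 / r^2\<close>, and the linear term has coefficient \<open>2 Q\<close> with
  \<open>Q = m^2 + (u^2 - 1) / r^2\<close> and \<open>m^2 = \<alpha> \<beta> / 2\<close>. Since
  \<open>u'' = Q u\<close>, the quotient \<open>w\<close> solves the Riccati equation
  \<open>w' = Q - w^2\<close>, which completes \<open>2 v'^2 + 2 Q v^2\<close> to a square plus an
  exact derivative. This hidden convexity in \<open>v^2\<close> is why minimality and uniqueness
  arrive together; only the sign of \<open>v\<close> remains to be settled. The exact term drops out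
  because \<open>v^2 - u^2\<close> tends to 0 at both ends while \<open>- m < w \<le> 0\<close>. The
  lower bound on \<open>w\<close> comes from \<open>u < 1\<close>, that is from
  \<open>Q < m^2\<close>; the upper one is monotonicity of \<open>u\<close>. The obstacle is the
  class of competitors: the energy sees only the pointwise derivative of a locally absolutely
  continuous \<open>v\<close>, so the exact term must be integrated for such functions. This
  accounts for the measure-theoretic first third.\<close>

definition short_family :: "real set \<Rightarrow> real \<Rightarrow> nat \<Rightarrow> (nat \<Rightarrow> real) \<Rightarrow> (nat \<Rightarrow> real) \<Rightarrow> bool" where
  "short_family S d n x y \<longleftrightarrow> (\<forall>k<n. x k \<le> y k \<and> x k \<in> S \<and> y k \<in> S) \<and>
     (\<forall>i<n. \<forall>j<n. i \<noteq> j \<longrightarrow> y i \<le> x j \<or> y j \<le> x i) \<and> (\<Sum>k<n. y k - x k) < d"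

lemma abs_cont_on_iff:
  "abs_cont_on S F \<longleftrightarrow>
     (\<forall>e>0. \<exists>d>0. \<forall>n x y. short_family S d n x y \<longrightarrow> (\<Sum>k<n. \<bar>F (y k) - F (x k)\<bar>) < e)"
  by (simp only: abs_cont_on_def short_family_def imp_conjL)

lemma abs_cont_onE:
  assumes "abs_cont_on S F" "e > 0"
  obtains d where "d > 0" "\<And>n x y. short_family S d n x y \<Longrightarrow> (\<Sum>k<n. \<bar>F (y k) - F (x k)\<bar>) < e"
  using assms unfolding abs_cont_on_iff by blast

lemma abs_cont_onI:
  assumes "\<And>e. e > 0 \<Longrightarrow> \<exists>d>0. \<forall>n x y. short_family S d n x y \<longrightarrow> (\<Sum>k<n. \<bar>F (y k) - F (x k)\<bar>) < e"
  shows "abs_cont_on S F"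
  using assms unfolding abs_cont_on_iff by blast

section \<open>Divisions into intervals and Vitali covers\<close>

lemma division_nonoverlap:
  fixes \<D> :: "real set set"
  assumes "\<D> division_of X" "K \<in> \<D>" "L \<in> \<D>" "K \<noteq> L" "Inf K < Sup K" "Inf L < Sup L"
  shows "Sup K \<le> Inf L \<or> Sup L \<le> Inf K"
proof -
  obtain a b where K: "K = {a..b}" "a \<le> b"
    using division_ofD(3,4)[OF assms(1,2)] by (metis atLeastatMost_empty_iff cbox_interval)
  obtain c d where L: "L = {c..d}" "c \<le> d"
    using division_ofD(3,4)[OF assms(1,3)] by (metis atLeastatMost_empty_iff cbox_interval)
  have "interior K \<inter> interior L = {}"
    using division_ofD(5)[OF assms(1,2,3,4)] .
  then have "{a<..<b} \<inter> {c<..<d} = {}"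
    by (simp add: K L)
  \<comment> \<open>The midpoint of the would-be overlap of the two open intervals.\<close>
  then have "(max a c + min b d) / 2 \<notin> {a<..<b} \<inter> {c<..<d}"
    by blast
  then show ?thesis
    using assms(5,6) K L by (auto simp: max_def min_def split: if_splits)
qed

text \<open>Covering and gauge arguments produce divisions, not indexed families; this is the form
  of absolute continuity that they consume.\<close>

lemma abs_cont_on_division:
  assumes "abs_cont_on S F" "0 < e"
  obtains d where "0 < d"
    "\<And>\<D>. \<D> division_of \<Union>\<D> \<Longrightarrow> \<Union>\<D> \<subseteq> S \<Longrightarrow> (\<Sum>K\<in>\<D>. measure lborel K) < d \<Longrightarrow>
        (\<Sum>K\<in>\<D>. \<bar>F (Sup K) - F (Inf K)\<bar>) < e"
proof -
  obtain d where "d > 0" and d: "\<And>n x y. short_family S d n x y \<Longrightarrow> (\<Sum>k<n. \<bar>F (y k) - F (x k)\<bar>) < e"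
    using abs_cont_onE[OF assms] by blast
  show ?thesis
  proof (rule that[OF \<open>d > 0\<close>])
    fix \<D> assume div: "\<D> division_of \<Union>\<D>" and sub: "\<Union>\<D> \<subseteq> S" and small: "(\<Sum>K\<in>\<D>. measure lborel K) < d"
    have fin: "finite \<D>" using div by auto
    have KD: "\<exists>a b. K = {a..b} \<and> a \<le> b" if "K \<in> \<D>" for K
      using division_ofD(3,4)[OF div that] by (metis atLeastatMost_empty_iff cbox_interval)
    \<comment> \<open>A one-point cell may lie strictly inside another cell, because its interior is
      empty. The ordering required by \<open>short_family\<close> then fails, so such cells are
      dropped; their increments are 0.\<close>
    define \<E> where "\<E> = {K \<in> \<D>. Inf K < Sup K}"
    have "finite \<E>" using fin by (simp add: \<E>_def)
    then obtain h where h: "bij_betw h {..<card \<E>} \<E>"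
      using ex_bij_betw_nat_finite[of \<E>] by (auto simp: atLeast0LessThan)
    have hE: "h k \<in> \<E>" if "k < card \<E>" for k using h that by (auto simp: bij_betw_def)
    have "(\<Sum>k<card \<E>. \<bar>F (Sup (h k)) - F (Inf (h k))\<bar>) < e"
    proof (rule d, unfold short_family_def, intro conjI)
      show "\<forall>k<card \<E>. Inf (h k) \<le> Sup (h k) \<and> Inf (h k) \<in> S \<and> Sup (h k) \<in> S"
      proof (intro allI impI)
        fix k assume "k < card \<E>"
        then have k: "h k \<in> \<D>" using hE \<E>_def by auto
        then obtain a b where ab: "h k = {a..b}" "a \<le> b" using KD by blast
        with k sub have "{a..b} \<subseteq> S" by blast
        with ab show "Inf (h k) \<le> Sup (h k) \<and> Inf (h k) \<in> S \<and> Sup (h k) \<in> S"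
          by auto
      qed
      show "\<forall>i<card \<E>. \<forall>j<card \<E>. i \<noteq> j \<longrightarrow> Sup (h i) \<le> Inf (h j) \<or> Sup (h j) \<le> Inf (h i)"
      proof (intro allI impI)
        fix i j assume ij: "i < card \<E>" "j < card \<E>" "i \<noteq> j"
        then have "h i \<noteq> h j" using h by (auto simp: bij_betw_def inj_on_def)
        then show "Sup (h i) \<le> Inf (h j) \<or> Sup (h j) \<le> Inf (h i)"
          using division_nonoverlap[OF div] hE[OF ij(1)] hE[OF ij(2)] by (auto simp: \<E>_def)
      qed
      have "(\<Sum>k<card \<E>. Sup (h k) - Inf (h k)) = (\<Sum>K\<in>\<E>. Sup K - Inf K)"
        using sum.reindex_bij_betw[OF h] .
      also have "\<dots> = (\<Sum>K\<in>\<E>. measure lborel K)"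
        by (intro sum.cong) (auto simp: \<E>_def dest!: KD)
      also have "\<dots> \<le> (\<Sum>K\<in>\<D>. measure lborel K)"
        using fin by (intro sum_mono2) (auto simp: \<E>_def)
      finally show "(\<Sum>k<card \<E>. Sup (h k) - Inf (h k)) < d" using small by linarith
    qed
    also have "(\<Sum>k<card \<E>. \<bar>F (Sup (h k)) - F (Inf (h k))\<bar>) = (\<Sum>K\<in>\<E>. \<bar>F (Sup K) - F (Inf K)\<bar>)"
      using sum.reindex_bij_betw[OF h, of "\<lambda>K. \<bar>F (Sup K) - F (Inf K)\<bar>"] .
    also have "\<dots> = (\<Sum>K\<in>\<D>. \<bar>F (Sup K) - F (Inf K)\<bar>)"
      proof (rule sum.mono_neutral_left[OF fin])
      show "\<forall>K\<in>\<D> - \<E>. \<bar>F (Sup K) - F (Inf K)\<bar> = 0"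
      proof
        fix K assume K: "K \<in> \<D> - \<E>"
        then obtain a b where "K = {a..b}" "a \<le> b" using KD by blast
        with K show "\<bar>F (Sup K) - F (Inf K)\<bar> = 0" by (auto simp: \<E>_def)
      qed
    qed (auto simp: \<E>_def)
    finally show "(\<Sum>K\<in>\<D>. \<bar>F (Sup K) - F (Inf K)\<bar>) < e" .
  qed
qed

text \<open>Vitali's theorem gives countably many disjoint intervals that cover \<open>E\<close> up
  to a null set; by continuity of the measure, finitely many of them leave less than
  \<open>e\<close> uncovered. Intervals are read as balls around their midpoints, and the point
  \<open>x\<close> may sit anywhere in its interval, even at an endpoint.\<close>

lemma Vitali_finite_cover:
  fixes E U :: "real set"
  assumes E: "E \<in> lmeasurable" "E \<subseteq> U" "open U" and "e > 0"
    and fine: "\<And>x d. x \<in> E \<Longrightarrow> d > 0 \<Longrightarrow> \<exists>s t. s < t \<and> s \<le> x \<and> x \<le> t \<and> t - s < d \<and> P s t"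
  obtains \<D> where "\<D> division_of \<Union>\<D>" "\<Union>\<D> \<subseteq> U"
    "\<And>K. K \<in> \<D> \<Longrightarrow> \<exists>s t. s < t \<and> K = {s..t} \<and> P s t" "measure lebesgue (E - \<Union>\<D>) < e"
proof -
  define I where "I = {(s,t). s < t \<and> {s..t} \<subseteq> U \<and> P s t}"
  define a where "a = (\<lambda>(s::real,t). (s + t) / 2)"
  define r where "r = (\<lambda>(s::real,t). (t - s) / 2)"
  have cb: "cball (a i) (r i) = {fst i..snd i}" for i
    by (auto simp: a_def r_def cball_eq_atLeastAtMost field_simps split: prod.splits)
  obtain C where C: "countable C" "C \<subseteq> I"
     "pairwise (\<lambda>i j. disjnt (cball (a i) (r i)) (cball (a j) (r j))) C"
     "negligible(E - (\<Union>i \<in> C. cball (a i) (r i)))"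
  proof (rule Vitali_covering_theorem_cballs[of I r E a])
    show "0 < r i" if "i \<in> I" for i using that by (auto simp: I_def r_def)
    fix x d :: real assume "x \<in> E" "0 < d"
    then obtain \<rho> where "\<rho> > 0" "ball x \<rho> \<subseteq> U" using E openE by blast
    moreover obtain s t where st: "s < t" "s \<le> x" "x \<le> t" "t - s < min \<rho> d" "P s t"
      using fine[OF \<open>x \<in> E\<close>, of "min \<rho> d"] \<open>d > 0\<close> \<open>\<rho> > 0\<close> by auto
    moreover have "{s..t} \<subseteq> ball x \<rho>" using st by (auto simp: dist_real_def)
    ultimately show "\<exists>i. i \<in> I \<and> x \<in> cball (a i) (r i) \<and> r i < d"
      unfolding cb by (intro exI[of _ "(s,t)"]) (auto simp: I_def r_def)
  qed blast
  define \<C> where "\<C> = (\<lambda>(s,t). {s..t}) ` C"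
  have Un: "(\<Union>i \<in> C. cball (a i) (r i)) = \<Union>\<C>"
    by (auto simp: cb \<C>_def)
  \<comment> \<open>\<open>U\<close> may have infinite measure; cutting the intervals down to
    \<open>E\<close> keeps all finite unions bounded by the measure of \<open>E\<close>.\<close>
  define \<E> where "\<E> = (\<lambda>K. E \<inter> K) ` \<C>"
  have K\<C>: "\<exists>s t. s < t \<and> K = {s..t} \<and> P s t \<and> K \<subseteq> U" if "K \<in> \<C>" for K
    using that C(2) by (force simp: \<C>_def I_def)
  have mE: "measure lebesgue (\<Union>\<E>) = measure lebesgue E"
  proof -
    have "\<Union>\<E> = E - (E - \<Union>\<C>)" by (auto simp: \<E>_def)
    moreover have "E - \<Union>\<C> \<in> null_sets lebesgue"
      using C(4) unfolding Un negligible_iff_null_sets .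
    ultimately show ?thesis
      using measure_Diff_null_set[OF fmeasurableD[OF E(1)]] by metis
  qed
  obtain \<D>' where D': "\<D>' \<subseteq> \<E>" "finite \<D>'" "measure lebesgue (\<Union>\<E>) - e < measure lebesgue (\<Union>\<D>')"
  proof (rule measure_countable_Union_approachable[of \<E> e "measure lebesgue E"])
    show "countable \<E>" using C(1) by (simp add: \<E>_def \<C>_def)
    show "d \<in> lmeasurable" if d: "d \<in> \<E>" for d
    proof -
      obtain K where "K \<in> \<C>" "d = E \<inter> K" using d by (auto simp: \<E>_def)
      moreover from this obtain s t where "K = {s..t}" using K\<C> by blast
      ultimately show ?thesis using E(1) by (simp add: fmeasurable_Int_fmeasurable)
    qed
    then have "\<Union>D' \<in> lmeasurable" if "D' \<subseteq> \<E>" "finite D'" for D'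
      using that by (intro fmeasurable.finite_Union) auto
    then show "measure lebesgue (\<Union>D') \<le> measure lebesgue E" if "D' \<subseteq> \<E>" "finite D'" for D'
      using that E(1) by (intro measure_mono_fmeasurable) (auto simp: \<E>_def)
  qed (use \<open>e > 0\<close> in auto)
  then obtain \<D> where D: "\<D> \<subseteq> \<C>" "finite \<D>" "\<D>' = (\<lambda>K. E \<inter> K) ` \<D>"
    unfolding \<E>_def using finite_subset_image by metis
  have UD: "\<Union>\<D>' = E \<inter> \<Union>\<D>" using D by auto
  have lD: "\<Union>\<D> \<in> lmeasurable"
  proof (rule fmeasurable.finite_Union[OF D(2)])
    show "\<D> \<subseteq> lmeasurable"
    proof
      fix K assume K: "K \<in> \<D>"
      then obtain s t where "K = {s..t}" using K\<C> D(1) by blast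
      then show "K \<in> lmeasurable" by simp
    qed
  qed
  show ?thesis
  proof
    show "\<D> division_of \<Union>\<D>"
    proof (rule division_ofI)
      fix K assume "K \<in> \<D>"
      then obtain s t where "s < t" "K = {s..t}" using D(1) K\<C> by blast
      then show "\<exists>a b. K = cbox a b" "K \<noteq> {}" by (auto simp: cbox_interval)
      show "K \<subseteq> \<Union>\<D>" using \<open>K \<in> \<D>\<close> by auto
      fix L assume "L \<in> \<D>" "K \<noteq> L"
      have KL: "K \<in> \<C>" "L \<in> \<C>" using D(1) \<open>K \<in> \<D>\<close> \<open>L \<in> \<D>\<close> by auto
      then obtain i j where ij: "i \<in> C" "j \<in> C" "K = {fst i..snd i}" "L = {fst j..snd j}"
        by (auto simp: \<C>_def)
      then have "i \<noteq> j" using \<open>K \<noteq> L\<close> by auto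
      with C(3) ij have "disjnt K L" by (auto simp: pairwise_def cb)
      then show "interior K \<inter> interior L = {}"
        using interior_subset by (auto simp: disjnt_def)
    qed (use D in auto)
    show "\<Union>\<D> \<subseteq> U" using D(1) K\<C> by blast
    show "\<exists>s t. s < t \<and> K = {s..t} \<and> P s t" if "K \<in> \<D>" for K
      using that D(1) K\<C> by blast
    have "measure lebesgue (E - \<Union>\<D>) = measure lebesgue E - measure lebesgue (E \<inter> \<Union>\<D>)"
      using measurable_measure_Diff[of E lebesgue "E \<inter> \<Union>\<D>"] E(1) lD
      by (simp add: Diff_Int fmeasurableD fmeasurable.Int)
    then show "measure lebesgue (E - \<Union>\<D>) < e" using D'(3) mE UD by simp
  qed
qed

lemma division_increments:
  fixes F :: "real \<Rightarrow> real"
  assumes "\<D> division_of {a..b}" "a \<le> b"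
  shows "(\<Sum>K\<in>\<D>. F (Sup K) - F (Inf K)) = F b - F a"
proof -
  have D: "Inf K \<in> K \<and> K \<subseteq> {a..b} \<and> (\<exists>c d. K = cbox c d)" if K: "K \<in> \<D>" for K
  proof -
    obtain c d where "K = cbox c d" using division_ofD(4)[OF assms(1) K] by blast
    moreover have "K \<noteq> {}" using division_ofD(3)[OF assms(1) K] .
    ultimately show ?thesis using division_ofD(2)[OF assms(1) K] by (auto simp: cbox_interval)
  qed
  define p where "p = (\<lambda>K. (Inf K, K)) ` \<D>"
  have "p tagged_division_of {a..b}"
  proof (rule tagged_division_ofI)
    show "finite p" using assms(1) by (auto simp: p_def)
    show "\<Union>{K. \<exists>x. (x, K) \<in> p} = {a..b}"
      unfolding p_def using division_ofD(6)[OF assms(1)] by blast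
    fix x K assume "(x, K) \<in> p"
    then have K: "K \<in> \<D>" "x = Inf K" by (auto simp: p_def)
    show "x \<in> K" "K \<subseteq> {a..b}" "\<exists>c d. K = cbox c d" using D[OF K(1)] K(2) by auto
    fix y L assume "(y, L) \<in> p" "(x, K) \<noteq> (y, L)"
    then show "interior K \<inter> interior L = {}"
      using division_ofD(5)[OF assms(1) K(1)] K by (auto simp: p_def)
  qed
  from additive_tagged_division_1[OF assms(2) this, of F]
  have "F b - F a = (\<Sum>(x, K)\<in>p. F (Sup K) - F (Inf K))" by simp
  also have "\<dots> = (\<Sum>K\<in>\<D>. F (Sup K) - F (Inf K))"
    unfolding p_def by (subst sum.reindex) (auto simp: inj_on_def)
  finally show ?thesis by simp
qed

lemma measure_division:
  fixes \<D> :: "real set set"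
  assumes "\<D> division_of \<Union>\<D>"
  shows "measure lebesgue (\<Union>\<D>) = (\<Sum>K\<in>\<D>. measure lborel K)" "\<Union>\<D> \<in> lmeasurable"
proof -
  have "measure lborel K = measure lebesgue K" if K: "K \<in> \<D>" for K
  proof -
    obtain a b where "K = cbox a b" using division_ofD(4)[OF assms K] by blast
    then show ?thesis by simp
  qed
  then show "measure lebesgue (\<Union>\<D>) = (\<Sum>K\<in>\<D>. measure lborel K)"
    using content_division[OF assms] by simp
  show "\<Union>\<D> \<in> lmeasurable" using lmeasurable_division[OF assms] .
qed

lemma lmeasurable_outer_open:
  fixes S :: "real set"
  assumes "S \<in> lmeasurable" "e > 0"
  obtains T where "open T" "S \<subseteq> T" "T \<in> lmeasurable" "measure lebesgue T < measure lebesgue S + e"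
proof -
  obtain T where T: "open T" "S \<subseteq> T" "T - S \<in> lmeasurable" "emeasure lebesgue (T - S) < ennreal e"
    using sets_lebesgue_outer_open[OF fmeasurableD[OF assms(1)] assms(2)] by metis
  have TS: "T = S \<union> (T - S)" using T(2) by blast
  have "T \<in> lmeasurable" using TS fmeasurable.Un[OF assms(1) T(3)] by metis
  moreover have "measure lebesgue (T - S) < e"
    using T(3,4) by (metis emeasure_eq_measure2 ennreal_leI not_less)
  moreover have "measure lebesgue T \<le> measure lebesgue S + measure lebesgue (T - S)"
    using measure_Un_le[of S lebesgue "T - S"] assms(1) T(3) TS by (metis fmeasurableD)
  ultimately show ?thesis using that[of T] T(1,2) by force
qed

text \<open>Cover \<open>E\<close> by intervals of slope at most \<open>p\<close>, and then \<open>E\<close> within each of them by subintervals of slope at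
  least \<open>q\<close>. What is left of the former has small total length, so by absolute continuity \<open>F\<close> hardly changes there,
  whence \<open>q |E| \<le> p |E|\<close> in the limit.\<close>

lemma derivate_gap_negligible:
  fixes F :: "real \<Rightarrow> real"
  assumes F: "abs_cont_on UNIV F" and E: "E \<in> lmeasurable" and "p < q"
    and lo: "\<And>x d. x \<in> E \<Longrightarrow> d > 0 \<Longrightarrow> \<exists>s t. s < t \<and> s \<le> x \<and> x \<le> t \<and> t - s < d \<and> F t - F s \<le> p * (t - s)"
    and hi: "\<And>x d. x \<in> E \<Longrightarrow> d > 0 \<Longrightarrow> \<exists>s t. s < t \<and> s \<le> x \<and> x \<le> t \<and> t - s < d \<and> F t - F s \<ge> q * (t - s)"
  shows "negligible E"
proof -
  let ?\<mu> = "measure lebesgue"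
  have main: "(q - p) * ?\<mu> E \<le> e * (1 + 3 * \<bar>q\<bar> + 2 * (q - p))" if "e > 0" for e
  proof -
    obtain d where "d > 0" and d: "\<And>\<D>. \<D> division_of \<Union>\<D> \<Longrightarrow> (\<Sum>K\<in>\<D>. measure lborel K) < d \<Longrightarrow>
        (\<Sum>K\<in>\<D>. \<bar>F (Sup K) - F (Inf K)\<bar>) < e"
      using abs_cont_on_division[OF F \<open>e > 0\<close>] by (metis subset_UNIV)
    \<comment> \<open>With \<open>A\<close>, \<open>B\<close>, \<open>C\<close> below:
      \<open>A < |E| + \<eta>\<close> and \<open>B > |E| - 2 \<eta>\<close>, so the rest satisfies
      \<open>C = A - B < 3 \<eta> \<le> d\<close> and absolute continuity applies to it.\<close>
    define \<eta> where "\<eta> = min e (d / 3)"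
    have \<eta>: "\<eta> > 0" "\<eta> \<le> e" "3 * \<eta> \<le> d" using \<open>d > 0\<close> \<open>e > 0\<close> by (auto simp: \<eta>_def)
    obtain U where U: "open U" "E \<subseteq> U" "U \<in> lmeasurable" "?\<mu> U < ?\<mu> E + \<eta>"
      using lmeasurable_outer_open[OF E \<eta>(1)] by metis
    obtain \<I> where I: "\<I> division_of \<Union>\<I>" "\<Union>\<I> \<subseteq> U"
       "\<And>K. K \<in> \<I> \<Longrightarrow> \<exists>s t. s < t \<and> K = {s..t} \<and> F t - F s \<le> p * (t - s)" "?\<mu> (E - \<Union>\<I>) < \<eta>"
      using Vitali_finite_cover[where P = "\<lambda>s t. F t - F s \<le> p * (t - s)", OF E U(2,1) \<eta>(1)] lo by blast
    have finI: "finite \<I>" using I(1) by auto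
    \<comment> \<open>Shares the loss \<open>\<eta>\<close> among the intervals of
      \<open>\<I>\<close>; the added 1 covers an empty \<open>\<I>\<close>.\<close>
    define \<theta> where "\<theta> = \<eta> / (card \<I> + 1)"
    have \<theta>: "\<theta> > 0" "card \<I> * \<theta> \<le> \<eta>" using \<eta> by (auto simp: \<theta>_def field_simps)
    have "\<exists>\<J> \<Q>. \<J> \<subseteq> \<Q> \<and> \<Q> division_of I \<and> \<J> division_of \<Union>\<J> \<and> 
        (\<forall>K\<in>\<J>. \<exists>s t. s < t \<and> K = {s..t} \<and> F t - F s \<ge> q * (t - s)) \<and> ?\<mu> (E \<inter> interior I - \<Union>\<J>) < \<theta>"
      if II: "I \<in> \<I>" for I
    proof -
      obtain s t where st: "I = {s..t}" using I(3)[OF II] by blast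
      obtain \<J> where J: "\<J> division_of \<Union>\<J>" "\<Union>\<J> \<subseteq> interior I"
        "\<And>K. K \<in> \<J> \<Longrightarrow> \<exists>s t. s < t \<and> K = {s..t} \<and> F t - F s \<ge> q * (t - s)" "?\<mu> (E \<inter> interior I - \<Union>\<J>) < \<theta>"
      proof (rule Vitali_finite_cover[where P = "\<lambda>s t. F t - F s \<ge> q * (t - s)" and E = "E \<inter> interior I" and U =
        "interior I"])
        show "E \<inter> interior I \<in> lmeasurable" using E by (simp add: fmeasurable_Int_fmeasurable st)
        show "0 < \<theta>" by (fact \<theta>)
      qed (use hi in auto)
      have "\<Union>\<J> \<subseteq> cbox s t" using J(2) interior_subset[of I] st by (auto simp: cbox_interval)
      then obtain \<Q> where "\<J> \<subseteq> \<Q>" "\<Q> division_of cbox s t"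
        using partial_division_extend_interval[OF J(1)] by metis
      then show ?thesis using J st by (metis cbox_interval)
    qed
    then obtain \<J> \<Q> where JQ: "\<And>I. I \<in> \<I> \<Longrightarrow> \<J> I \<subseteq> \<Q> I" "\<And>I. I \<in> \<I> \<Longrightarrow> \<Q> I division_of I"
        "\<And>I. I \<in> \<I> \<Longrightarrow> \<J> I division_of \<Union>(\<J> I)"
        "\<And>I K. I \<in> \<I> \<Longrightarrow> K \<in> \<J> I \<Longrightarrow> \<exists>s t. s < t \<and> K = {s..t} \<and> F t - F s \<ge> q * (t - s)"
        "\<And>I. I \<in> \<I> \<Longrightarrow> ?\<mu> (E \<inter> interior I - \<Union>(\<J> I)) < \<theta>"
      by metis
    \<comment> \<open>A degenerate cell at a common endpoint could belong to two different
      intervals; without such cells the collections \<open>R I\<close> are pairwise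
      disjoint.\<close>
    define R where "R I = {K \<in> \<Q> I - \<J> I. Inf K < Sup K}" for I
    have finQ: "finite (\<Q> I)" if "I \<in> \<I>" for I using JQ(2)[OF that] by auto
    have Qint: "\<exists>a b. K = {a..b} \<and> a \<le> b" if "I \<in> \<I>" "K \<in> \<Q> I" for I K
      using division_ofD(3,4)[OF JQ(2)[OF that(1)] that(2)] by (metis atLeastatMost_empty_iff cbox_interval)
    have Qzero: "G (Sup K) - G (Inf K) = 0" if "I \<in> \<I>" "K \<in> \<Q> I" "\<not> Inf K < Sup K" for I K and G :: "real \<Rightarrow> real"
      using Qint[OF that(1,2)] that(3) by auto
    \<comment> \<open>Used with \<open>G = F\<close> for increments and with the identity for
      lengths.\<close>
    have split: "(\<Sum>K\<in>\<J> I. G (Sup K) - G (Inf K)) + (\<Sum>K\<in>R I. G (Sup K) - G (Inf K)) = G (Sup I) - G (Inf I)"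
      if II: "I \<in> \<I>" for I and G :: "real \<Rightarrow> real"
    proof -
      obtain s t where st: "I = {s..t}" "s < t" using I(3)[OF II] by blast
      have "(\<Sum>K\<in>R I. G (Sup K) - G (Inf K)) = (\<Sum>K\<in>\<Q> I - \<J> I. G (Sup K) - G (Inf K))"
        using finQ[OF II] by (intro sum.mono_neutral_left) (auto simp: R_def dest: Qzero[OF II, of _ G])
      moreover have "(\<Sum>K\<in>\<Q> I. G (Sup K) - G (Inf K)) = 
          (\<Sum>K\<in>\<Q> I - \<J> I. G (Sup K) - G (Inf K)) + (\<Sum>K\<in>\<J> I. G (Sup K) - G (Inf K))"
        by (rule sum.subset_diff[OF JQ(1)[OF II] finQ[OF II]])
      moreover have "(\<Sum>K\<in>\<Q> I. G (Sup K) - G (Inf K)) = G (Sup I) - G (Inf I)"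
        using division_increments[of "\<Q> I" s t G] JQ(2)[OF II] st by simp
      ultimately show ?thesis by simp
    qed
    have mint: "measure lborel K = Sup K - Inf K" if "I \<in> \<I>" "K \<in> \<Q> I" for I K
      using Qint[OF that] by auto
    have mintI: "measure lborel K = Sup K - Inf K" if "K \<in> \<I>" for K
      using I(3)[OF that] by auto
    define \<R> where "\<R> = (\<Union>I\<in>\<I>. R I)"
    have Rsub: "interior K \<noteq> {}" "K \<subseteq> I" if "I \<in> \<I>" "K \<in> R I" for I K
    proof -
      have K: "K \<in> \<Q> I" "Inf K < Sup K" using that by (auto simp: R_def)
      show "interior K \<noteq> {}" using Qint[OF that(1) K(1)] K(2) by auto
      show "K \<subseteq> I" using division_ofD(2)[OF JQ(2)[OF that(1)] K(1)] .
    qed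
    have Rdisj: "interior K \<inter> interior L = {}" if "I \<in> \<I>" "K \<in> R I" "I' \<in> \<I>" "L \<in> R I'" "I \<noteq> I'" for I K I' L
      using division_ofD(5)[OF I(1) that(1,3,5)] interior_mono[OF Rsub(2)[OF that(1,2)]] interior_mono[OF
        Rsub(2)[OF that(3,4)]]
      by blast
    have finR: "finite (R I)" if "I \<in> \<I>" for I using finQ[OF that] by (auto simp: R_def)
    have sumR: "sum g \<R> = (\<Sum>I\<in>\<I>. sum g (R I))" for g :: "real set \<Rightarrow> real"
      unfolding \<R>_def
    proof (rule sum.UNION_disjoint[OF finI])
      show "\<forall>I\<in>\<I>. finite (R I)" using finR by auto
      show "\<forall>I\<in>\<I>. \<forall>I'\<in>\<I>. I \<noteq> I' \<longrightarrow> R I \<inter> R I' = {}"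
        using Rdisj Rsub(1) by (metis disjoint_iff inf.idem)
    qed
    have Rdiv: "\<R> division_of \<Union>\<R>"
    proof (rule division_ofI)
      show "finite \<R>" using finI finR by (auto simp: \<R>_def)
      fix K assume "K \<in> \<R>"
      then obtain I where I1: "I \<in> \<I>" "K \<in> R I" by (auto simp: \<R>_def)
      then have KQ: "K \<in> \<Q> I" by (auto simp: R_def)
      show "K \<subseteq> \<Union>\<R>" using \<open>K \<in> \<R>\<close> by auto
      show "K \<noteq> {}" "\<exists>a b. K = cbox a b" using division_ofD(3,4)[OF JQ(2)[OF I1(1)] KQ] by auto
      fix L assume "L \<in> \<R>" "K \<noteq> L"
      then obtain I' where I2: "I' \<in> \<I>" "L \<in> R I'" by (auto simp: \<R>_def)
      show "interior K \<inter> interior L = {}"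
      proof (cases "I = I'")
        case True
        then show ?thesis using division_ofD(5)[OF JQ(2)[OF I1(1)] KQ] I2 \<open>K \<noteq> L\<close> by (auto simp: R_def)
      next
        case False
        then show ?thesis using Rdisj I1 I2 by blast
      qed
    qed simp
    \<comment> \<open>Total lengths: \<open>A\<close> of the flat intervals, \<open>B\<close> of the
      steep subintervals inside them, \<open>C\<close> of what remains between.\<close>
    define A where "A = (\<Sum>I\<in>\<I>. measure lborel I)"
    define B where "B = (\<Sum>I\<in>\<I>. \<Sum>K\<in>\<J> I. measure lborel K)"
    define C where "C = (\<Sum>K\<in>\<R>. measure lborel K)"
    have "A = B + C"
    proof -
      have "measure lborel I = (\<Sum>K\<in>\<J> I. measure lborel K) + (\<Sum>K\<in>R I. measure lborel K)" if II: "I \<in> \<I>" for I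
      proof -
        have "(\<Sum>K\<in>\<J> I. measure lborel K) = (\<Sum>K\<in>\<J> I. Sup K - Inf K)"
          using JQ(1)[OF II] by (intro sum.cong) (auto intro!: mint[OF II])
        moreover have "(\<Sum>K\<in>R I. measure lborel K) = (\<Sum>K\<in>R I. Sup K - Inf K)"
          by (intro sum.cong) (auto simp: R_def intro!: mint[OF II])
        ultimately show ?thesis using split[OF II, of "\<lambda>x. x"] mintI[OF II] by simp
      qed
      then show ?thesis by (simp add: A_def B_def C_def sumR sum.distrib)
    qed
    have A1: "A < ?\<mu> E + \<eta>"
    proof -
      have "A = ?\<mu> (\<Union>\<I>)" using measure_division[OF I(1)] by (simp add: A_def)
      also have "\<dots> \<le> ?\<mu> U" using measure_division(2)[OF I(1)] I(2) U(3) by (intro measure_mono_fmeasurable) auto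
      finally show ?thesis using U(4) by linarith
    qed
    have B1: "B > ?\<mu> E - 2 * \<eta>"
    proof -
      have lI: "E \<inter> I \<in> lmeasurable" if "I \<in> \<I>" for I
        using I(3)[OF that] E by (auto intro!: fmeasurable_Int_fmeasurable)
      have one: "?\<mu> (E \<inter> I) \<le> (\<Sum>K\<in>\<J> I. measure lborel K) + \<theta>" if II: "I \<in> \<I>" for I
      proof -
        obtain s t where st: "I = {s..t}" "s < t" using I(3)[OF II] by blast
        have l1: "E \<inter> interior I \<in> lmeasurable" using E by (simp add: fmeasurable_Int_fmeasurable st)
        have l2: "\<Union>(\<J> I) \<in> lmeasurable" using measure_division(2)[OF JQ(3)[OF II]] .
        have l3: "E \<inter> interior I - \<Union>(\<J> I) \<in> lmeasurable" using l1 l2 by (simp add: fmeasurable.Diff)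
        have l4: "{s,t} \<in> lmeasurable" "?\<mu> {s,t} = 0" using negligible_iff_measure[of "{s,t}"] by auto
        have "E \<inter> I \<subseteq> ((E \<inter> interior I - \<Union>(\<J> I)) \<union> \<Union>(\<J> I)) \<union> {s,t}" by (auto simp: st)
        then have "?\<mu> (E \<inter> I) \<le> ?\<mu> (((E \<inter> interior I - \<Union>(\<J> I)) \<union> \<Union>(\<J> I)) \<union> {s,t})"
          by (rule measure_mono_fmeasurable[OF _ fmeasurableD[OF lI[OF II]]])
             (intro fmeasurable.Un l2 l3 l4(1))
        also have "\<dots> \<le> ?\<mu> (E \<inter> interior I - \<Union>(\<J> I)) + ?\<mu> (\<Union>(\<J> I)) + ?\<mu> {s,t}"
          using measure_Un_le[OF fmeasurableD[OF fmeasurable.Un[OF l3 l2]] fmeasurableD[OF l4(1)]]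
             measure_Un_le[OF fmeasurableD[OF l3] fmeasurableD[OF l2]] by linarith
        finally show ?thesis using JQ(5)[OF II] measure_division(1)[OF JQ(3)[OF II]] l4 by simp
      qed
      have "?\<mu> E \<le> ?\<mu> ((E - \<Union>\<I>) \<union> (\<Union>I\<in>\<I>. E \<inter> I))"
        using E lI finI measure_division(2)[OF I(1)]
        by (intro measure_mono_fmeasurable fmeasurable.Un fmeasurable.Diff fmeasurable.finite_UN) auto
      also have "\<dots> \<le> ?\<mu> (E - \<Union>\<I>) + ?\<mu> (\<Union>I\<in>\<I>. E \<inter> I)"
        using E lI finI measure_division(2)[OF I(1)]
        by (intro measure_Un_le fmeasurableD fmeasurable.Diff fmeasurable.finite_UN) auto
      also have "?\<mu> (\<Union>I\<in>\<I>. E \<inter> I) \<le> (\<Sum>I\<in>\<I>. ?\<mu> (E \<inter> I))"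
        using lI finI by (intro measure_UNION_le) auto
      also have "\<dots> \<le> (\<Sum>I\<in>\<I>. (\<Sum>K\<in>\<J> I. measure lborel K) + \<theta>)"
        using one by (intro sum_mono)
      also have "\<dots> = B + card \<I> * \<theta>" by (simp add: B_def sum.distrib)
      finally show ?thesis using I(4) \<theta>(2) by linarith
    qed
    have "C < d" using \<open>A = B + C\<close> A1 B1 \<eta> by linarith
    then have Rs: "(\<Sum>K\<in>\<R>. \<bar>F (Sup K) - F (Inf K)\<bar>) < e" using d[OF Rdiv] by (simp add: C_def)
    \<comment> \<open>The steep increments total at least \<open>q B\<close>, the flat ones at most
      \<open>p A\<close>, and they differ by the increments over \<open>\<R>\<close>, which are
      below \<open>e\<close>.\<close>
    have "q * B - e \<le> p * A"
    proof -
      have "q * B \<le> (\<Sum>I\<in>\<I>. \<Sum>K\<in>\<J> I. F (Sup K) - F (Inf K))"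
        unfolding B_def sum_distrib_left using JQ(4) by (intro sum_mono) fastforce
      also have "\<dots> = (\<Sum>I\<in>\<I>. F (Sup I) - F (Inf I)) - (\<Sum>K\<in>\<R>. F (Sup K) - F (Inf K))"
        unfolding sumR sum_subtractf[symmetric] using split by (intro sum.cong) (auto simp: algebra_simps)
      finally have "q * B \<le> \<dots>" .
      moreover have "(\<Sum>I\<in>\<I>. F (Sup I) - F (Inf I)) \<le> p * A"
        unfolding A_def sum_distrib_left using I(3) by (intro sum_mono) fastforce
      moreover have "\<bar>\<Sum>K\<in>\<R>. F (Sup K) - F (Inf K)\<bar> \<le> (\<Sum>K\<in>\<R>. \<bar>F (Sup K) - F (Inf K)\<bar>)"
        by (rule sum_abs)
      ultimately show ?thesis using Rs by linarith
    qed
    moreover have "C \<ge> 0" by (auto simp: C_def intro!: sum_nonneg)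
    have "q * C \<le> \<bar>q\<bar> * (3 * \<eta>)"
      using \<open>C \<ge> 0\<close> A1 B1 \<open>A = B + C\<close> by (intro mult_mono) auto
    moreover have "\<bar>q\<bar> * (3 * \<eta>) \<le> \<bar>q\<bar> * (3 * e)" using \<eta> by (intro mult_left_mono) auto
    \<comment> \<open>\<open>|E| < B + 2 \<eta> \<le> A + 2 e\<close>; then
      \<open>(q - p) A = q B + q C - p A \<le> e + 3 |q| e\<close>.\<close>
    moreover have "(q - p) * ?\<mu> E \<le> (q - p) * (A + 2 * e)"
      using \<open>p < q\<close> B1 \<open>C \<ge> 0\<close> \<open>A = B + C\<close> \<eta> by (intro mult_left_mono) auto
    ultimately show ?thesis using \<open>A = B + C\<close> by (simp add: algebra_simps)
  qed
  have "?\<mu> E \<le> 0"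
  proof (rule ccontr)
    assume "\<not> ?\<mu> E \<le> 0"
    then have pos: "(q - p) * ?\<mu> E > 0" using \<open>p < q\<close> by simp
    define c where "c = 1 + 3 * \<bar>q\<bar> + 2 * (q - p)"
    have "c > 0" using \<open>p < q\<close> by (simp add: c_def)
    show False using main[of "(q - p) * ?\<mu> E / (2 * c)"] pos \<open>c > 0\<close> unfolding c_def[symmetric]
      by (simp add: field_simps)
  qed
  then show ?thesis using E measure_nonneg[of lebesgue E] by (simp add: negligible_iff_measure)
qed

text \<open>Within a cell shorter than the \<open>\<delta>\<close> belonging to \<open>\<epsilon> = 1\<close>, disjoint intervals of slope at least \<open>N\<close> have
  total length at most \<open>1 / N\<close>.\<close>

lemma derivate_infinite_negligible:
  fixes F :: "real \<Rightarrow> real"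
  assumes F: "abs_cont_on UNIV F" and E: "E \<in> lmeasurable"
    and inf: "\<And>N x d. x \<in> E \<Longrightarrow> d > 0 \<Longrightarrow> 
      \<exists>s t. s < t \<and> s \<le> x \<and> x \<le> t \<and> t - s < d \<and> N * (t - s) \<le> \<bar>F t - F s\<bar>"
  shows "negligible E"
proof -
  let ?\<mu> = "measure lebesgue"
  obtain d where "d > 0" and d: "\<And>\<D>. \<D> division_of \<Union>\<D> \<Longrightarrow> (\<Sum>K\<in>\<D>. measure lborel K) < d \<Longrightarrow>
      (\<Sum>K\<in>\<D>. \<bar>F (Sup K) - F (Inf K)\<bar>) < 1"
    using abs_cont_on_division[OF F, of 1] by (metis subset_UNIV zero_less_one)
  \<comment> \<open>A cell of length \<open>d / 2\<close> keeps the total length of any disjoint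
    intervals inside it below \<open>d\<close>, so the variation bound 1 is available however many
    intervals there are.\<close>
  have cell: "negligible (E \<inter> {c<..<c + d/2})" for c
  proof -
    define C where "C = {c<..<c + d/2}"
    have EC: "E \<inter> C \<in> lmeasurable" using E by (simp add: C_def fmeasurable_Int_fmeasurable)
    have lC: "C \<in> lmeasurable" "?\<mu> C = d / 2" using \<open>d > 0\<close> by (auto simp: C_def)
    have "?\<mu> (E \<inter> C) \<le> e" if "e > 0" for e
    proof -
      \<comment> \<open>Slope \<open>2 / e\<close> against total variation below 1 forces total
        length below \<open>e / 2\<close>.\<close>
      obtain \<I> where I: "\<I> division_of \<Union>\<I>" "\<Union>\<I> \<subseteq> C"
         "\<And>K. K \<in> \<I> \<Longrightarrow> \<exists>s t. s < t \<and> K = {s..t} \<and> 2 / e * (t - s) \<le> \<bar>F t - F s\<bar>" "?\<mu> (E \<inter> C - \<Union>\<I>) < e / 2"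
      proof (rule Vitali_finite_cover[where P = "\<lambda>s t. 2 / e * (t - s) \<le> \<bar>F t - F s\<bar>", of "E \<inter> C" C "e / 2"])
        show "open C" by (simp add: C_def)
        fix x \<delta> :: real assume "x \<in> E \<inter> C" "0 < \<delta>"
        then show "\<exists>s t. s < t \<and> s \<le> x \<and> x \<le> t \<and> t - s < \<delta> \<and> 2 / e * (t - s) \<le> \<bar>F t - F s\<bar>"
          using inf by blast
      qed (use EC \<open>e > 0\<close> in auto)
      have "(\<Sum>K\<in>\<I>. measure lborel K) \<le> d / 2"
        using measure_mono_fmeasurable[OF I(2) fmeasurableD[OF measure_division(2)[OF I(1)]] lC(1)]
          measure_division(1)[OF I(1)] lC(2) by simp
      then have "(\<Sum>K\<in>\<I>. \<bar>F (Sup K) - F (Inf K)\<bar>) < 1"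
        using d[OF I(1)] \<open>d > 0\<close> by simp
      moreover have "2 / e * (\<Sum>K\<in>\<I>. measure lborel K) \<le> (\<Sum>K\<in>\<I>. \<bar>F (Sup K) - F (Inf K)\<bar>)"
        unfolding sum_distrib_left using I(3) by (intro sum_mono) fastforce
      ultimately have "2 / e * ?\<mu> (\<Union>\<I>) < 1" using measure_division(1)[OF I(1)] by simp
      then have 1: "?\<mu> (\<Union>\<I>) < e / 2" using \<open>e > 0\<close> by (simp add: field_simps)
      have lI: "\<Union>\<I> \<in> lmeasurable" by (rule measure_division(2)[OF I(1)])
      have "?\<mu> (E \<inter> C) \<le> ?\<mu> ((E \<inter> C - \<Union>\<I>) \<union> \<Union>\<I>)"
        using EC lI by (intro measure_mono_fmeasurable) auto
      also have "\<dots> \<le> ?\<mu> (E \<inter> C - \<Union>\<I>) + ?\<mu> (\<Union>\<I>)"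
        using EC lI by (intro measure_Un_le) (auto intro: fmeasurableD)
      finally show ?thesis using 1 I(4) by linarith
    qed
    then have "?\<mu> (E \<inter> C) \<le> 0" using field_le_epsilon[of "?\<mu> (E \<inter> C)" 0] by simp
    then show ?thesis using EC measure_nonneg[of lebesgue "E \<inter> C"] unfolding C_def[symmetric]
      by (simp add: negligible_iff_measure)
  qed
  have "E \<subseteq> (\<Union>k\<in>(UNIV::int set). E \<inter> {k * (d/4)<..<k * (d/4) + d/2})"
  proof
    fix x assume "x \<in> E"
    \<comment> \<open>Open cells of length \<open>d / 2\<close> are placed at spacing
      \<open>d / 4\<close>, so endpoints are covered too. Lowering the floor by one puts
      \<open>x\<close> in the right half of its cell, away from the excluded left end.\<close>
    define k where "k = \<lfloor>x / (d/4)\<rfloor> - 1"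
    have "of_int k + 1 \<le> x / (d/4)" "x / (d/4) < of_int k + 2"
      unfolding k_def by linarith+
    then have "k * (d/4) < x" "x < k * (d/4) + d/2" using \<open>d > 0\<close> by (auto simp: field_simps)
    then show "x \<in> (\<Union>k\<in>(UNIV::int set). E \<inter> {k * (d/4)<..<k * (d/4) + d/2})" using \<open>x \<in> E\<close> by auto
  qed
  moreover have "negligible (\<Union>k\<in>(UNIV::int set). E \<inter> {k * (d/4)<..<k * (d/4) + d/2})"
  proof (rule negligible_countable_Union)
    fix S assume "S \<in> range (\<lambda>k::int. E \<inter> {k * (d/4)<..<k * (d/4) + d/2})"
    then show "negligible S" using cell by blast
  qed simp
  ultimately show ?thesis using negligible_subset by blast
qed

section \<open>Differentiability almost everywhere\<close>

lemma abs_cont_on_imp_continuous_on: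
  assumes "abs_cont_on {a..b} F"
  shows "continuous_on {a..b} F"
proof (unfold continuous_on_iff, intro ballI allI impI)
  fix x e :: real assume x: "x \<in> {a..b}" and "e > 0"
  obtain d where "d > 0" and d: "\<And>\<D>. \<D> division_of \<Union>\<D> \<Longrightarrow> \<Union>\<D> \<subseteq> {a..b} \<Longrightarrow> (\<Sum>K\<in>\<D>. measure lborel K) < d \<Longrightarrow>
        (\<Sum>K\<in>\<D>. \<bar>F (Sup K) - F (Inf K)\<bar>) < e"
    by (rule abs_cont_on_division[OF assms \<open>e > 0\<close>]) blast
  have "dist (F y) (F x) < e" if "y \<in> {a..b}" "dist y x < d" for y
  proof -
    have "{cbox (min x y) (max x y)} division_of \<Union>{cbox (min x y) (max x y)}"
      using division_of_self[of "min x y" "max x y"] by (simp add: cbox_interval)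
    from d[OF this] show ?thesis using x that
      by (cases "x \<le> y") (auto simp: dist_real_def cbox_interval min_def max_def abs_minus_commute)
  qed
  then show "\<exists>d>0. \<forall>y\<in>{a..b}. dist y x < d \<longrightarrow> dist (F y) (F x) < e" using \<open>d > 0\<close> by blast
qed

lemma abs_cont_on_subset: "abs_cont_on T F \<Longrightarrow> S \<subseteq> T \<Longrightarrow> abs_cont_on S F"
  unfolding abs_cont_on_iff short_family_def by (elim all_forward imp_forward ex_forward conj_forward) auto

text \<open>\<open>Sup A\<close> is the lower limit of \<open>g\<close>. If the upper limit were
  larger, two rationals in between would both be crossed frequently. Rational gaps are enough, which
  keeps the exceptional set a countable union.\<close>

lemma tendsto_at_0_of_bounded_no_gap:
  fixes g :: "real \<Rightarrow> real"
  assumes gap: "\<And>p q. p \<in> \<rat> \<Longrightarrow> q \<in> \<rat> \<Longrightarrow> p < q \<Longrightarrow> \<exists>\<^sub>F h in at 0. g h < p \<Longrightarrow> \<exists>\<^sub>F h in at 0. g h > q \<Longrightarrow> False"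
    and bd: "eventually (\<lambda>h. \<bar>g h\<bar> \<le> N) (at 0)"
  shows "\<exists>L. (g \<longlongrightarrow> L) (at 0)"
proof -
  define A where "A = {p. eventually (\<lambda>h. p \<le> g h) (at 0)}"
  have "- N \<in> A" unfolding A_def using bd by (auto elim: eventually_mono)
  have "p \<le> N" if "p \<in> A" for p
  proof -
    have "eventually (\<lambda>h. p \<le> g h \<and> \<bar>g h\<bar> \<le> N) (at 0)" using that bd by (auto simp: A_def intro: eventually_conj)
    then have "eventually (\<lambda>h::real. p \<le> N) (at 0)" by (rule eventually_mono) auto
    then show ?thesis by (simp add: eventually_const_iff)
  qed
  then have bdd: "bdd_above A" by (auto simp: bdd_above_def)
  have "(g \<longlongrightarrow> Sup A) (at 0)"
  proof (rule tendstoI)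
    fix e :: real assume "e > 0"
    obtain p where p: "p \<in> A" "p > Sup A - e"
      using less_cSup_iff[OF _ bdd, of "Sup A - e"] \<open>- N \<in> A\<close> \<open>e > 0\<close> by auto
    have "eventually (\<lambda>h. g h < Sup A + e) (at 0)"
    proof (rule ccontr)
      assume "\<not> ?thesis"
      then have fr: "\<exists>\<^sub>F h in at 0. g h \<ge> Sup A + e" by (simp add: not_eventually not_less)
      obtain p q where pq: "p \<in> \<rat>" "Sup A < p" "q \<in> \<rat>" "p < q" "q < Sup A + e"
        using Rats_dense_in_real[of "Sup A" "Sup A + e"] \<open>e > 0\<close> Rats_dense_in_real by (metis less_add_same_cancel1)
      have "\<exists>\<^sub>F h in at 0. g h > q" using fr pq by (auto elim: frequently_elim1)
      then have "\<not> (\<exists>\<^sub>F h in at 0. g h < p)" using gap pq by blast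
      then have "p \<in> A" by (simp add: A_def frequently_def not_less)
      then have "p \<le> Sup A" using bdd by (rule cSup_upper)
      then show False using pq by simp
    qed
    moreover have "eventually (\<lambda>h. p \<le> g h) (at 0)" using p by (simp add: A_def)
    ultimately show "eventually (\<lambda>h. dist (g h) (Sup A) < e) (at 0)"
      by eventually_elim (use p in \<open>auto simp: dist_real_def\<close>)
  qed
  then show ?thesis by blast
qed

text \<open>The union over \<open>h\<close> is uncountable, but each set in it is open, so only the
  intersection over the radii \<open>1 / (n + 1)\<close> needs to be countable.\<close>

lemma frequently_at_0_borel:
  fixes P :: "real \<Rightarrow> real \<Rightarrow> bool"
  assumes "\<And>h. h \<noteq> 0 \<Longrightarrow> open {x. P x h}"
  shows "{x. \<exists>\<^sub>F h in at 0. P x h} \<in> sets borel"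
proof -
  have "{x. \<exists>\<^sub>F h in at 0. P x h} = (\<Inter>n::nat. \<Union>h\<in>{h. h \<noteq> 0 \<and> \<bar>h\<bar> < inverse (Suc n)}. {x. P x h})"
    (is "_ = ?R")
  proof (intro equalityI subsetI)
    fix x assume "x \<in> {x. \<exists>\<^sub>F h in at 0. P x h}"
    then have "\<exists>h. h \<noteq> 0 \<and> \<bar>h\<bar> < d \<and> P x h" if "d > 0" for d
      using that by (auto simp: frequently_at)
    then show "x \<in> ?R" by (auto simp del: of_nat_Suc)
  next
    fix x assume x: "x \<in> ?R"
    have "\<exists>h. h \<noteq> 0 \<and> \<bar>h\<bar> < d \<and> P x h" if d: "d > 0" for d
    proof -
      obtain n where n: "inverse (real (Suc n)) < d" using reals_Archimedean[OF d] by blast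
      have "x \<in> (\<Union>h\<in>{h. h \<noteq> 0 \<and> \<bar>h\<bar> < inverse (Suc n)}. {x. P x h})" using x by blast
      then show ?thesis using n by (auto intro: less_trans)
    qed
    then show "x \<in> {x. \<exists>\<^sub>F h in at 0. P x h}" by (auto simp: frequently_at)
  qed
  also have "\<dots> \<in> sets borel"
    using assms by (intro sets.countable_INT'') (auto intro!: borel_open open_UN)
  finally show ?thesis .
qed

text \<open>Where the derivative fails to exist, the difference quotients are unbounded (the set
  \<open>H\<close>) or oscillate across a rational gap (the sets \<open>G p q\<close>).\<close>

lemma abs_cont_on_ae_differentiable:
  fixes F :: "real \<Rightarrow> real"
  assumes F: "abs_cont_on UNIV F"
  shows "negligible {x. \<not> F differentiable (at x)}"
proof -
  define Q where "Q x h = (F (x + h) - F x) / h" for x h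
  have "continuous_on UNIV F"
  proof -
    have "isCont F x" for x
    proof -
      have "continuous_on {x-1..x+1} F"
        using abs_cont_on_imp_continuous_on abs_cont_on_subset[OF F] by blast
      then show ?thesis by (rule continuous_on_interior) simp
    qed
    then show ?thesis by (simp add: continuous_at_imp_continuous_on)
  qed
  then have contQ: "continuous_on UNIV (\<lambda>x. Q x h)" if "h \<noteq> 0" for h
    unfolding Q_def using that by (auto intro!: continuous_intros intro: continuous_on_compose2)
  \<comment> \<open>For \<open>h < 0\<close> the difference quotient belongs to the interval with
    \<open>x\<close> as its right end; this is why the covers admit intervals with \<open>x\<close>
    at an endpoint.\<close>
  have near: "\<exists>s t. s < t \<and> s \<le> x \<and> x \<le> t \<and> t - s < d \<and> R ((F t - F s) / (t - s))"
    if fr: "\<exists>\<^sub>F h in at 0. R (Q x h)" and "d > 0" for x d R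
  proof -
    obtain h where h: "h \<noteq> 0" "\<bar>h\<bar> < d" "R (Q x h)" using fr \<open>d > 0\<close> by (auto simp: frequently_at)
    show ?thesis
    proof (cases "h > 0")
      case True
      then show ?thesis using h by (intro exI[of _ x] exI[of _ "x+h"]) (auto simp: Q_def)
    next
      case False
      moreover have "Q x h = (F x - F (x + h)) / (x - (x + h))" using h(1) by (simp add: Q_def field_simps)
      ultimately show ?thesis using h by (intro exI[of _ "x+h"] exI[of _ x]) (auto simp: Q_def)
    qed
  qed
  define G where "G p q = {x. (\<exists>\<^sub>F h in at 0. Q x h < p) \<and> (\<exists>\<^sub>F h in at 0. Q x h > q)}" for p q
  define H where "H = {x. \<forall>N::nat. \<exists>\<^sub>F h in at 0. \<bar>Q x h\<bar> > N}"
  have G: "negligible (G p q)" if "p < q" for p q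
  proof -
    have "G p q = {x. \<exists>\<^sub>F h in at 0. Q x h < p} \<inter> {x. \<exists>\<^sub>F h in at 0. Q x h > q}"
      by (auto simp: G_def)
    also have "\<dots> \<in> sets borel"
      by (intro sets.Int frequently_at_0_borel) (auto intro!: open_Collect_less contQ continuous_intros)
    finally have Gm: "G p q \<in> sets borel" .
    have "negligible (G p q \<inter> cbox a b)" for a b
    proof (rule derivate_gap_negligible[OF F _ \<open>p < q\<close>])
      show "G p q \<inter> cbox a b \<in> lmeasurable"
        using Gm by (intro fmeasurable_Int_fmeasurable[of "cbox a b", simplified Int_commute]) auto
      fix x d :: real assume x: "x \<in> G p q \<inter> cbox a b" and d: "d > 0"
      then have "\<exists>\<^sub>F h in at 0. Q x h < p" "\<exists>\<^sub>F h in at 0. Q x h > q" by (auto simp: G_def)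
      from near[OF this(1) d] near[OF this(2) d]
      show "\<exists>s t. s < t \<and> s \<le> x \<and> x \<le> t \<and> t - s < d \<and> F t - F s \<le> p * (t - s)"
        "\<exists>s t. s < t \<and> s \<le> x \<and> x \<le> t \<and> t - s < d \<and> F t - F s \<ge> q * (t - s)"
        by (force simp: field_simps)+
    qed
    then show ?thesis by (subst negligible_on_intervals) blast
  qed
  have H: "negligible H"
  proof -
    have "H = (\<Inter>N::nat. {x. \<exists>\<^sub>F h in at 0. \<bar>Q x h\<bar> > N})" by (auto simp: H_def)
    also have "\<dots> \<in> sets borel"
      by (intro sets.countable_INT'' frequently_at_0_borel) (auto intro!: open_Collect_less contQ continuous_intros)
    finally have Hm: "H \<in> sets borel" .
    have "negligible (H \<inter> cbox a b)" for a b
    proof (rule derivate_infinite_negligible[OF F])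
      show "H \<inter> cbox a b \<in> lmeasurable"
        using Hm by (intro fmeasurable_Int_fmeasurable[of "cbox a b", simplified Int_commute]) auto
      fix N x d :: real assume x: "x \<in> H \<inter> cbox a b" and d: "d > 0"
      obtain n :: nat where n: "N \<le> n" using real_arch_simple by blast
      have "\<exists>\<^sub>F h in at 0. \<bar>Q x h\<bar> > n" using x by (auto simp: H_def)
      from near[OF this d] obtain s t where st: "s < t" "s \<le> x" "x \<le> t" "t - s < d"
        "n < \<bar>(F t - F s) / (t - s)\<bar>" by blast
      then have "N < \<bar>F t - F s\<bar> / (t - s)" using n by (simp add: abs_divide)
      then have "N * (t - s) \<le> \<bar>F t - F s\<bar>" using st(1) by (simp add: field_simps)
      then show "\<exists>s t. s < t \<and> s \<le> x \<and> x \<le> t \<and> t - s < d \<and> N * (t - s) \<le> \<bar>F t - F s\<bar>"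
        using st by blast
    qed
    then show ?thesis by (subst negligible_on_intervals) blast
  qed
  have "{x. \<not> F differentiable (at x)} \<subseteq> H \<union> (\<Union>(p,q)\<in>{(p,q). p \<in> \<rat> \<and> q \<in> \<rat> \<and> p < q}. G p q)"
  proof
    fix x assume x: "x \<in> {x. \<not> F differentiable (at x)}"
    show "x \<in> H \<union> (\<Union>(p,q)\<in>{(p,q). p \<in> \<rat> \<and> q \<in> \<rat> \<and> p < q}. G p q)"
    proof (rule ccontr)
      assume n: "\<not> ?thesis"
      then obtain N :: nat where "\<not> (\<exists>\<^sub>F h in at 0. \<bar>Q x h\<bar> > N)" by (auto simp: H_def)
      then have "eventually (\<lambda>h. \<bar>Q x h\<bar> \<le> N) (at 0)" by (simp add: frequently_def not_less)
      then have "\<exists>L. (Q x \<longlongrightarrow> L) (at 0)"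
        using n by (intro tendsto_at_0_of_bounded_no_gap) (auto simp: G_def)
      then show False using x by (auto simp: Q_def[abs_def] DERIV_def[symmetric] simp: real_differentiable_def)
    qed
  qed
  moreover have "negligible (\<Union>(p,q)\<in>{(p,q). p \<in> \<rat> \<and> q \<in> \<rat> \<and> p < q}. G p q)"
  proof (rule negligible_countable_Union)
    have "countable (\<rat> \<times> \<rat> :: (real \<times> real) set)" by (simp add: countable_rat)
    then have "countable {(p,q::real). p \<in> \<rat> \<and> q \<in> \<rat> \<and> p < q}" by (rule countable_subset[rotated]) auto
    then show "countable ((\<lambda>(p,q). G p q) ` {(p,q). p \<in> \<rat> \<and> q \<in> \<rat> \<and> p < q})" by simp
  qed (use G in auto)
  ultimately show ?thesis using H negligible_Un negligible_subset by blast
qed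

text \<open>The clamp onto \<open>{a..b}\<close> is monotone and 1-Lipschitz, hence maps short
  families to short families. It transfers the result on the whole line to intervals.\<close>

lemma abs_cont_on_clamp:
  assumes "abs_cont_on {a..b} F" "a \<le> b"
  shows "abs_cont_on UNIV (\<lambda>x. F (max a (min b x)))"
proof (rule abs_cont_onI)
  fix e :: real assume "e > 0"
  obtain d where "d > 0" and d: "\<And>n x y. short_family {a..b} d n x y \<Longrightarrow> (\<Sum>k<n. \<bar>F (y k) - F (x k)\<bar>) < e"
    using abs_cont_onE[OF assms(1) \<open>e > 0\<close>] by blast
  define c where "c x = max a (min b x)" for x
  have cm: "c x \<le> c y" if "x \<le> y" for x y using that by (auto simp: c_def)
  have cl: "c y - c x \<le> y - x" if "x \<le> y" for x y using that assms(2) by (auto simp: c_def)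
  have cr: "c x \<in> {a..b}" for x using assms(2) by (auto simp: c_def)
  have "(\<Sum>k<n. \<bar>F (c (y k)) - F (c (x k))\<bar>) < e" if xy: "short_family UNIV d n x y" for n x y
  proof (rule d, unfold short_family_def, intro conjI)
    show "\<forall>k<n. c (x k) \<le> c (y k) \<and> c (x k) \<in> {a..b} \<and> c (y k) \<in> {a..b}"
      "\<forall>i<n. \<forall>j<n. i \<noteq> j \<longrightarrow> c (y i) \<le> c (x j) \<or> c (y j) \<le> c (x i)"
      using xy cm cr unfolding short_family_def by blast+
    have "(\<Sum>k<n. c (y k) - c (x k)) \<le> (\<Sum>k<n. y k - x k)"
      using xy by (intro sum_mono cl) (auto simp: short_family_def)
    then show "(\<Sum>k<n. c (y k) - c (x k)) < d" using xy by (simp add: short_family_def)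
  qed
  then show "\<exists>d>0. \<forall>n x y. short_family UNIV d n x y \<longrightarrow>
      (\<Sum>k<n. \<bar>F (max a (min b (y k))) - F (max a (min b (x k)))\<bar>) < e"
    using \<open>d > 0\<close> unfolding c_def by blast
qed

lemma abs_cont_on_Icc_ae_differentiable:
  assumes "abs_cont_on {a..b} F"
  shows "negligible {x \<in> {a..b}. \<not> F differentiable (at x)}"
proof (cases "a \<le> b")
  case True
  let ?G = "\<lambda>x. F (max a (min b x))"
  have "{x \<in> {a..b}. \<not> F differentiable (at x)} \<subseteq> {x. \<not> ?G differentiable (at x)} \<union> {a, b}"
  proof
    fix x assume x: "x \<in> {x \<in> {a..b}. \<not> F differentiable (at x)}"
    show "x \<in> {x. \<not> ?G differentiable (at x)} \<union> {a, b}"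
    proof (rule ccontr)
      assume n: "\<not> ?thesis"
      then have "x \<in> {a<..<b}" using x by auto
      moreover obtain D where "(?G has_real_derivative D) (at x)" using n by (auto simp: real_differentiable_def)
      ultimately have "(F has_real_derivative D) (at x)"
        by (elim has_field_derivative_transform_within_open[where S = "{a<..<b}"]) auto
      then show False using x by (auto simp: real_differentiable_def)
    qed
  qed
  moreover have "negligible ({x. \<not> ?G differentiable (at x)} \<union> {a, b})"
    using abs_cont_on_ae_differentiable[OF abs_cont_on_clamp[OF assms True]] by simp
  ultimately show ?thesis by (rule negligible_subset[rotated])
qed simp

text \<open>In a fine tagged division, the pieces tagged in \<open>N\<close> lie in an open set of small measure, so absolute continuity
  bounds their increments; the other pieces are controlled by differentiability at the tag.\<close>

theorem fundamental_theorem_of_calculus_abs_cont: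
  fixes F f :: "real \<Rightarrow> real"
  assumes ab: "a \<le> b" and F: "abs_cont_on {a..b} F" and N: "negligible N"
    and f: "\<And>x. x \<in> {a..b} - N \<Longrightarrow> (F has_real_derivative f x) (at x within {a..b})"
  shows "(f has_integral (F b - F a)) {a..b}"
proof -
  \<comment> \<open>With value 0 on \<open>N\<close>, a piece tagged in \<open>N\<close> contributes
    nothing but the increment of \<open>F\<close>.\<close>
  define g where "g x = (if x \<in> N then 0 else f x)" for x
  have "(g has_integral (F b - F a)) {a..b}"
    unfolding has_integral_real
  proof (intro allI impI)
    fix e :: real assume e: "e > 0"
    define e' where "e' = e / (2 * (b - a + 1))"
    have e': "e' > 0" "e' * (b - a) < e / 2" using e ab by (auto simp: e'_def field_simps)
    obtain d where "d > 0" and d: "\<And>\<D>. \<D> division_of \<Union>\<D> \<Longrightarrow> \<Union>\<D> \<subseteq> {a..b} \<Longrightarrow> (\<Sum>K\<in>\<D>. measure lborel K) < d \<Longrightarrow>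
        (\<Sum>K\<in>\<D>. \<bar>F (Sup K) - F (Inf K)\<bar>) < e / 2"
      by (rule abs_cont_on_division[OF F, of "e / 2"]) (use e in \<open>simp, blast\<close>)
    obtain U where U: "open U" "N \<subseteq> U" "U \<in> lmeasurable" "measure lebesgue U < d"
      using lmeasurable_outer_open[of N d] N \<open>d > 0\<close> by (auto simp: negligible_iff_measure)
    have "\<exists>\<rho>>0. (x \<in> N \<longrightarrow> ball x \<rho> \<subseteq> U) \<and> (x \<notin> N \<longrightarrow> (\<forall>y\<in>{a..b}. \<bar>y - x\<bar> < \<rho> \<longrightarrow>
      \<bar>F y - F x - f x * (y - x)\<bar> \<le> e' * \<bar>y - x\<bar>))"
      if x: "x \<in> {a..b}" for x
    proof (cases "x \<in> N")
      case True
      then show ?thesis using U openE by blast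
    next
      case False
      with x f have "(F has_derivative (\<lambda>h. f x * h)) (at x within {a..b})"
        by (auto simp: has_field_derivative_def)
      then show ?thesis using False e'(1) unfolding has_derivative_within_alt
        by (auto simp: real_norm_def)
    qed
    then obtain \<rho> where \<rho>: "\<And>x. x \<in> {a..b} \<Longrightarrow> \<rho> x > 0" "\<And>x. x \<in> {a..b} \<Longrightarrow> x \<in> N \<Longrightarrow> ball x (\<rho> x) \<subseteq> U"
      "\<And>x y. x \<in> {a..b} \<Longrightarrow> x \<notin> N \<Longrightarrow> y \<in> {a..b} \<Longrightarrow> \<bar>y - x\<bar> < \<rho> x \<Longrightarrow> \<bar>F y - F x - f x * (y - x)\<bar> \<le> e' * \<bar>y - x\<bar>"
      by metis
    define \<gamma> where "\<gamma> x = ball x (if x \<in> {a..b} then \<rho> x else 1)" for x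
    show "\<exists>\<gamma>. gauge \<gamma> \<and> (\<forall>\<D>. \<D> tagged_division_of {a..b} \<and> \<gamma> fine \<D> \<longrightarrow>
        norm ((\<Sum>(x, k)\<in>\<D>. measure lborel k *\<^sub>R g x) - (F b - F a)) < e)"
    proof (intro exI[of _ \<gamma>] conjI allI impI)
      show "gauge \<gamma>" by (auto simp: gauge_def \<gamma>_def \<rho>(1))
      fix \<D> assume "\<D> tagged_division_of {a..b} \<and> \<gamma> fine \<D>"
      then have D: "\<D> tagged_division_of {a..b}" and fine: "\<gamma> fine \<D>" by auto
      have fin: "finite \<D>" using D by auto
      have K: "\<exists>u v. k = {u..v} \<and> u \<le> x \<and> x \<le> v \<and> a \<le> u \<and> v \<le> b \<and> {u..v} \<subseteq> ball x (\<rho> x)" if xk: "(x, k) \<in> \<D>" for x k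
      proof -
        have 1: "x \<in> k" "k \<subseteq> {a..b}" using tagged_division_ofD(2,3)[OF D xk] by auto
        obtain u v where 2: "k = cbox u v" using tagged_division_ofD(4)[OF D xk] by blast
        have "k \<subseteq> \<gamma> x" using fine xk by (auto simp: fine_def)
        then show ?thesis using 1 2 by (intro exI[of _ u] exI[of _ v]) (auto simp: \<gamma>_def cbox_interval split:
          if_splits)
      qed
      define \<B> where "\<B> = {(x,k) \<in> \<D>. x \<in> N}"
      have B: "\<B> tagged_partial_division_of {a..b}"
        using D tagged_partial_division_subset[of \<D> "{a..b}" \<B>] by (auto simp: \<B>_def tagged_division_of_def)
      have Bdiv: "snd ` \<B> division_of \<Union>(snd ` \<B>)" by (rule partial_division_of_tagged_division[OF B])
      have "\<Union>(snd ` \<B>) \<subseteq> U \<inter> {a..b}"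
      proof
        fix y assume "y \<in> \<Union>(snd ` \<B>)"
        then obtain x k where xk: "(x,k) \<in> \<D>" "x \<in> N" "y \<in> k" by (auto simp: \<B>_def)
        then obtain u v where "k = {u..v}" "u \<le> x" "x \<le> v" "a \<le> u" "v \<le> b" "{u..v} \<subseteq> ball x (\<rho> x)"
          using K by blast
        then show "y \<in> U \<inter> {a..b}" using \<rho>(2)[of x] xk by auto
      qed
      then have BU: "\<Union>(snd ` \<B>) \<subseteq> U" "\<Union>(snd ` \<B>) \<subseteq> {a..b}" by auto
      have "(\<Sum>K\<in>snd ` \<B>. measure lborel K) \<le> measure lebesgue U"
        using measure_mono_fmeasurable[OF BU(1) fmeasurableD[OF measure_division(2)[OF Bdiv]] U(3)]
          measure_division(1)[OF Bdiv] by simp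
      then have "(\<Sum>K\<in>snd ` \<B>. \<bar>F (Sup K) - F (Inf K)\<bar>) < e / 2"
        using d[OF Bdiv BU(2)] U(4) by simp
      moreover have "(\<Sum>(x,k)\<in>\<B>. \<bar>F (Sup k) - F (Inf k)\<bar>) = (\<Sum>K\<in>snd ` \<B>. \<bar>F (Sup K) - F (Inf K)\<bar>)"
      proof -
        \<comment> \<open>\<open>Sup {}\<close> and \<open>Inf {}\<close> are unspecified, whereas
          passing from tagged pieces to their cells requires the summand to vanish on every cell
          with empty interior, the empty one included.\<close>
        let ?P = "\<lambda>k. if k = {} then 0 else \<bar>F (Sup k) - F (Inf k)\<bar>"
        have "(\<Sum>(x,k)\<in>\<B>. ?P k) = (\<Sum>K\<in>snd ` \<B>. ?P K)"
          by (rule sum.over_tagged_division_lemma[OF tagged_partial_division_of_Union_self[OF B]])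
             (auto simp: cbox_interval)
        moreover have "k \<noteq> {}" if "(x,k) \<in> \<B>" for x k using that K by (fastforce simp: \<B>_def)
        ultimately show ?thesis by (smt (verit, best) case_prod_unfold image_iff prod.collapse sum.cong)
      qed
      ultimately have bad: "(\<Sum>(x,k)\<in>\<B>. \<bar>F (Sup k) - F (Inf k)\<bar>) < e / 2" by simp
      have good: "\<bar>measure lborel k * g x - (F (Sup k) - F (Inf k))\<bar> \<le> e' * measure lborel k"
        if xk: "(x,k) \<in> \<D> - \<B>" for x k
      proof -
        obtain u v where uv: "k = {u..v}" "u \<le> x" "x \<le> v" "a \<le> u" "v \<le> b" "{u..v} \<subseteq> ball x (\<rho> x)"
          using K xk by blast
        have x: "x \<in> {a..b}" "x \<notin> N" using uv xk by (auto simp: \<B>_def)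
        have "{u, v} \<subseteq> {u..v}" using uv(2,3) by auto
        then have "u \<in> ball x (\<rho> x)" "v \<in> ball x (\<rho> x)" using uv(6) by blast+
        then have "\<bar>F v - F x - f x * (v - x)\<bar> \<le> e' * \<bar>v - x\<bar>" "\<bar>F u - F x - f x * (u - x)\<bar> \<le> e' * \<bar>u - x\<bar>"
          using uv x(1) \<rho>(3)[OF x, of v] \<rho>(3)[OF x, of u] by (auto simp: dist_real_def)
        \<comment> \<open>The tag splits the cell, and the linearization errors of its two parts add
          up to at most \<open>e' (v - u)\<close>.\<close>
        then have "\<bar>F v - F u - f x * (v - u)\<bar> \<le> e' * (v - u)" using uv(2,3)
          by (simp add: algebra_simps abs_if split: if_splits)
        then show ?thesis using uv x by (simp add: g_def algebra_simps abs_minus_commute)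
      qed
      have inc: "(\<Sum>(x,k)\<in>\<D>. F (Sup k) - F (Inf k)) = F b - F a"
        using additive_tagged_division_1[OF ab D, of F] by simp
      have "(\<Sum>(x, k)\<in>\<D>. measure lborel k *\<^sub>R g x) - (F b - F a) = (\<Sum>(x, k)\<in>\<D>. measure lborel k * g x - (F (Sup
        k) - F (Inf k)))"
        unfolding inc[symmetric] sum_subtractf[symmetric] by (simp add: case_prod_unfold)
      also have "\<bar>\<dots>\<bar> \<le> (\<Sum>(x, k)\<in>\<D>. \<bar>measure lborel k * g x - (F (Sup k) - F (Inf k))\<bar>)"
        unfolding case_prod_unfold by (rule sum_abs)
      also have "\<dots> = (\<Sum>(x, k)\<in>\<D> - \<B>. \<bar>measure lborel k * g x - (F (Sup k) - F (Inf k))\<bar>) 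
          + (\<Sum>(x, k)\<in>\<B>. \<bar>measure lborel k * g x - (F (Sup k) - F (Inf k))\<bar>)"
        by (rule sum.subset_diff[OF _ fin]) (auto simp: \<B>_def)
      also have "(\<Sum>(x, k)\<in>\<B>. \<bar>measure lborel k * g x - (F (Sup k) - F (Inf k))\<bar>) = (\<Sum>(x,k)\<in>\<B>. \<bar>F (Sup k) - F
        (Inf k)\<bar>)"
        by (intro sum.cong) (auto simp: \<B>_def g_def)
      also have "(\<Sum>(x, k)\<in>\<D> - \<B>. \<bar>measure lborel k * g x - (F (Sup k) - F (Inf k))\<bar>) \<le> (\<Sum>(x, k)\<in>\<D> - \<B>. e' *
        measure lborel k)"
        using good by (intro sum_mono) auto
      also have "\<dots> \<le> (\<Sum>(x, k)\<in>\<D>. e' * measure lborel k)"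
        using fin e' by (intro sum_mono2) auto
      also have "\<dots> = e' * (b - a)"
        using additive_content_tagged_division[of \<D> a b] D ab
          by (simp add: sum_distrib_left[symmetric] case_prod_unfold cbox_interval)
      finally show "norm ((\<Sum>(x, k)\<in>\<D>. measure lborel k *\<^sub>R g x) - (F b - F a)) < e"
        using bad e' by simp
    qed
  qed
  then show ?thesis
    by (rule has_integral_spike[OF N, rotated]) (auto simp: g_def)
qed

section \<open>Closure properties of absolute continuity\<close>

lemma abs_cont_on_continuous_derivative:
  fixes F f :: "real \<Rightarrow> real"
  assumes f: "\<And>x. x \<in> {a..b} \<Longrightarrow> (F has_real_derivative f x) (at x within {a..b})" and "continuous_on {a..b} f"
  shows "abs_cont_on {a..b} F"
proof -
  obtain M where M: "\<And>x. x \<in> {a..b} \<Longrightarrow> \<bar>f x\<bar> \<le> M"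
    using compact_imp_bounded[OF compact_continuous_image[OF assms(2)]] by (fastforce simp: bounded_iff)
  define L where "L = max M 1"
  have L: "L > 0" "\<And>x. x \<in> {a..b} \<Longrightarrow> norm (f x) \<le> L" using M by (force simp: L_def)+
  have lip: "\<bar>F y - F x\<bar> \<le> L * (y - x)" if "x \<in> {a..b}" "y \<in> {a..b}" "x \<le> y" for x y
    using field_differentiable_bound[OF convex_real_interval(5)[of a b] f L(2), of y x] that by auto
  show ?thesis
  proof (rule abs_cont_onI)
    fix e :: real assume "e > 0"
    have "(\<Sum>k<n. \<bar>F (y k) - F (x k)\<bar>) < e" if xy: "short_family {a..b} (e / L) n x y" for n x y
    proof -
      have "(\<Sum>k<n. \<bar>F (y k) - F (x k)\<bar>) \<le> (\<Sum>k<n. L * (y k - x k))"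
        using xy by (intro sum_mono lip) (auto simp: short_family_def)
      also have "\<dots> = L * (\<Sum>k<n. y k - x k)" by (simp add: sum_distrib_left)
      also have "\<dots> < e" using xy L by (simp add: short_family_def field_simps)
      finally show ?thesis .
    qed
    then show "\<exists>d>0. \<forall>n x y. short_family {a..b} d n x y \<longrightarrow> (\<Sum>k<n. \<bar>F (y k) - F (x k)\<bar>) < e"
      using \<open>e > 0\<close> L by (intro exI[of _ "e / L"]) auto
  qed
qed

lemma abs_cont_on_increment_bound:
  fixes F G H :: "real \<Rightarrow> real"
  assumes F: "abs_cont_on S F" and G: "abs_cont_on S G" and M: "M > 0"
    and inc: "\<And>x y. x \<in> S \<Longrightarrow> y \<in> S \<Longrightarrow> \<bar>H y - H x\<bar> \<le> M * \<bar>F y - F x\<bar> + M * \<bar>G y - G x\<bar>"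
  shows "abs_cont_on S H"
proof (rule abs_cont_onI)
  fix e :: real assume "e > 0"
  then have e2: "e / (2 * M) > 0" using M by simp
  obtain d1 where d1: "d1 > 0" "\<And>n x y. short_family S d1 n x y \<Longrightarrow> (\<Sum>k<n. \<bar>F (y k) - F (x k)\<bar>) < e / (2 * M)"
    using abs_cont_onE[OF F e2] by blast
  obtain d2 where d2: "d2 > 0" "\<And>n x y. short_family S d2 n x y \<Longrightarrow> (\<Sum>k<n. \<bar>G (y k) - G (x k)\<bar>) < e / (2 * M)"
    using abs_cont_onE[OF G e2] by blast
  have "(\<Sum>k<n. \<bar>H (y k) - H (x k)\<bar>) < e" if xy: "short_family S (min d1 d2) n x y" for n x y
  proof -
    have "(\<Sum>k<n. \<bar>H (y k) - H (x k)\<bar>) \<le> (\<Sum>k<n. M * \<bar>F (y k) - F (x k)\<bar> + M * \<bar>G (y k) - G (x k)\<bar>)"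
      using xy by (intro sum_mono inc) (auto simp: short_family_def)
    also have "\<dots> = M * (\<Sum>k<n. \<bar>F (y k) - F (x k)\<bar>) + M * (\<Sum>k<n. \<bar>G (y k) - G (x k)\<bar>)"
      by (simp add: sum.distrib sum_distrib_left)
    also have "\<dots> < M * (e / (2 * M)) + M * (e / (2 * M))"
      using xy M by (intro add_strict_mono mult_strict_left_mono d1(2) d2(2)) (auto simp: short_family_def)
    also have "\<dots> = e" using M by simp
    finally show ?thesis .
  qed
  then show "\<exists>d>0. \<forall>n x y. short_family S d n x y \<longrightarrow> (\<Sum>k<n. \<bar>H (y k) - H (x k)\<bar>) < e"
    using d1(1) d2(1) by (intro exI[of _ "min d1 d2"]) auto
qed

lemma abs_cont_on_mult:
  fixes F G :: "real \<Rightarrow> real"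
  assumes F: "abs_cont_on {a..b} F" and G: "abs_cont_on {a..b} G"
  shows "abs_cont_on {a..b} (\<lambda>x. F x * G x)"
proof -
  have "bounded (F ` {a..b})" "bounded (G ` {a..b})"
    using abs_cont_on_imp_continuous_on[OF F] abs_cont_on_imp_continuous_on[OF G]
    by (auto intro!: compact_imp_bounded compact_continuous_image)
  then obtain M1 M2 where M12: "\<And>x. x \<in> {a..b} \<Longrightarrow> \<bar>F x\<bar> \<le> M1" "\<And>x. x \<in> {a..b} \<Longrightarrow> \<bar>G x\<bar> \<le> M2"
    by (fastforce simp: bounded_iff)
  define M where "M = max 1 (max M1 M2)"
  have M: "M > 0" "\<And>x. x \<in> {a..b} \<Longrightarrow> \<bar>F x\<bar> \<le> M" "\<And>x. x \<in> {a..b} \<Longrightarrow> \<bar>G x\<bar> \<le> M"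
    using M12 by (force simp: M_def)+
  have inc: "\<bar>F y * G y - F x * G x\<bar> \<le> M * \<bar>F y - F x\<bar> + M * \<bar>G y - G x\<bar>" if "x \<in> {a..b}" "y \<in> {a..b}" for x y
  proof -
    have "F y * G y - F x * G x = G y * (F y - F x) + F x * (G y - G x)" by (simp add: algebra_simps)
    also have "\<bar>\<dots>\<bar> \<le> \<bar>G y\<bar> * \<bar>F y - F x\<bar> + \<bar>F x\<bar> * \<bar>G y - G x\<bar>"
      by (metis abs_mult abs_triangle_ineq)
    also have "\<dots> \<le> M * \<bar>F y - F x\<bar> + M * \<bar>G y - G x\<bar>"
      using M that by (intro add_mono mult_right_mono) auto
    finally show ?thesis .
  qed
  show ?thesis by (rule abs_cont_on_increment_bound[OF F G M(1) inc])
qed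

lemma abs_cont_on_add:
  fixes F G :: "real \<Rightarrow> real"
  assumes "abs_cont_on S F" "abs_cont_on S G"
  shows "abs_cont_on S (\<lambda>x. F x + G x)"
  by (rule abs_cont_on_increment_bound[OF assms zero_less_one]) auto

lemma continuous_on_of_locally_abs_cont:
  fixes v :: "real \<Rightarrow> real"
  assumes v: "\<And>a b. 0 < a \<Longrightarrow> a \<le> b \<Longrightarrow> abs_cont_on {a..b} v"
  shows "continuous_on {0<..} v"
proof -
  have "isCont v x" if "x > 0" for x
  proof -
    have "continuous_on {x/2..x+1} v" using that by (intro abs_cont_on_imp_continuous_on v) auto
    then show ?thesis by (rule continuous_on_interior) (use that in auto)
  qed
  then show ?thesis by (auto intro: continuous_at_imp_continuous_on)
qed

section \<open>The calibration inequality\<close>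

text \<open>Links the gauge integral supplied by the fundamental theorem, whose integrand may change
  sign, to the nonnegative Lebesgue integral defining the energy: when the latter is finite,
  \<open>d\<close> is itself gauge integrable and the two can be compared.\<close>

lemma has_integral_le_nn_integral:
  fixes f d :: "real \<Rightarrow> real"
  assumes f: "(f has_integral J) {a..b}" and N: "negligible N"
    and le: "\<And>x. x \<in> {a..b} - N \<Longrightarrow> f x \<le> d x" and nonneg: "\<And>x. x \<in> {a..b} \<Longrightarrow> 0 \<le> d x"
    and meas: "d \<in> borel_measurable (lebesgue_on {a..b})"
  shows "ennreal J \<le> (\<integral>\<^sup>+x\<in>{a..b}. ennreal (d x) \<partial>lebesgue)"
proof (cases "(\<integral>\<^sup>+x\<in>{a..b}. ennreal (d x) \<partial>lebesgue) = \<infinity>")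
  case False
  define D where "D x = indicator {a..b} x * d x" for x
  have D0: "0 \<le> D x" for x using nonneg by (auto simp: D_def indicator_def)
  have "(\<lambda>x. indicator {a..b} x *\<^sub>R d x) \<in> borel_measurable lebesgue"
    using meas by (subst (asm) borel_measurable_restrict_space_iff) auto
  then have Dm: "D \<in> borel_measurable lebesgue" by (simp add: D_def[abs_def])
  have eq: "(\<integral>\<^sup>+x\<in>{a..b}. ennreal (d x) \<partial>lebesgue) = (\<integral>\<^sup>+x. ennreal (D x) \<partial>lebesgue)"
    by (intro nn_integral_cong) (auto simp: D_def indicator_def)
  obtain r where r: "r \<ge> 0" "(\<integral>\<^sup>+x. ennreal (D x) \<partial>lebesgue) = ennreal r"
    using False unfolding eq by (metis ennreal_cases infinity_ennreal_def)
  have D: "(D has_integral r) UNIV"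
    using has_integral_iff_nn_integral_lebesgue[of D r, OF D0] Dm r by blast
  have "((\<lambda>x. if x \<in> {a..b} then f x else 0) has_integral J) UNIV"
    using f by (simp only: has_integral_restrict_UNIV)
  then have f': "((\<lambda>x. if x \<in> N then D x else if x \<in> {a..b} then f x else 0) has_integral J) UNIV"
    by (rule has_integral_spike[OF N, rotated]) auto
  have "J \<le> r"
    by (rule has_integral_le[OF f' D]) (use le D0 in \<open>auto simp: D_def indicator_def\<close>)
  then show ?thesis unfolding eq r(2) by (rule ennreal_leI)
qed simp

lemma Union_Icc_inverse_Suc: "(\<Union>n. {inverse (real (Suc n))..real (Suc n)}) = {0<..}"
proof (intro equalityI subsetI)
  fix x assume "x \<in> (\<Union>n. {inverse (real (Suc n))..real (Suc n)})"
  then obtain n where "inverse (real (Suc n)) \<le> x" by auto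
  moreover have "0 < inverse (real (Suc n))" by simp
  ultimately show "x \<in> {0<..}" by (metis greaterThan_iff less_le_trans)
next
  fix x :: real assume x: "x \<in> {0<..}"
  obtain n1 where n1: "inverse (real (Suc n1)) < x" using reals_Archimedean x by auto
  obtain n2 :: nat where n2: "x \<le> n2" using real_arch_simple by blast
  have "inverse (real (Suc (max n1 n2))) \<le> inverse (real (Suc n1))" by (intro le_imp_inverse_le) auto
  then have "inverse (real (Suc (max n1 n2))) \<le> x" using n1 by linarith
  moreover have "x \<le> real (Suc (max n1 n2))" using n2 by (simp add: max_def)
  ultimately show "x \<in> (\<Union>n. {inverse (real (Suc n))..real (Suc n)})" by (auto simp del: of_nat_Suc)
qed

text \<open>On \<open>{a..b}\<close> the hypothesis integrates to
  \<open>\<integral> g \<le> \<integral> d + H a - H b\<close>; the boundary terms vanish as the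
  interval exhausts the half-line.\<close>

lemma nn_integral_comparison:
  fixes g H d :: "real \<Rightarrow> real"
  assumes g: "continuous_on {0<..} g" "\<And>x. x > 0 \<Longrightarrow> 0 \<le> g x"
    and H: "\<And>a b. 0 < a \<Longrightarrow> a \<le> b \<Longrightarrow> abs_cont_on {a..b} H"
    and N: "negligible N" and H': "\<And>x. x > 0 \<Longrightarrow> x \<notin> N \<Longrightarrow> (H has_real_derivative h x) (at x)"
    and le: "\<And>x. x > 0 \<Longrightarrow> x \<notin> N \<Longrightarrow> g x + h x \<le> d x" and d0: "\<And>x. x > 0 \<Longrightarrow> 0 \<le> d x"
    and meas: "\<And>a b. 0 < a \<Longrightarrow> a \<le> b \<Longrightarrow> d \<in> borel_measurable (lebesgue_on {a..b})"
    and H0: "(H \<longlongrightarrow> 0) (at_right 0)" and Hinf: "(H \<longlongrightarrow> 0) at_top"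
  shows "(\<integral>\<^sup>+x\<in>{0<..}. ennreal (g x) \<partial>lebesgue) \<le> (\<integral>\<^sup>+x\<in>{0<..}. ennreal (d x) \<partial>lebesgue)"
proof (cases "(\<integral>\<^sup>+x\<in>{0<..}. ennreal (d x) \<partial>lebesgue) = \<infinity>")
  case False
  then obtain E where E: "E \<ge> 0" "(\<integral>\<^sup>+x\<in>{0<..}. ennreal (d x) \<partial>lebesgue) = ennreal E"
    by (metis ennreal_cases infinity_ennreal_def)
  have step: "(\<integral>\<^sup>+x\<in>{a..b}. ennreal (g x) \<partial>lebesgue) \<le> ennreal (E + H a - H b)" if ab: "0 < a" "a \<le> b" for a b
  proof -
    have gc: "continuous_on {a..b} g" using g(1) by (rule continuous_on_subset) (use ab in auto)
    then have gi: "(g has_integral integral {a..b} g) {a..b}"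
      by (simp add: integrable_continuous_interval integrable_integral)
    have hi: "(h has_integral (H b - H a)) {a..b}"
      by (rule fundamental_theorem_of_calculus_abs_cont[OF ab(2) H[OF ab] N])
         (use H' ab in \<open>auto intro: has_field_derivative_at_within\<close>)
    have "ennreal (integral {a..b} g + (H b - H a)) \<le> (\<integral>\<^sup>+x\<in>{a..b}. ennreal (d x) \<partial>lebesgue)"
      by (rule has_integral_le_nn_integral[OF has_integral_add[OF gi hi] N _ _ meas[OF ab]])
         (use le d0 ab in auto)
    also have "\<dots> \<le> (\<integral>\<^sup>+x\<in>{0<..}. ennreal (d x) \<partial>lebesgue)"
      using ab by (intro nn_integral_mono) (auto simp: indicator_def)
    finally have "integral {a..b} g + (H b - H a) \<le> E" using E by (simp add: ennreal_le_iff)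
    then have "integral {a..b} g \<le> E + H a - H b" by simp
    moreover have "(\<integral>\<^sup>+x\<in>{a..b}. ennreal (g x) \<partial>lebesgue) = ennreal (integral {a..b} g)"
    proof -
      have g0: "\<And>x. x \<in> {a..b} \<Longrightarrow> 0 \<le> g x" using g(2) ab by auto
      have "(\<integral>\<^sup>+x\<in>{a..b}. ennreal (g x) \<partial>lebesgue) = (\<integral>\<^sup>+x. ennreal (indicator {a..b} x * g x) \<partial>lborel)"
        unfolding nn_integral_completion by (intro nn_integral_cong) (auto simp: indicator_def)
      also have "\<dots> = ennreal (integral {a..b} g)"
        by (rule nn_integral_has_integral_lebesgue[OF g0 gi])
      finally show ?thesis .
    qed
    ultimately show ?thesis by (simp add: ennreal_leI)
  qed
  define A where "A n = {inverse (real (Suc n))..real (Suc n)}" for n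
  have An: "0 < inverse (real (Suc n))" "inverse (real (Suc n)) \<le> real (Suc n)" for n
    by (auto simp: field_simps intro: order_trans[of _ 1])
  have "(\<lambda>n. \<integral>\<^sup>+x\<in>A n. ennreal (g x) \<partial>lebesgue) \<longlonglongrightarrow> (\<integral>\<^sup>+x\<in>{0<..}. ennreal (g x) \<partial>lebesgue)"
  proof -
    have inc: "incseq A"
      unfolding A_def incseq_Suc_iff by (auto intro: order_trans le_imp_inverse_le)
    have Un: "(\<Union>n. A n) = {0<..}" unfolding A_def by (rule Union_Icc_inverse_Suc)
    have gm: "(\<lambda>x. ennreal (g x) * indicator (A n) x) \<in> borel_measurable lebesgue" for n
    proof -
      have "continuous_on (A n) g" using g(1) 
        by (rule continuous_on_subset) (use Union_Icc_inverse_Suc in \<open>unfold A_def, blast\<close>)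
      then have "(\<lambda>x. indicator (A n) x *\<^sub>R g x) \<in> borel_measurable borel"
        by (intro borel_measurable_continuous_on_indicator) (auto simp: A_def)
      then have "(\<lambda>x. ennreal (indicator (A n) x *\<^sub>R g x)) \<in> borel_measurable lebesgue"
        by (intro measurable_compose[OF _ measurable_ennreal] measurable_completion) simp
      moreover have "(\<lambda>x. ennreal (indicator (A n) x *\<^sub>R g x)) = (\<lambda>x. ennreal (g x) * indicator (A n) x)"
        by (auto simp: indicator_def)
      ultimately show ?thesis by simp
    qed
    have "(\<lambda>n. \<integral>\<^sup>+x. ennreal (g x) * indicator (A n) x \<partial>lebesgue) \<longlonglongrightarrow> (\<integral>\<^sup>+x. ennreal (g x) * indicator (\<Union>n. A n) x
      \<partial>lebesgue)"
    proof (rule nn_integral_LIMSEQ[OF _ gm])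
      show "incseq (\<lambda>n x. ennreal (g x) * indicator (A n) x)"
        using inc unfolding incseq_def le_fun_def by (auto simp: indicator_def) 
      show "(\<lambda>n. ennreal (g x) * indicator (A n) x) \<longlonglongrightarrow> ennreal (g x) * indicator (\<Union>n. A n) x" for x
      proof (cases "x \<in> (\<Union>n. A n)")
        case True
        then obtain m where "x \<in> A m" by blast
        then have "eventually (\<lambda>n. ennreal (g x) * indicator (A n) x = ennreal (g x) * indicator (\<Union>n. A n) x)
          sequentially"
          unfolding eventually_sequentially using inc by (intro exI[of _ m]) (auto simp: incseq_def indicator_def)
        then show ?thesis by (rule tendsto_eventually)
      next
        case False
        then have "\<And>n. x \<notin> A n" by blast
        with False show ?thesis by simp
      qed
    qed
    then show ?thesis unfolding Un .
  qed
  moreover have "(\<lambda>n. ennreal (E + H (inverse (real (Suc n))) - H (real (Suc n)))) \<longlonglongrightarrow> ennreal (E + 0 - 0)"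
  proof (intro tendsto_ennrealI tendsto_diff tendsto_add tendsto_const)
    show "(\<lambda>n. H (inverse (real (Suc n)))) \<longlonglongrightarrow> 0"
      by (rule filterlim_compose[OF H0])
         (auto simp: filterlim_at simp del: of_nat_Suc intro!: LIMSEQ_inverse_real_of_nat)
    show "(\<lambda>n. H (real (Suc n))) \<longlonglongrightarrow> 0"
      by (rule filterlim_compose[OF Hinf]) (intro filterlim_compose[OF filterlim_real_sequentially] filterlim_Suc)
  qed
  ultimately show ?thesis
    unfolding E(2) using step[OF An] by (intro LIMSEQ_le[of _ _ _ "ennreal E"]) (auto simp: A_def)
qed simp

text \<open>The fundamental theorem makes \<open>deriv v\<close> gauge integrable, and gauge
  integrable functions are Lebesgue measurable. The arbitrary values of \<open>deriv\<close> where
  \<open>v\<close> is not differentiable sit on a null set.\<close>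

lemma deriv_measurable_of_abs_cont:
  fixes v :: "real \<Rightarrow> real"
  assumes "abs_cont_on {a..b} v" "a \<le> b"
  shows "deriv v \<in> borel_measurable (lebesgue_on {a..b})"
proof -
  have "(deriv v has_integral (v b - v a)) {a..b}"
    by (rule fundamental_theorem_of_calculus_abs_cont[OF assms(2,1) abs_cont_on_Icc_ae_differentiable[OF assms(1)]])
       (auto simp: DERIV_deriv_iff_real_differentiable intro: has_field_derivative_at_within)
  then show ?thesis by (intro integrable_imp_measurable) blast
qed

abbreviation energy_density :: "real \<Rightarrow> (real \<Rightarrow> real) \<Rightarrow> real \<Rightarrow> real" where
  "energy_density c v r \<equiv> 2 * (deriv v r)\<^sup>2 + (1 - (v r)\<^sup>2)\<^sup>2 / r\<^sup>2 + c * (v r)\<^sup>2"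

lemma energy_density_measurable:
  assumes v: "abs_cont_on {a..b} v" and ab: "0 < a" "a \<le> b"
  shows "energy_density c v \<in> borel_measurable (lebesgue_on {a..b})"
proof -
  have "v \<in> borel_measurable (lebesgue_on {a..b})"
    by (intro continuous_imp_measurable_on_sets_lebesgue abs_cont_on_imp_continuous_on[OF v]) auto
  moreover have "(\<lambda>x::real. x) \<in> borel_measurable (lebesgue_on {a..b})"
    by (intro continuous_imp_measurable_on_sets_lebesgue) auto
  moreover note deriv_measurable_of_abs_cont[OF v ab(2)]
  ultimately show ?thesis by measurable
qed

text \<open>The Jacobi (calibration) identity: with \<open>w = u'/u\<close>, wherever \<open>v\<close> is differentiable, the energy density of \<open>v\<close>
  minus that of \<open>u\<close> equals \<open>2 (v' - w v)\<^sup>2 + (u\<^sup>2 - v\<^sup>2)\<^sup>2 / r\<^sup>2\<close> plus the exact derivative of \<open>2 (v\<^sup>2 - u\<^sup>2) w\<close>.\<close>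

lemma energy_ge_calibrated:
  fixes u u' v :: "real \<Rightarrow> real"
  assumes u: "\<And>r. r > 0 \<Longrightarrow> (u has_real_derivative u' r) (at r)"
    and u': "\<And>r. r > 0 \<Longrightarrow> (u' has_real_derivative ((\<alpha> * \<beta> / 2 + ((u r)\<^sup>2 - 1) / r\<^sup>2) * u r)) (at r)"
    and pos: "\<And>r. r > 0 \<Longrightarrow> u r > 0" and bd: "\<And>r. r > 0 \<Longrightarrow> \<bar>u' r\<bar> \<le> M * u r"
    and ul: "(u \<longlongrightarrow> 1) (at_right 0)" "(u \<longlongrightarrow> 0) at_top"
    and v: "\<And>a b. 0 < a \<Longrightarrow> a \<le> b \<Longrightarrow> abs_cont_on {a..b} v"
    and vl: "(v \<longlongrightarrow> 1) (at_right 0)" "(v \<longlongrightarrow> 0) at_top"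
    and c: "\<alpha> * \<beta> \<ge> 0"
  shows "(\<integral>\<^sup>+r\<in>{0<..}. ennreal (energy_density (\<alpha> * \<beta>) u r + ((u r)\<^sup>2 - (v r)\<^sup>2)\<^sup>2 / r\<^sup>2) \<partial>lebesgue) \<le> energy \<alpha> \<beta> v"
proof -
  let ?c = "\<alpha> * \<beta>"
  define w where "w r = u' r / u r" for r
  define q where "q r = ?c / 2 + ((u r)\<^sup>2 - 1) / r\<^sup>2" for r
  have u'': "(u' has_real_derivative (q r * u r)) (at r)" if "r > 0" for r
    using u'[OF that] by (simp add: q_def)
  have w: "(w has_real_derivative (q r - (w r)\<^sup>2)) (at r)" if "r > 0" for r
    unfolding w_def using pos[OF that]
    by (auto intro!: derivative_eq_intros u[OF that] u''[OF that] simp: field_simps power2_eq_square)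
  have cu: "continuous_on {0<..} u" "continuous_on {0<..} u'" "continuous_on {0<..} w"
    using u u'' w by (auto intro!: continuous_at_imp_continuous_on DERIV_isCont)
  have cv: "continuous_on {0<..} v" by (rule continuous_on_of_locally_abs_cont[OF v])
  define H where "H r = (v r * v r - u r * u r) * (2 * w r)" for r
  define N where "N = {r. r > 0 \<and> \<not> v differentiable (at r)}"
  have N: "negligible N"
  proof -
    have "N \<subseteq> (\<Union>n::nat. {x \<in> {inverse (real (Suc n))..real (Suc n)}. \<not> v differentiable (at x)})"
    proof
      fix x assume x: "x \<in> N"
      then have "x \<in> (\<Union>n. {inverse (real (Suc n))..real (Suc n)})"
        unfolding Union_Icc_inverse_Suc by (auto simp: N_def)
      then show "x \<in> (\<Union>n::nat. {x \<in> {inverse (real (Suc n))..real (Suc n)}. \<not> v differentiable (at x)})"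
        using x unfolding N_def by blast
    qed
    moreover have "negligible (\<Union>n::nat. {x \<in> {inverse (real (Suc n))..real (Suc n)}. \<not> v differentiable (at x)})"
    proof (rule negligible_countable_Union)
      fix S assume "S \<in> range (\<lambda>n::nat. {x \<in> {inverse (real (Suc n))..real (Suc n)}. \<not> v differentiable (at x)})"
      then obtain n where S: "S = {x \<in> {inverse (real (Suc n))..real (Suc n)}. \<not> v differentiable (at x)}" by blast
      show "negligible S" unfolding S
        by (intro abs_cont_on_Icc_ae_differentiable v) (auto simp: field_simps intro: order_trans[of _ 1])
    qed simp
    ultimately show ?thesis by (rule negligible_subset[rotated])
  qed
  have ac: "abs_cont_on {a..b} H" if "0 < a" "a \<le> b" for a b
  proof -
    have sub: "{a..b} \<subseteq> {0<..}" using that by auto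
    have "abs_cont_on {a..b} (\<lambda>r. - (u r * u r))"
    proof (rule abs_cont_on_continuous_derivative)
      show "((\<lambda>r. - (u r * u r)) has_real_derivative (- (2 * u x * u' x))) (at x within {a..b})" if "x \<in> {a..b}" for x
      proof -
        have "x > 0" using that \<open>0 < a\<close> by simp
        note ux = u[OF this]
        have "((\<lambda>r. - (u r * u r)) has_real_derivative (- (u' x * u x + u' x * u x))) (at x)"
          by (rule DERIV_minus[OF DERIV_mult[OF ux ux]])
        then show ?thesis by (rule has_field_derivative_at_within[OF DERIV_cong]) simp
      qed
      show "continuous_on {a..b} (\<lambda>x. - (2 * u x * u' x))"
        using sub by (intro continuous_intros continuous_on_subset[OF cu(1)] continuous_on_subset[OF cu(2)]) auto
    qed
    moreover have "abs_cont_on {a..b} (\<lambda>r. 2 * w r)"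
    proof (rule abs_cont_on_continuous_derivative)
      show "((\<lambda>r. 2 * w r) has_real_derivative (2 * (q x - (w x)\<^sup>2))) (at x within {a..b})" if "x \<in> {a..b}" for x
      proof -
        have "x > 0" using that \<open>0 < a\<close> by simp
        show ?thesis by (rule has_field_derivative_at_within[OF DERIV_cmult[OF w[OF \<open>x > 0\<close>]]])
      qed
      show "continuous_on {a..b} (\<lambda>x. 2 * (q x - (w x)\<^sup>2))"
        unfolding q_def using sub \<open>0 < a\<close>
        by (intro continuous_intros continuous_on_subset[OF cu(1)] continuous_on_subset[OF cu(3)]) auto
    qed
    ultimately have "abs_cont_on {a..b} (\<lambda>r. (v r * v r + - (u r * u r)) * (2 * w r))"
      by (rule abs_cont_on_mult[OF abs_cont_on_add[OF abs_cont_on_mult[OF v[OF that] v[OF that]]]])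
    then show ?thesis by (simp add: H_def[abs_def])
  qed
  \<comment> \<open>The factor \<open>v^2 - u^2\<close> of \<open>H\<close> tends to 0 at both ends;
    boundedness of \<open>w\<close> is what carries this over to \<open>H\<close>.\<close>
  have wbd: "\<bar>w r\<bar> \<le> M" if "r > 0" for r
    using bd[OF that] pos[OF that] by (simp add: w_def field_simps)
  have Hlim: "(H \<longlongrightarrow> 0) F" if "eventually (\<lambda>r. r > 0) F" "((\<lambda>r. v r * v r - u r * u r) \<longlongrightarrow> 0) F" for F
    unfolding H_def
  proof (rule lim_null_mult_right_bounded[where B = "2 * M", OF that(2)])
    show "\<forall>\<^sub>F r in F. norm (2 * w r) \<le> 2 * M" using that(1) by eventually_elim (use wbd in \<open>auto simp: abs_mult\<close>)
  qed
  have "(\<integral>\<^sup>+r\<in>{0<..}. ennreal (energy_density ?c u r + ((u r)\<^sup>2 - (v r)\<^sup>2)\<^sup>2 / r\<^sup>2) \<partial>lebesgue)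
    \<le> (\<integral>\<^sup>+r\<in>{0<..}. ennreal (energy_density ?c v r) \<partial>lebesgue)"
  proof (rule nn_integral_comparison[OF _ _ ac N])
    have "continuous_on {0<..} (\<lambda>r. 2 * (u' r)\<^sup>2 + (1 - (u r)\<^sup>2)\<^sup>2 / r\<^sup>2 + ?c * (u r)\<^sup>2 + ((u r)\<^sup>2 - (v r)\<^sup>2)\<^sup>2
      / r\<^sup>2)"
      by (intro continuous_intros cu cv) auto
    then show "continuous_on {0<..} (\<lambda>r. energy_density ?c u r + ((u r)\<^sup>2 - (v r)\<^sup>2)\<^sup>2 / r\<^sup>2)"
      by (rule continuous_on_eq) (use DERIV_imp_deriv[OF u] in auto)
    show "0 \<le> energy_density ?c u r + ((u r)\<^sup>2 - (v r)\<^sup>2)\<^sup>2 / r\<^sup>2" "0 \<le> energy_density ?c v r" for r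
      using c by auto
    show "energy_density ?c v \<in> borel_measurable (lebesgue_on {a..b})" if "0 < a" "a \<le> b" for a b
      using energy_density_measurable[OF v[OF that] that] .
    show "(H \<longlongrightarrow> 0) (at_right 0)" "(H \<longlongrightarrow> 0) at_top"
      using tendsto_diff[OF tendsto_mult[OF vl(1) vl(1)] tendsto_mult[OF ul(1) ul(1)]]
        tendsto_diff[OF tendsto_mult[OF vl(2) vl(2)] tendsto_mult[OF ul(2) ul(2)]]
      by (auto intro!: Hlim eventually_gt_at_top simp: eventually_at_right_less)
    fix r :: real assume r: "r > 0" "r \<notin> N"
    then have vd: "(v has_real_derivative (deriv v r)) (at r)"
      by (auto simp: N_def DERIV_deriv_iff_real_differentiable)
    let ?h = "(2 * v r * deriv v r - 2 * u r * u' r) * (2 * w r) + (v r * v r - u r * u r) * (2 * (q r - (w r)\<^sup>2))"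
    show "(H has_real_derivative ?h) (at r)"
    proof -
      note ux = u[OF r(1)]
      have "(H has_real_derivative ((deriv v r * v r + deriv v r * v r - (u' r * u r + u' r * u r)) * (2 * w r)
          + 2 * (q r - (w r)\<^sup>2) * (v r * v r - u r * u r))) (at r)"
        unfolding H_def[abs_def]
        by (rule DERIV_mult[OF DERIV_diff[OF DERIV_mult[OF vd vd] DERIV_mult[OF ux ux]] DERIV_cmult[OF w[OF r(1)]]])
      then show ?thesis by (simp add: algebra_simps)
    qed
    have "u' r = w r * u r" using pos[OF r(1)] by (simp add: w_def)
    \<comment> \<open>With \<open>u' = w u\<close> every term cancels except the completed
      square.\<close>
    then have "energy_density ?c v r - (energy_density ?c u r + ((u r)\<^sup>2 - (v r)\<^sup>2)\<^sup>2 / r\<^sup>2 + ?h) = 2 * (deriv v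
      r - w r * v r)\<^sup>2"
      unfolding DERIV_imp_deriv[OF u[OF r(1)]] q_def divide_inverse
      by (simp add: power2_eq_square algebra_simps)
    also have "\<dots> \<ge> 0" by simp
    finally show "energy_density ?c u r + ((u r)\<^sup>2 - (v r)\<^sup>2)\<^sup>2 / r\<^sup>2 + ?h \<le> energy_density ?c v r" by simp
  qed
  then show ?thesis by (simp add: energy_def)
qed

section \<open>Solutions of the profile equation\<close>

lemma interior_max_second_derivative:
  fixes z z1 :: "real \<Rightarrow> real"
  assumes S: "open S" "x \<in> S" and z: "\<And>r. r \<in> S \<Longrightarrow> (z has_real_derivative z1 r) (at r)"
    and z1: "(z1 has_real_derivative z2) (at x)" and max: "\<And>y. y \<in> S \<Longrightarrow> z y \<le> z x"
  shows "z2 \<le> 0"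
proof (rule ccontr)
  assume "\<not> z2 \<le> 0"
  obtain e where e: "e > 0" "ball x e \<subseteq> S" using S openE by blast
  have "z1 x = 0"
    by (rule DERIV_local_max[OF z[OF S(2)] e(1)]) (use e max in \<open>auto simp: dist_real_def\<close>)
  obtain d where d: "d > 0" "\<And>h. 0 < h \<Longrightarrow> h < d \<Longrightarrow> z1 x < z1 (x + h)"
    using DERIV_pos_inc_right[OF z1] \<open>\<not> z2 \<le> 0\<close> by auto
  define h where "h = min d e / 2"
  have h: "0 < h" "h < d" "h < e" using d e by (auto simp: h_def)
  have sub: "{x..x+h} \<subseteq> S" using e h by (force simp: dist_real_def)
  obtain \<xi> where \<xi>: "x < \<xi>" "\<xi> < x + h" "z (x + h) - z x = (x + h - x) * z1 \<xi>"
    using MVT2[of x "x + h" z z1] h z sub by (auto simp: subset_iff)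
  have "z1 \<xi> > 0" using d(2)[of "\<xi> - x"] \<xi> h \<open>z1 x = 0\<close> by auto
  then have "h * z1 \<xi> > 0" using h by simp
  then have "z (x + h) > z x" using \<xi>(3) by simp
  moreover have "x + h \<in> S" using sub h by auto
  ultimately show False using max by force
qed

text \<open>The boundary condition is phrased through compact subsets, so finite endpoints and
  infinity are treated alike: a positive value forces an interior maximum, where
  \<open>z2 > 0\<close> is impossible.\<close>

lemma maximum_principle_open:
  fixes z z1 z2 :: "real \<Rightarrow> real"
  assumes S: "open S" and z: "\<And>r. r \<in> S \<Longrightarrow> (z has_real_derivative z1 r) (at r)"
    and z1: "\<And>r. r \<in> S \<Longrightarrow> (z1 has_real_derivative z2 r) (at r)"
    and bdry: "\<And>e. e > 0 \<Longrightarrow> \<exists>K. compact K \<and> K \<subseteq> S \<and> (\<forall>r\<in>S - K. z r < e)"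
    and pos: "\<And>r. r \<in> S \<Longrightarrow> z r > 0 \<Longrightarrow> z2 r > 0"
    and r: "r \<in> S"
  shows "z r \<le> 0"
proof (rule ccontr)
  assume "\<not> z r \<le> 0"
  then have "z r > 0" by simp
  from bdry[OF this] obtain K where K: "compact K" "K \<subseteq> S" "\<And>s. s \<in> S - K \<Longrightarrow> z s < z r" by blast
  have "r \<in> K" using K(3) r by force
  have "continuous_on K z" using z K(2) by (auto intro!: continuous_at_imp_continuous_on DERIV_isCont)
  then obtain x where x: "x \<in> K" "\<And>y. y \<in> K \<Longrightarrow> z y \<le> z x"
    using continuous_attains_sup[OF K(1)] \<open>r \<in> K\<close> by blast
  have "z y \<le> z x" if "y \<in> S" for y
    using x K(3)[of y] \<open>r \<in> K\<close> that by (cases "y \<in> K") (auto intro: less_imp_le less_le_trans)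
  then have "z2 x \<le> 0" using interior_max_second_derivative[OF S _ z z1] x(1) K(2) by blast
  moreover have "z x > 0" using x \<open>r \<in> K\<close> \<open>z r > 0\<close> by (auto intro: less_le_trans)
  ultimately show False using pos[of x] x(1) K(2) by auto
qed

lemma maximum_principle_halfline:
  fixes z z1 z2 :: "real \<Rightarrow> real"
  assumes z: "\<And>r. r > a \<Longrightarrow> (z has_real_derivative z1 r) (at r)"
    and z1: "\<And>r. r > a \<Longrightarrow> (z1 has_real_derivative z2 r) (at r)"
    and b1: "\<And>e. e > 0 \<Longrightarrow> eventually (\<lambda>r. z r < e) (at_right a)"
    and b2: "\<And>e. e > 0 \<Longrightarrow> eventually (\<lambda>r. z r < e) at_top"
    and pos: "\<And>r. r > a \<Longrightarrow> z r > 0 \<Longrightarrow> z2 r > 0" and r: "r > a"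
  shows "z r \<le> 0"
proof (rule maximum_principle_open[of "{a<..}" z z1 z2])
  fix e :: real assume "e > 0"
  obtain c where c: "c > a" "\<And>y. y > a \<Longrightarrow> y < c \<Longrightarrow> z y < e"
    using b1[OF \<open>e > 0\<close>] by (auto simp: eventually_at_right_field)
  obtain d where d: "\<And>y. y \<ge> d \<Longrightarrow> z y < e"
    using b2[OF \<open>e > 0\<close>] by (auto simp: eventually_at_top_linorder)
  show "\<exists>K. compact K \<and> K \<subseteq> {a<..} \<and> (\<forall>r\<in>{a<..} - K. z r < e)"
    by (intro exI[of _ "{c..d}"]) (use c d in auto)
qed (use assms in auto)

lemma maximum_principle_interval:
  fixes z z1 z2 :: "real \<Rightarrow> real"
  assumes z: "\<And>r. a < r \<Longrightarrow> r < b \<Longrightarrow> (z has_real_derivative z1 r) (at r)"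
    and z1: "\<And>r. a < r \<Longrightarrow> r < b \<Longrightarrow> (z1 has_real_derivative z2 r) (at r)"
    and b1: "\<And>e. e > 0 \<Longrightarrow> eventually (\<lambda>r. z r < e) (at_right a)"
    and b2: "\<And>e. e > 0 \<Longrightarrow> eventually (\<lambda>r. z r < e) (at_left b)"
    and pos: "\<And>r. a < r \<Longrightarrow> r < b \<Longrightarrow> z r > 0 \<Longrightarrow> z2 r > 0" and r: "a < r" "r < b"
  shows "z r \<le> 0"
proof (rule maximum_principle_open[of "{a<..<b}" z z1 z2])
  fix e :: real assume "e > 0"
  obtain c where c: "c > a" "\<And>y. y > a \<Longrightarrow> y < c \<Longrightarrow> z y < e"
    using b1[OF \<open>e > 0\<close>] by (auto simp: eventually_at_right_field)
  obtain d where d: "d < b" "\<And>y. y > d \<Longrightarrow> y < b \<Longrightarrow> z y < e"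
    using b2[OF \<open>e > 0\<close>] by (auto simp: eventually_at_left_field)
  show "\<exists>K. compact K \<and> K \<subseteq> {a<..<b} \<and> (\<forall>r\<in>{a<..<b} - K. z r < e)"
    by (intro exI[of _ "{c..d}"]) (use c d in auto)
qed (use assms in auto)

text \<open>The growing term \<open>\<delta> exp (k (s - R))\<close> of the barrier replaces a boundary condition at infinity, where \<open>u\<close> is
  only known to be bounded.\<close>

lemma decay_upper:
  fixes u u' Q :: "real \<Rightarrow> real"
  assumes k: "k > 0"
    and u: "\<And>r. r \<ge> R \<Longrightarrow> (u has_real_derivative u' r) (at r)"
    and u': "\<And>r. r \<ge> R \<Longrightarrow> (u' has_real_derivative (Q r * u r)) (at r)"
    and Q: "\<And>r. r \<ge> R \<Longrightarrow> Q r \<ge> k\<^sup>2" and bd: "\<And>r. r \<ge> R \<Longrightarrow> u r \<le> B" and r: "r > R"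
  shows "u r \<le> \<bar>u R\<bar> * exp (- k * (r - R))"
proof (rule field_le_epsilon)
  fix \<epsilon> :: real assume "\<epsilon> > 0"
  \<comment> \<open>Normalized so that the growing term equals \<open>\<epsilon>\<close> exactly at
    the point \<open>r\<close> under consideration.\<close>
  define \<delta> where "\<delta> = \<epsilon> * exp (- k * (r - R))"
  have \<delta>: "\<delta> > 0" "\<delta> * exp (k * (r - R)) = \<epsilon>" using \<open>\<epsilon> > 0\<close> by (auto simp: \<delta>_def mult.assoc exp_add[symmetric])
  define z where "z s = u s - \<bar>u R\<bar> * exp (- k * (s - R)) - \<delta> * exp (k * (s - R))" for s
  define z1 where "z1 s = u' s + k * \<bar>u R\<bar> * exp (- k * (s - R)) - k * \<delta> * exp (k * (s - R))" for s
  define z2 where "z2 s = Q s * u s - k\<^sup>2 * \<bar>u R\<bar> * exp (- k * (s - R)) - k\<^sup>2 * \<delta> * exp (k * (s - R))" for s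
  have "z r \<le> 0"
  proof (rule maximum_principle_halfline[of R z z1 z2])
    fix s assume "s > R"
    then show "(z has_real_derivative z1 s) (at s)" "(z1 has_real_derivative z2 s) (at s)"
      unfolding z_def z1_def z2_def using u[of s] u'[of s]
      by (auto intro!: derivative_eq_intros simp: power2_eq_square)
    assume "z s > 0"
    have "\<bar>u R\<bar> * exp (- k * (s - R)) + \<delta> * exp (k * (s - R)) \<ge> 0" using \<delta> by simp
    with \<open>z s > 0\<close> have "u s > 0" by (simp add: z_def)
    then have "Q s * u s \<ge> k\<^sup>2 * u s" using Q[of s] \<open>s > R\<close> by (intro mult_right_mono) auto
    \<comment> \<open>Both exponentials solve \<open>y'' = k^2 y\<close>, so only the comparison of
      \<open>Q\<close> with \<open>k^2\<close> enters.\<close>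
    then have "z2 s \<ge> k\<^sup>2 * z s" by (simp add: z_def z2_def algebra_simps)
    moreover have "k\<^sup>2 * z s > 0" using k \<open>z s > 0\<close> by simp
    ultimately show "z2 s > 0" by linarith
  next
    fix e :: real assume "e > 0"
    have "isCont u R" using u[of R] by (auto intro: DERIV_isCont)
    then have "isCont z R" unfolding z_def by (intro continuous_intros) auto
    then have "(z \<longlongrightarrow> z R) (at_right R)"
      by (auto simp: isCont_def intro: tendsto_within_subset filterlim_at_split[THEN iffD1, THEN conjunct2])
    moreover have "z R < e" using \<delta> \<open>e > 0\<close> by (simp add: z_def)
    ultimately show "eventually (\<lambda>r. z r < e) (at_right R)" by (rule order_tendstoD(2))
    have "filterlim (\<lambda>s. \<delta> * exp (k * (s - R))) at_top at_top"
      using k \<delta>(1) by real_asymp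
    then have "eventually (\<lambda>s. \<delta> * exp (k * (s - R)) > B) at_top" by (simp add: filterlim_at_top_dense)
    then show "eventually (\<lambda>r. z r < e) at_top"
      using eventually_ge_at_top[of R]
    proof eventually_elim
      case (elim s)
      have "0 \<le> \<bar>u R\<bar> * exp (- k * (s - R))" by simp
      with elim bd[of s] \<open>e > 0\<close> show ?case unfolding z_def by linarith
    qed
  qed (use r in auto)
  then show "u r \<le> \<bar>u R\<bar> * exp (- k * (r - R)) + \<epsilon>" unfolding z_def using \<delta>(2) by linarith
qed

lemma decay_bound:
  fixes u u' Q :: "real \<Rightarrow> real"
  assumes k: "k > 0"
    and u: "\<And>r. r \<ge> R \<Longrightarrow> (u has_real_derivative u' r) (at r)"
    and u': "\<And>r. r \<ge> R \<Longrightarrow> (u' has_real_derivative (Q r * u r)) (at r)"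
    and Q: "\<And>r. r \<ge> R \<Longrightarrow> Q r \<ge> k\<^sup>2" and bd: "\<And>r. r \<ge> R \<Longrightarrow> \<bar>u r\<bar> \<le> B" and r: "r \<ge> R"
  shows "\<bar>u r\<bar> \<le> \<bar>u R\<bar> * exp (- k * (r - R))"
proof (cases "r = R")
  case False
  then have r: "r > R" using r by simp
  have "u r \<le> \<bar>u R\<bar> * exp (- k * (r - R))"
    by (rule decay_upper[OF k u u' Q _ r, of B]) (use bd in \<open>auto simp: abs_le_iff\<close>)
  moreover have "- u r \<le> \<bar>- u R\<bar> * exp (- k * (r - R))"
    by (rule decay_upper[of k R "\<lambda>r. - u r" "\<lambda>r. - u' r" Q B, OF k _ _ Q _ r])
       (use bd u u' in \<open>auto simp: abs_le_iff intro!: derivative_eq_intros\<close>)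
  ultimately show ?thesis by simp
qed simp

section \<open>Asymptotics of arbitrary solutions at infinity and at the origin\<close>

locale profile =
  fixes m :: real and u u' :: "real \<Rightarrow> real"
  assumes m: "m > 0"
    and DERIV_u: "\<And>r. r > 0 \<Longrightarrow> (u has_real_derivative u' r) (at r)"
    and DERIV_u': "\<And>r. r > 0 \<Longrightarrow> (u' has_real_derivative ((m\<^sup>2 + ((u r)\<^sup>2 - 1) / r\<^sup>2) * u r)) (at r)"
    and lim_0: "(u \<longlongrightarrow> 1) (at_right 0)" and lim_infinity: "(u \<longlongrightarrow> 0) at_top"
begin

text \<open>Reading the equation as the linear one \<open>u'' = Q u\<close> lets decay and
  positivity be drawn from bounds on \<open>Q\<close>.\<close>

abbreviation Q :: "real \<Rightarrow> real" where "Q r \<equiv> m\<^sup>2 + ((u r)\<^sup>2 - 1) / r\<^sup>2"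

lemma isCont_u: "r > 0 \<Longrightarrow> isCont u r" and isCont_u': "r > 0 \<Longrightarrow> isCont u' r"
  using DERIV_u DERIV_u' DERIV_isCont by blast+

lemma Q_ge_near_infinity:
  assumes "0 < k" "k < m"
  obtains R where "R \<ge> 1" "\<And>r. r \<ge> R \<Longrightarrow> Q r \<ge> k\<^sup>2" "\<And>r. r \<ge> R \<Longrightarrow> \<bar>u r\<bar> \<le> 1"
proof -
  have pos: "m\<^sup>2 - k\<^sup>2 > 0" using assms by (simp add: power_strict_mono)
  have "eventually (\<lambda>r. \<bar>u r\<bar> < 1) at_top"
    using order_tendstoD(2)[OF tendsto_rabs[OF lim_infinity], of 1] by simp
  then obtain R1 where R1: "\<And>r. r \<ge> R1 \<Longrightarrow> \<bar>u r\<bar> < 1" by (auto simp: eventually_at_top_linorder)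
  \<comment> \<open>Beyond \<open>R\<close> the deficit \<open>1 / r^2\<close> in
    \<open>Q \<ge> m^2 - 1 / r^2\<close> is at most \<open>m^2 - k^2\<close>.\<close>
  define R where "R = max (max 1 R1) (1 / sqrt (m\<^sup>2 - k\<^sup>2))"
  show ?thesis
  proof (rule that[of R])
    fix r assume r: "r \<ge> R"
    then have "r > 0" "r \<ge> 1 / sqrt (m\<^sup>2 - k\<^sup>2)" by (auto simp: R_def)
    then have "1 / r \<le> sqrt (m\<^sup>2 - k\<^sup>2)" using pos by (simp add: field_simps)
    then have "(1 / r)\<^sup>2 \<le> (sqrt (m\<^sup>2 - k\<^sup>2))\<^sup>2" using \<open>r > 0\<close> by (intro power_mono) auto
    then have "1 / r\<^sup>2 \<le> m\<^sup>2 - k\<^sup>2" using pos by (simp add: power_divide)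
    moreover have "((u r)\<^sup>2 - 1) / r\<^sup>2 \<ge> - 1 / r\<^sup>2" by (intro divide_right_mono) auto
    ultimately show "Q r \<ge> k\<^sup>2" by simp
    show "\<bar>u r\<bar> \<le> 1" using R1[of r] r by (simp add: R_def)
  qed (simp add: R_def)
qed

text \<open>The barrier controls \<open>u\<close> only. For \<open>u'\<close>, the mean value
  theorem on a unit interval yields a point where \<open>u'\<close> is a difference of values of
  \<open>u\<close>, and \<open>u'' = Q u\<close> with bounded \<open>Q\<close> carries the estimate
  back to \<open>r\<close>.\<close>

lemma exponential_decay:
  assumes "0 < k" "k < m"
  obtains A R where "A \<ge> 0" "R \<ge> 1" "\<And>r. r \<ge> R \<Longrightarrow> \<bar>u r\<bar> \<le> A * exp (- k * r)" "\<And>r. r \<ge> R \<Longrightarrow> \<bar>u' r\<bar> \<le> A * exp (- k * r)"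
proof -
  obtain R where R: "R \<ge> 1" "\<And>r. r \<ge> R \<Longrightarrow> Q r \<ge> k\<^sup>2" "\<And>r. r \<ge> R \<Longrightarrow> \<bar>u r\<bar> \<le> 1"
    using Q_ge_near_infinity[OF assms] by blast
  define A where "A = \<bar>u R\<bar> * exp (k * R)"
  have A: "A \<ge> 0" by (simp add: A_def)
  have ub: "\<bar>u r\<bar> \<le> A * exp (- k * r)" if "r \<ge> R" for r
  proof -
    have "\<bar>u r\<bar> \<le> \<bar>u R\<bar> * exp (- k * (r - R))"
      by (rule decay_bound[of k R u u' Q 1, OF assms(1) _ _ R(2,3) that]) (use R(1)
        in \<open>auto intro!: DERIV_u DERIV_u'\<close>)
    also have "\<dots> = A * exp (- k * r)" by (simp add: A_def exp_add[symmetric] algebra_simps)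
    finally show ?thesis .
  qed
  define C where "C = (m\<^sup>2 + 1) * A"
  have C: "C \<ge> 0" using A by (simp add: C_def)
  have Qb: "\<bar>Q r * u r\<bar> \<le> C * exp (- k * r)" if "r \<ge> R" for r
  proof -
    have "r \<ge> 1" using that R by linarith
    then have "(u r)\<^sup>2 \<le> 1" using R(3)[OF that] by (simp add: abs_square_le_1)
    then have "\<bar>((u r)\<^sup>2 - 1) / r\<^sup>2\<bar> \<le> 1 / 1"
      unfolding abs_divide using \<open>r \<ge> 1\<close> by (intro frac_le) auto
    then have "\<bar>Q r\<bar> \<le> m\<^sup>2 + 1" by (intro order_trans[OF abs_triangle_ineq]) auto
    then have "\<bar>Q r\<bar> * \<bar>u r\<bar> \<le> (m\<^sup>2 + 1) * (A * exp (- k * r))" using ub[OF that] by (intro mult_mono) auto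
    then show ?thesis by (simp add: C_def abs_mult mult.assoc)
  qed
  have u'b: "\<bar>u' r\<bar> \<le> (2 * A + C) * exp (- k * r)" if r: "r \<ge> R" for r
  proof -
    have dec: "exp (- k * s) \<le> exp (- k * r)" if "s \<ge> r" for s using that assms by simp
    obtain \<xi> where \<xi>: "r < \<xi>" "\<xi> < r + 1" "u (r + 1) - u r = (r + 1 - r) * u' \<xi>"
      using MVT2[of r "r + 1" u u'] R r DERIV_u by auto
    have "\<bar>u' \<xi>\<bar> \<le> \<bar>u (r + 1)\<bar> + \<bar>u r\<bar>" using \<xi>(3) by simp
    also have "\<dots> \<le> A * exp (- k * r) + A * exp (- k * r)"
      using ub[of "r + 1"] ub[of r] r A dec[of "r + 1"] mult_left_mono[OF dec[of "r + 1"] A] by auto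
    finally have 1: "\<bar>u' \<xi>\<bar> \<le> 2 * A * exp (- k * r)" by simp
    obtain \<zeta> where \<zeta>: "r < \<zeta>" "\<zeta> < \<xi>" "u' \<xi> - u' r = (\<xi> - r) * (Q \<zeta> * u \<zeta>)"
      using MVT2[of r \<xi> u' "\<lambda>r. Q r * u r"] R r \<xi> DERIV_u' by auto
    have "\<bar>u' \<xi> - u' r\<bar> = (\<xi> - r) * \<bar>Q \<zeta> * u \<zeta>\<bar>" using \<zeta> by (simp add: abs_mult)
    also have "\<dots> \<le> 1 * (C * exp (- k * \<zeta>))" using \<xi> \<zeta> r Qb[of \<zeta>] by (intro mult_mono) auto
    also have "\<dots> \<le> C * exp (- k * r)" using mult_left_mono[OF dec[of \<zeta>] C] \<zeta> by simp
    finally show ?thesis using 1 by (simp add: algebra_simps)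
  qed
  show ?thesis
  proof (rule that[of "2 * A + C" R])
    show "\<bar>u r\<bar> \<le> (2 * A + C) * exp (- k * r)" if "r \<ge> R" for r
      by (rule order_trans[OF ub[OF that]]) (use A C in \<open>auto intro!: mult_right_mono\<close>)
  qed (use A C R u'b in auto)
qed

lemma deriv_lim_infinity: "(u' \<longlongrightarrow> 0) at_top"
proof -
  obtain A R where AR: "A \<ge> 0" "\<And>r. r \<ge> R \<Longrightarrow> \<bar>u' r\<bar> \<le> A * exp (- (m / 2) * r)"
    by (rule exponential_decay[of "m / 2"]) (use m in auto)
  show ?thesis
  proof (rule Lim_null_comparison)
    show "eventually (\<lambda>r. norm (u' r) \<le> A * exp (- (m / 2) * r)) at_top"
      using eventually_ge_at_top[of R] by eventually_elim (use AR in auto)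
    show "((\<lambda>r. A * exp (- (m / 2) * r)) \<longlongrightarrow> 0) at_top" using m by real_asymp
  qed
qed

text \<open>Writing \<open>g = u - 1\<close>, the equation is \<open>g'' = m\<^sup>2 u + u (u + 1) g / r\<^sup>2\<close> with \<open>u (u + 1) \<ge> 1\<close> near the origin,
  for which multiples of \<open>r\<^sup>3\<^sup>/\<^sup>2\<close> are supersolutions (the true size is \<open>r\<^sup>2 ln r\<close>).\<close>

lemma behaviour_near_0:
  obtains C \<delta> where "C > 0" "0 < \<delta>" "\<delta> \<le> 1" "\<And>r. 0 < r \<Longrightarrow> r < \<delta> \<Longrightarrow> 3/4 < u r \<and> u r < 2"
    "\<And>r. 0 < r \<Longrightarrow> r < \<delta> \<Longrightarrow> \<bar>u r - 1\<bar> \<le> C * (r * sqrt r)"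
proof -
  have "eventually (\<lambda>r. 3/4 < u r \<and> u r < 2) (at_right 0)"
    using order_tendstoD(1)[OF lim_0, of "3/4"] order_tendstoD(2)[OF lim_0, of 2] by (auto intro: eventually_conj)
  then obtain \<delta>0 where \<delta>0: "\<delta>0 > 0" "\<And>r. 0 < r \<Longrightarrow> r < \<delta>0 \<Longrightarrow> 3/4 < u r \<and> u r < 2"
    by (auto simp: eventually_at_right_field)
  define \<delta> where "\<delta> = min 1 (\<delta>0 / 2)"
  have \<delta>: "0 < \<delta>" "\<delta> \<le> 1" "\<And>r. 0 < r \<Longrightarrow> r \<le> \<delta> \<Longrightarrow> 3/4 < u r \<and> u r < 2" using \<delta>0 by (auto simp: \<delta>_def)
  \<comment> \<open>\<open>C > 8 m^2\<close> makes a quarter of the barrier's strength exceed the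
    source \<open>2 m^2\<close>; the second entry makes the barrier dominate at
    \<open>\<delta>\<close>.\<close>
  define C where "C = max (8 * m\<^sup>2 + 1) (\<bar>u \<delta> - 1\<bar> / (\<delta> * sqrt \<delta>))"
  have C: "C > 8 * m\<^sup>2" "C > 0" "\<bar>u \<delta> - 1\<bar> \<le> C * (\<delta> * sqrt \<delta>)"
  proof -
    show "C > 8 * m\<^sup>2" by (simp add: C_def)
    then show "C > 0" by (meson le_less_trans zero_le_power2 mult_nonneg_nonneg zero_le_numeral)
    have "\<bar>u \<delta> - 1\<bar> / (\<delta> * sqrt \<delta>) \<le> C" by (simp add: C_def)
    then show "\<bar>u \<delta> - 1\<bar> \<le> C * (\<delta> * sqrt \<delta>)" using \<delta>(1) by (simp add: field_simps)
  qed
  have main: "\<sigma> * (u r - 1) - C * (r * sqrt r) \<le> 0" if \<sigma>: "\<sigma> = 1 \<or> \<sigma> = -1" and r: "0 < r" "r < \<delta>" for r \<sigma> :: real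
  proof (rule maximum_principle_interval[of 0 \<delta> "\<lambda>r. \<sigma> * (u r - 1) - C * (r * sqrt r)"
    "\<lambda>r. \<sigma> * u' r - C * (3/2 * sqrt r)"
        "\<lambda>r. \<sigma> * (Q r * u r) - C * (3/4 / sqrt r)"])
    fix r assume r: "0 < r" "r < \<delta>"
    have sq: "r / sqrt r = sqrt r" "sqrt r > 0" using r by (auto simp: real_div_sqrt)
    have "((\<lambda>r. r * sqrt r) has_real_derivative (3/2 * sqrt r)) (at r)"
      using r sq(1) by (auto intro!: derivative_eq_intros simp: field_simps)
    from DERIV_diff[OF DERIV_cmult[OF DERIV_diff[OF DERIV_u[OF r(1)] DERIV_const[of 1]], of \<sigma>] DERIV_cmult[OF
      this, of C]]
    show "((\<lambda>r. \<sigma> * (u r - 1) - C * (r * sqrt r)) has_real_derivative \<sigma> * u' r - C * (3/2 * sqrt r)) (at r)" by simp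
    have "((\<lambda>r. 3/2 * sqrt r) has_real_derivative (3/4 / sqrt r)) (at r)"
      using r by (auto intro!: derivative_eq_intros simp: field_simps)
    from DERIV_diff[OF DERIV_cmult[OF DERIV_u'[OF r(1)], of \<sigma>] DERIV_cmult[OF this, of C]]
    show "((\<lambda>r. \<sigma> * u' r - C * (3/2 * sqrt r)) has_real_derivative \<sigma> * (Q r * u r) - C * (3/4 / sqrt r)) (at r)"
      by simp
    assume z: "0 < \<sigma> * (u r - 1) - C * (r * sqrt r)"
    have ur: "3/4 < u r" "u r < 2" using \<delta>(3)[of r] r by auto
    \<comment> \<open>\<open>3/4 * 7/4 = 21/16\<close>: this is the reason for the threshold
      \<open>3/4\<close>.\<close>
    have "u r * (u r + 1) \<ge> 3/4 * (3/4 + 1)" using ur by (intro mult_mono) auto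
    then have uu: "u r * (u r + 1) \<ge> 1" by simp
    have "C * (r * sqrt r) \<ge> 0" using r C by simp
    then have gpos: "\<sigma> * (u r - 1) \<ge> 0" using z by linarith
    have "\<sigma> * (Q r * u r) = \<sigma> * m\<^sup>2 * u r + (u r * (u r + 1)) * (\<sigma> * (u r - 1)) / r\<^sup>2"
      by (simp add: divide_inverse power2_eq_square algebra_simps)
    moreover have "(u r * (u r + 1)) * (\<sigma> * (u r - 1)) / r\<^sup>2 \<ge> C * (r * sqrt r) / r\<^sup>2"
      using mult_right_mono[OF uu gpos] z by (intro divide_right_mono) auto
    moreover have "C * (r * sqrt r) / r\<^sup>2 = C / sqrt r"
      using r real_sqrt_pow2[of r] by (simp add: divide_simps power2_eq_square)
    moreover have "\<sigma> * m\<^sup>2 * u r \<ge> - (m\<^sup>2 * 2)"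
    proof -
      have "m\<^sup>2 * u r \<le> m\<^sup>2 * 2" "0 \<le> m\<^sup>2 * u r" using ur by (auto intro!: mult_left_mono)
      then show ?thesis using \<sigma> by auto
    qed
    \<comment> \<open>The second derivative of \<open>r * sqrt r\<close> is only
      \<open>3/4 / sqrt r\<close>, while the singular term contributes at least
      \<open>1 / sqrt r\<close> per unit of \<open>C\<close>; the spare quarter absorbs
      \<open>m^2 u\<close>, of size at most \<open>2 m^2\<close>.\<close>
    moreover have "C * (1/4 / sqrt r) > m\<^sup>2 * 2"
    proof -
      have "sqrt r \<le> 1" using r \<delta> by simp
      then have "C \<le> C / sqrt r" using C(2) sq(2) by (simp add: field_simps)
      then show ?thesis using C(1) by simp
    qed
    moreover have "C * (3/4 / sqrt r) + C * (1/4 / sqrt r) = C / sqrt r" by (simp add: field_simps)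
    ultimately show "0 < \<sigma> * (Q r * u r) - C * (3/4 / sqrt r)" by linarith
  next
    fix e :: real assume "e > 0"
    have "((\<lambda>r. \<sigma> * (u r - 1) - C * (r * sqrt r)) \<longlongrightarrow> \<sigma> * (1 - 1) - C * (0 * sqrt 0)) (at_right 0)"
      by (intro tendsto_intros lim_0)
    then show "eventually (\<lambda>r. \<sigma> * (u r - 1) - C * (r * sqrt r) < e) (at_right 0)"
      by (rule order_tendstoD(2)) (use \<open>e > 0\<close> in simp)
    have "(u \<longlongrightarrow> u \<delta>) (at_left \<delta>)"
      using isCont_u[OF \<delta>(1)] by (auto simp: isCont_def intro: tendsto_within_subset filterlim_at_split[THEN
        iffD1, THEN conjunct1])
    then have "((\<lambda>r. \<sigma> * (u r - 1) - C * (r * sqrt r)) \<longlongrightarrow> \<sigma> * (u \<delta> - 1) - C * (\<delta> * sqrt \<delta>)) (at_left \<delta>)"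
      by (intro tendsto_intros)
    then show "eventually (\<lambda>r. \<sigma> * (u r - 1) - C * (r * sqrt r) < e) (at_left \<delta>)"
      by (rule order_tendstoD(2)) (use \<open>e > 0\<close> C(3) \<sigma> in auto)
  qed (use r in auto)
  show ?thesis
  proof (rule that[OF C(2) \<delta>(1,2)])
    show "3/4 < u r \<and> u r < 2" if "0 < r" "r < \<delta>" for r using \<delta>(3)[of r] that by auto
    show "\<bar>u r - 1\<bar> \<le> C * (r * sqrt r)" if "0 < r" "r < \<delta>" for r
      using main[of 1 r] main[of "-1" r] that by auto
  qed
qed

text \<open>From \<open>u - 1 = O(r^(3/2))\<close>, the mean value theorem on
  \<open>{r..2 * r}\<close> gives a point with \<open>u' = O(sqrt r)\<close>; there
  \<open>u'' = O(1 / sqrt r)\<close>, so moving back a distance below \<open>r\<close> costs another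
  \<open>O(sqrt r)\<close>.\<close>

lemma deriv_lim_0: "(u' \<longlongrightarrow> 0) (at_right 0)"
proof -
  obtain C \<delta> where C: "C > 0" and \<delta>: "0 < \<delta>" "\<delta> \<le> 1" and ub: "\<And>r. 0 < r \<Longrightarrow> r < \<delta> \<Longrightarrow> 3/4 < u r \<and> u r < 2"
    and g: "\<And>r. 0 < r \<Longrightarrow> r < \<delta> \<Longrightarrow> \<bar>u r - 1\<bar> \<le> C * (r * sqrt r)"
    using behaviour_near_0 by metis
  have u''b: "\<bar>Q r * u r\<bar> \<le> 2 * m\<^sup>2 + 6 * C / sqrt r" if r: "0 < r" "r < \<delta>" for r
  proof -
    have ur: "0 < u r" "u r < 2" using ub[OF r] by auto
    have "Q r * u r = m\<^sup>2 * u r + (u r * (u r + 1)) * (u r - 1) / r\<^sup>2"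
      by (simp add: divide_inverse power2_eq_square algebra_simps)
    also have "\<bar>\<dots>\<bar> \<le> \<bar>m\<^sup>2 * u r\<bar> + \<bar>(u r * (u r + 1)) * (u r - 1) / r\<^sup>2\<bar>" by (rule abs_triangle_ineq)
    also have "\<bar>m\<^sup>2 * u r\<bar> \<le> 2 * m\<^sup>2" using ur mult_left_mono[of "u r" 2 "m\<^sup>2"] by (simp add: abs_mult)
    also have "\<bar>(u r * (u r + 1)) * (u r - 1) / r\<^sup>2\<bar> \<le> (2 * 3) * (C * (r * sqrt r)) / r\<^sup>2"
      unfolding abs_mult abs_divide abs_power2 using ur g[OF r] r C by (intro divide_right_mono mult_mono) auto
    also have "\<dots> = 6 * C / sqrt r"
      using r real_sqrt_pow2[of r] by (simp add: divide_simps power2_eq_square)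
    finally show ?thesis by simp
  qed
  have bd: "\<bar>u' r\<bar> \<le> 11 * C * sqrt r + 2 * m\<^sup>2 * r" if r: "0 < r" "r < \<delta> / 2" for r
  proof -
    have sq: "sqrt r > 0" "sqrt r * sqrt r = r" using r by auto
    obtain \<xi> where \<xi>: "r < \<xi>" "\<xi> < 2 * r" "u (2 * r) - u r = (2 * r - r) * u' \<xi>"
      using MVT2[of r "2 * r" u u'] r DERIV_u by auto
    have "sqrt (2 * r) \<le> 2 * sqrt r"
      by (rule real_le_lsqrt) (use r sq in \<open>auto simp: power2_eq_square\<close>)
    then have "2 * r * sqrt (2 * r) \<le> 2 * r * (2 * sqrt r)" using r by (intro mult_left_mono) auto
    then have "C * (2 * r * sqrt (2 * r)) \<le> C * (4 * (r * sqrt r))" using C by (intro mult_left_mono) auto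
    moreover have "\<bar>u (2 * r) - 1\<bar> \<le> C * (2 * r * sqrt (2 * r))" "\<bar>u r - 1\<bar> \<le> C * (r * sqrt r)"
      using g[of "2 * r"] g[of r] r by auto
    ultimately have "\<bar>r * u' \<xi>\<bar> \<le> C * (4 * (r * sqrt r)) + C * (r * sqrt r)" using \<xi>(3) by simp
    then have "r * \<bar>u' \<xi>\<bar> \<le> r * (5 * C * sqrt r)" using r by (simp add: abs_mult algebra_simps)
    then have 1: "\<bar>u' \<xi>\<bar> \<le> 5 * C * sqrt r" using r by simp
    obtain \<zeta> where \<zeta>: "r < \<zeta>" "\<zeta> < \<xi>" "u' \<xi> - u' r = (\<xi> - r) * (Q \<zeta> * u \<zeta>)"
      using MVT2[of r \<xi> u' "\<lambda>r. Q r * u r"] r \<xi> DERIV_u' by auto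
    have "\<bar>u' \<xi> - u' r\<bar> = (\<xi> - r) * \<bar>Q \<zeta> * u \<zeta>\<bar>" using \<zeta> by (simp add: abs_mult)
    also have "\<dots> \<le> r * (2 * m\<^sup>2 + 6 * C / sqrt \<zeta>)" using \<xi> \<zeta> r u''b[of \<zeta>] by (intro mult_mono) auto
    also have "\<dots> \<le> r * (2 * m\<^sup>2 + 6 * C / sqrt r)" using \<zeta> r C
      by (intro mult_left_mono add_left_mono divide_left_mono mult_pos_pos) auto
    also have "\<dots> = 2 * m\<^sup>2 * r + 6 * C * sqrt r" using sq by (simp add: field_simps)
    finally show ?thesis using 1 by linarith
  qed
  show ?thesis
  proof (rule Lim_null_comparison)
    show "eventually (\<lambda>r. norm (u' r) \<le> 11 * C * sqrt r + 2 * m\<^sup>2 * r) (at_right 0)"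
      unfolding eventually_at_right_field using bd \<delta> by (intro exI[of _ "\<delta> / 2"]) auto
    have "((\<lambda>r. 11 * C * sqrt r + 2 * m\<^sup>2 * r) \<longlongrightarrow> 11 * C * sqrt 0 + 2 * m\<^sup>2 * 0) (at_right 0)"
      by (intro tendsto_intros)
    then show "((\<lambda>r. 11 * C * sqrt r + 2 * m\<^sup>2 * r) \<longlongrightarrow> 0) (at_right 0)" by simp
  qed
qed

text \<open>\<open>B / (1 + r)^2\<close> has an elementary antiderivative. Near 0 the density is
  bounded because \<open>(1 - u^2)^2 = O(r^3)\<close>, near infinity because of exponential decay
  and the factor \<open>1 / r^2\<close>, and in between by compactness.\<close>

lemma integrand_bound:
  assumes c: "c \<ge> 0"
  obtains B where "B \<ge> 0" "\<And>r. r > 0 \<Longrightarrow> 2 * (u' r)\<^sup>2 + (1 - (u r)\<^sup>2)\<^sup>2 / r\<^sup>2 + c * (u r)\<^sup>2 \<le> B / (1 + r)\<^sup>2"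
proof -
  define \<phi> where "\<phi> r = (2 * (u' r)\<^sup>2 + (1 - (u r)\<^sup>2)\<^sup>2 / r\<^sup>2 + c * (u r)\<^sup>2) * (1 + r)\<^sup>2" for r
  obtain C \<delta> where C: "C > 0" and \<delta>: "0 < \<delta>" "\<delta> \<le> 1" and ub: "\<And>r. 0 < r \<Longrightarrow> r < \<delta> \<Longrightarrow> 3/4 < u r \<and> u r < 2"
    and g: "\<And>r. 0 < r \<Longrightarrow> r < \<delta> \<Longrightarrow> \<bar>u r - 1\<bar> \<le> C * (r * sqrt r)"
    using behaviour_near_0 by metis
  have "eventually (\<lambda>r. \<bar>u' r\<bar> < 1) (at_right 0)"
    using order_tendstoD(2)[OF tendsto_rabs[OF deriv_lim_0], of 1] by simp
  then obtain d where d: "d > 0" "\<And>r. 0 < r \<Longrightarrow> r < d \<Longrightarrow> \<bar>u' r\<bar> < 1" by (auto simp: eventually_at_right_field)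
  define e where "e = min d \<delta>"
  have e: "0 < e" using d \<delta> by (simp add: e_def)
  have near: "\<phi> r \<le> (2 + 9 * C\<^sup>2 + c * 4) * 4" if r: "0 < r" "r < e" for r
  proof -
    have r1: "r < 1" "r < \<delta>" "r < d" using r \<delta> by (auto simp: e_def)
    have ur: "0 < u r" "u r < 2" using ub[OF r(1) r1(2)] by auto
    have "(1 - (u r)\<^sup>2)\<^sup>2 = (u r - 1)\<^sup>2 * (1 + u r)\<^sup>2" by (simp add: power2_eq_square algebra_simps)
    also have "\<dots> \<le> (C * (r * sqrt r))\<^sup>2 * 3\<^sup>2"
    proof (intro mult_mono)
      show "(u r - 1)\<^sup>2 \<le> (C * (r * sqrt r))\<^sup>2"
        using power_mono[OF g[OF r(1) r1(2)] abs_ge_zero, of 2] by simp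
      show "(1 + u r)\<^sup>2 \<le> 3\<^sup>2" using ur by (intro power_mono) auto
    qed auto
    also have "\<dots> = 9 * C\<^sup>2 * r * r\<^sup>2" using r by (simp add: power_mult_distrib)
    also have "\<dots> \<le> 9 * C\<^sup>2 * 1 * r\<^sup>2" using r1 r by (intro mult_right_mono mult_left_mono) auto
    finally have "(1 - (u r)\<^sup>2)\<^sup>2 / r\<^sup>2 \<le> 9 * C\<^sup>2" using r by (simp add: field_simps)
    moreover have "(u' r)\<^sup>2 \<le> 1" using d(2)[OF r(1) r1(3)] by (simp add: abs_square_le_1)
    moreover have "(u r)\<^sup>2 \<le> 2\<^sup>2" using ur by (intro power_mono) auto
    then have "c * (u r)\<^sup>2 \<le> c * 4" using c by (intro mult_left_mono) auto
    moreover have "(1 + r)\<^sup>2 \<le> 4" using power_mono[of "1 + r" 2 2] r r1 by simp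
    ultimately have "2 * (u' r)\<^sup>2 + (1 - (u r)\<^sup>2)\<^sup>2 / r\<^sup>2 + c * (u r)\<^sup>2 \<le> 2 + 9 * C\<^sup>2 + c * 4" "(1 + r)\<^sup>2 \<le> 4"
      by linarith+
    then show ?thesis unfolding \<phi>_def using c by (intro mult_mono) auto
  qed
  obtain A R where AR: "A \<ge> 0" "R \<ge> 1" "\<And>r. r \<ge> R \<Longrightarrow> \<bar>u r\<bar> \<le> A * exp (- (m/2) * r)" "\<And>r. r \<ge> R \<Longrightarrow>
    \<bar>u' r\<bar> \<le> A * exp (- (m/2) * r)"
    by (rule exponential_decay[of "m / 2"]) (use m in auto)
  have "((\<lambda>r. (exp (- (m/2) * r))\<^sup>2 * (1 + r)\<^sup>2) \<longlongrightarrow> 0) at_top" using m by real_asymp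
  from tendsto_mult_right_zero[OF this, of "A\<^sup>2"]
  have "((\<lambda>r. (A * exp (- (m/2) * r))\<^sup>2 * (1 + r)\<^sup>2) \<longlongrightarrow> 0) at_top"
    by (simp add: power_mult_distrib mult.assoc)
  then have "eventually (\<lambda>r. (A * exp (- (m/2) * r))\<^sup>2 * (1 + r)\<^sup>2 < 1) at_top" by (rule order_tendstoD) simp
  moreover have "eventually (\<lambda>r. \<bar>u r\<bar> < 1) at_top"
    using order_tendstoD(2)[OF tendsto_rabs[OF lim_infinity], of 1] by simp
  ultimately have "eventually (\<lambda>r. \<phi> r \<le> 2 + 4 + c) at_top"
    using eventually_ge_at_top[of R]
  proof eventually_elim
    case (elim r)
    have r: "r \<ge> 1" using elim AR by linarith
    have "(u r)\<^sup>2 * (1 + r)\<^sup>2 \<le> (A * exp (- (m/2) * r))\<^sup>2 * (1 + r)\<^sup>2"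
      "(u' r)\<^sup>2 * (1 + r)\<^sup>2 \<le> (A * exp (- (m/2) * r))\<^sup>2 * (1 + r)\<^sup>2"
      using power_mono[OF AR(3)[OF elim(3)] abs_ge_zero, of 2] power_mono[OF AR(4)[OF elim(3)] abs_ge_zero, of 2]
      by (auto intro!: mult_right_mono)
    then have 1: "(u r)\<^sup>2 * (1 + r)\<^sup>2 \<le> 1" "(u' r)\<^sup>2 * (1 + r)\<^sup>2 \<le> 1" using elim by auto
    have "(u r)\<^sup>2 \<le> 1" using elim by (simp add: abs_square_le_1)
    then have "(1 - (u r)\<^sup>2)\<^sup>2 \<le> 1\<^sup>2" by (intro power_mono) auto
    moreover have "((1 + r) / r)\<^sup>2 \<le> 2\<^sup>2" using r by (intro power_mono) (auto simp: field_simps)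
    ultimately have "(1 - (u r)\<^sup>2)\<^sup>2 * ((1 + r) / r)\<^sup>2 \<le> 1\<^sup>2 * 2\<^sup>2" by (intro mult_mono) auto
    then have "(1 - (u r)\<^sup>2)\<^sup>2 / r\<^sup>2 * (1 + r)\<^sup>2 \<le> 4" by (simp add: power_divide)
    moreover have "c * ((u r)\<^sup>2 * (1 + r)\<^sup>2) \<le> c * 1" using 1 c by (intro mult_left_mono) auto
    ultimately show ?case using 1 unfolding \<phi>_def by (simp add: algebra_simps)
  qed
  then obtain R2 where R2: "\<And>r. r \<ge> R2 \<Longrightarrow> \<phi> r \<le> 2 + 4 + c" by (auto simp: eventually_at_top_linorder)
  have "continuous_on {e..max R2 e} \<phi>"
    unfolding \<phi>_def using e isCont_u isCont_u'
    by (intro continuous_intros continuous_at_imp_continuous_on) auto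
  then have "bounded (\<phi> ` {e..max R2 e})" by (intro compact_imp_bounded compact_continuous_image) auto
  then obtain M where M: "\<And>r. r \<in> {e..max R2 e} \<Longrightarrow> \<bar>\<phi> r\<bar> \<le> M" unfolding bounded_iff by force
  define B where "B = max M (max (2 + 4 + c) ((2 + 9 * C\<^sup>2 + c * 4) * 4))"
  show ?thesis
  proof (rule that[of B])
    have "2 + 4 + c \<le> B" by (simp add: B_def)
    then show "B \<ge> 0" using c by simp
    fix r :: real assume r: "r > 0"
    have "\<phi> r \<le> B"
    proof (cases "r < e")
      case True
      then show ?thesis using near[OF r] by (simp add: B_def)
    next
      case False
      show ?thesis
      proof (cases "r \<ge> R2")
        case True
        then show ?thesis using R2[OF True] by (simp add: B_def)
      next
        case False
        then have "\<bar>\<phi> r\<bar> \<le> M" using \<open>\<not> r < e\<close> by (intro M) auto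
        then show ?thesis by (simp add: B_def)
      qed
    qed
    then show "2 * (u' r)\<^sup>2 + (1 - (u r)\<^sup>2)\<^sup>2 / r\<^sup>2 + c * (u r)\<^sup>2 \<le> B / (1 + r)\<^sup>2"
      using r by (simp add: \<phi>_def pos_le_divide_eq)
  qed
qed

lemma energy_finite:
  assumes c: "\<alpha> * \<beta> \<ge> 0"
  shows "energy \<alpha> \<beta> u < \<infinity>"
proof -
  obtain B where B: "B \<ge> 0" "\<And>r. r > 0 \<Longrightarrow> 2 * (u' r)\<^sup>2 + (1 - (u r)\<^sup>2)\<^sup>2 / r\<^sup>2 + \<alpha> * \<beta> * (u r)\<^sup>2 \<le> B / (1 + r)\<^sup>2"
    using integrand_bound[OF c] by blast
  have "energy \<alpha> \<beta> u \<le> (\<integral>\<^sup>+r. ennreal (B / (1 + r)\<^sup>2) * indicator {0..} r \<partial>lborel)"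
    unfolding energy_def nn_integral_completion
  proof (rule nn_integral_mono)
    fix r :: real
    show "ennreal (2 * (deriv u r)\<^sup>2 + (1 - (u r)\<^sup>2)\<^sup>2 / r\<^sup>2 + \<alpha> * \<beta> * (u r)\<^sup>2) * indicator {0<..} r
      \<le> ennreal (B / (1 + r)\<^sup>2) * indicator {0..} r"
      using B(2)[of r] DERIV_imp_deriv[OF DERIV_u[of r]] by (auto simp: indicator_def intro!: ennreal_leI)
  qed
  also have "\<dots> = ennreal (0 - (- B / (1 + 0)))"
  proof (rule nn_integral_FTC_atLeast)
    show "((\<lambda>r. - B / (1 + r)) has_real_derivative B / (1 + r)\<^sup>2) (at r)" if "0 \<le> r" for r
      using that by (auto intro!: derivative_eq_intros simp: power2_eq_square)
    show "((\<lambda>r. - B / (1 + r)) \<longlongrightarrow> 0) at_top" by real_asymp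
  qed (use B in auto)
  finally show ?thesis by (rule le_less_trans) simp
qed

end

section \<open>Pointwise bounds and monotonicity of nonnegative solutions\<close>

locale nonneg_profile = profile +
  assumes nonneg: "\<And>r. r > 0 \<Longrightarrow> u r \<ge> 0"
begin

text \<open>A zero of \<open>u \<ge> 0\<close> is a double zero, so by a Gronwall argument \<open>u\<close> would vanish all the way to the origin.\<close>

lemma pos:
  assumes r0: "r0 > 0" shows "u r0 > 0"
proof (rule ccontr)
  assume "\<not> u r0 > 0"
  then have u0: "u r0 = 0" using nonneg[OF r0] by simp
  have "u' r0 = 0"
    by (rule DERIV_local_min[OF DERIV_u[OF r0] r0]) (use nonneg u0 in auto)
  have zero: "u r = 0" if r: "0 < r" "r < r0" for r
  proof -
    have "continuous_on {r..r0} (\<lambda>s. 1 + Q s)"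
      using r isCont_u by (intro continuous_intros continuous_at_imp_continuous_on) auto
    then have "bounded ((\<lambda>s. 1 + Q s) ` {r..r0})" by (intro compact_imp_bounded compact_continuous_image) auto
    then obtain K where K: "\<And>s. s \<in> {r..r0} \<Longrightarrow> \<bar>1 + Q s\<bar> \<le> K" unfolding bounded_iff by force
    \<comment> \<open>\<open>(u^2 + u'^2)' = 2 u u' (1 + Q) \<ge> - K (u^2 + u'^2)\<close>, so the
      exponential weight makes \<open>E\<close> nondecreasing; a zero of \<open>E\<close> at
      \<open>r0\<close> then propagates to the left.\<close>
    define E where "E s = ((u s)\<^sup>2 + (u' s)\<^sup>2) * exp (K * s)" for s
    have "E r \<le> E r0"
    proof (rule DERIV_nonneg_imp_nondecreasing[of r r0 E])
      fix s assume s: "r \<le> s" "s \<le> r0"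
      then have "s > 0" using r by simp
      have "(E has_real_derivative ((2 * u s * u' s + 2 * u' s * (Q s * u s)) * exp (K * s) + ((u s)\<^sup>2 + (u'
        s)\<^sup>2) * (K * exp (K * s)))) (at s)"
        unfolding E_def using DERIV_u[OF \<open>s > 0\<close>] DERIV_u'[OF \<open>s > 0\<close>]
        by (auto intro!: derivative_eq_intros simp: power2_eq_square)
      moreover have "(2 * u s * u' s + 2 * u' s * (Q s * u s)) * exp (K * s) + ((u s)\<^sup>2 + (u' s)\<^sup>2) * (K * exp
        (K * s)) \<ge> 0"
      proof -
        have "\<bar>2 * u s * u' s\<bar> \<le> (u s)\<^sup>2 + (u' s)\<^sup>2"
          using sum_squares_bound[of "\<bar>u s\<bar>" "\<bar>u' s\<bar>"] by (simp add: abs_mult)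
        then have "\<bar>2 * u s * u' s\<bar> * \<bar>1 + Q s\<bar> \<le> ((u s)\<^sup>2 + (u' s)\<^sup>2) * K" using K[of s] s by (intro mult_mono) auto
        then have "2 * u s * u' s * (1 + Q s) \<ge> - (((u s)\<^sup>2 + (u' s)\<^sup>2) * K)"
          unfolding abs_mult[symmetric] by linarith
        then have "(2 * u s * u' s * (1 + Q s) + ((u s)\<^sup>2 + (u' s)\<^sup>2) * K) * exp (K * s) \<ge> 0" by simp
        then show ?thesis by (simp add: algebra_simps)
      qed
      ultimately show "\<exists>y. (E has_real_derivative y) (at s) \<and> y \<ge> 0" by blast
    qed (use r in simp)
    also have "\<dots> = 0" using u0 \<open>u' r0 = 0\<close> by (simp add: E_def)
    finally have "(u r)\<^sup>2 + (u' r)\<^sup>2 \<le> 0" by (simp add: E_def mult_le_0_iff)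
    then show ?thesis by (simp add: sum_power2_le_zero_iff)
  qed
  have "eventually (\<lambda>r. u r > 1/2) (at_right 0)" by (rule order_tendstoD(1)[OF lim_0]) simp
  then obtain d where d: "d > 0" "\<And>r. 0 < r \<Longrightarrow> r < d \<Longrightarrow> u r > 1/2" by (auto simp: eventually_at_right_field)
  define r where "r = min d r0 / 2"
  have "0 < r" "r < d" "r < r0" using d r0 by (auto simp: r_def)
  then show False using zero[of r] d(2)[of r] by simp
qed

text \<open>Where \<open>u > 1\<close> one has \<open>Q > 0\<close>, so \<open>u - 1\<close> has no
  positive maximum. Touching the value 1 would be a maximum with
  \<open>u'' = m^2 > 0\<close>.\<close>

lemma less_one:
  assumes r0: "r0 > 0" shows "u r0 < 1"
proof -
  have le: "u r \<le> 1" if "r > 0" for r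
  proof -
    have "u r - 1 \<le> 0"
    proof (rule maximum_principle_halfline[of 0 "\<lambda>r. u r - 1" u' "\<lambda>r. Q r * u r"])
      show "((\<lambda>r. u r - 1) has_real_derivative u' r) (at r)" if "r > 0" for r
        using DERIV_diff[OF DERIV_u[OF that] DERIV_const[of 1]] by simp
      show "eventually (\<lambda>r. u r - 1 < e) (at_right 0)" if "e > 0" for e
        using order_tendstoD(2)[OF lim_0, of "1 + e"] that by (auto elim: eventually_mono)
      show "eventually (\<lambda>r. u r - 1 < e) at_top" if "e > 0" for e
        using order_tendstoD(2)[OF lim_infinity, of "1 + e"] that by (auto elim: eventually_mono)
      show "0 < Q r * u r" if r: "r > 0" "0 < u r - 1" for r
      proof -
        have "(u r)\<^sup>2 > 1" using r by (simp add: one_less_power)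
        then show ?thesis using r m by (intro mult_pos_pos add_pos_pos divide_pos_pos) auto
      qed
    qed (use that DERIV_u' in auto)
    then show ?thesis by simp
  qed
  have "u r0 \<noteq> 1"
  proof
    assume 1: "u r0 = 1"
    have "Q r0 * u r0 \<le> 0"
      by (rule interior_max_second_derivative[of "{0<..}" r0 u u']) (use r0 DERIV_u DERIV_u'[OF r0] le 1 in auto)
    then show False using 1 m by simp
  qed
  then show ?thesis using le[OF r0] by simp
qed

lemma Q_less: "r > 0 \<Longrightarrow> Q r < m\<^sup>2"
  using less_one[of r] pos[of r] by (simp add: power_less_one_iff divide_neg_pos)

text \<open>Factor \<open>y'' - m^2 y\<close> as \<open>(D - m) (D + m) y\<close>. Since
  \<open>Q < m^2\<close>, the function \<open>(u' + m u) exp (- m r)\<close> is strictly decreasing;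
  it tends to 0 at infinity, hence is positive.\<close>

lemma deriv_gt:
  assumes r: "r > 0" shows "u' r > - m * u r"
proof -
  define g where "g r = (u' r + m * u r) * exp (- m * r)" for r
  have g': "(g has_real_derivative ((Q s - m\<^sup>2) * u s * exp (- m * s))) (at s)" if "s > 0" for s
    unfolding g_def using DERIV_u[OF that] DERIV_u'[OF that]
    by (auto intro!: derivative_eq_intros simp: power2_eq_square algebra_simps)
  have dec: "g b < g a" if "0 < a" "a < b" for a b
  proof (rule DERIV_neg_imp_decreasing[OF that(2)])
    fix s assume "a \<le> s" "s \<le> b"
    then have "s > 0" using that by simp
    moreover have "(Q s - m\<^sup>2) * u s * exp (- m * s) < 0"
      using Q_less[OF \<open>s > 0\<close>] pos[OF \<open>s > 0\<close>] by (intro mult_neg_pos) auto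
    ultimately show "\<exists>y. (g has_real_derivative y) (at s) \<and> y < 0" using g' by blast
  qed
  have "(g \<longlongrightarrow> (0 + m * 0) * 0) at_top" unfolding g_def
  proof (intro tendsto_intros deriv_lim_infinity lim_infinity)
    show "((\<lambda>r. exp (- m * r)) \<longlongrightarrow> 0) at_top" using m by real_asymp
  qed
  then have "(g \<longlongrightarrow> 0) at_top" by simp
  \<comment> \<open>A limit preserves only the weak inequality; the step from \<open>r\<close> to
    \<open>r + 1\<close> restores strictness.\<close>
  then have "0 \<le> g (r + 1)"
  proof (rule tendsto_upperbound)
    show "eventually (\<lambda>s. g s \<le> g (r + 1)) at_top"
      using eventually_gt_at_top[of "r + 1"] by eventually_elim (use dec[of "r + 1"] r in force)
  qed simp
  then have "g r > 0" using dec[of r "r + 1"] r by linarith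
  then show ?thesis by (simp add: g_def zero_less_mult_iff)
qed

text \<open>By \<open>deriv_gt\<close>, \<open>u exp (m r)\<close> is strictly increasing, and its
  limit at the origin is 1.\<close>

lemma gt_exp:
  assumes r: "r > 0" shows "u r > exp (- m * r)"
proof -
  define h where "h r = u r * exp (m * r)" for r
  have inc: "h a < h b" if "0 < a" "a < b" for a b
  proof (rule DERIV_pos_imp_increasing[OF that(2)])
    fix s assume "a \<le> s" "s \<le> b"
    then have s: "s > 0" using that by simp
    have "(h has_real_derivative ((u' s + m * u s) * exp (m * s))) (at s)"
      unfolding h_def using DERIV_u[OF s] by (auto intro!: derivative_eq_intros simp: algebra_simps)
    moreover have "(u' s + m * u s) * exp (m * s) > 0" using deriv_gt[OF s] by simp
    ultimately show "\<exists>y. (h has_real_derivative y) (at s) \<and> 0 < y" by blast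
  qed
  have "(h \<longlongrightarrow> 1 * exp (m * 0)) (at_right 0)" unfolding h_def by (intro tendsto_intros lim_0)
  then have "(h \<longlongrightarrow> 1) (at_right 0)" by simp
  then have "1 \<le> h (r / 2)"
  proof (rule tendsto_upperbound)
    show "eventually (\<lambda>s. h s \<le> h (r / 2)) (at_right 0)"
      unfolding eventually_at_right_field using inc r by (intro exI[of _ "r / 2"]) (auto intro: less_imp_le)
  qed simp
  then have "h r > 1" using inc[of "r / 2" r] r by simp
  then show ?thesis by (simp add: h_def exp_minus field_simps)
qed

text \<open>If \<open>u\<close> were not decreasing, a local minimum \<open>x1\<close> would be followed by a higher local maximum \<open>x2\<close>;
  the signs of \<open>u''\<close> there give \<open>1 - u(x1)\<^sup>2 \<le> m\<^sup>2 x1\<^sup>2 < m\<^sup>2 x2\<^sup>2 \<le> 1 - u(x2)\<^sup>2\<close>.\<close>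

lemma strictly_decreasing:
  assumes r: "0 < r" "r < s" shows "u s < u r"
proof (rule ccontr)
  assume "\<not> u s < u r"
  then have le: "u r \<le> u s" by simp
  have s: "s > 0" using r by simp
  have "eventually (\<lambda>x. u x > u s) (at_right 0)" by (rule order_tendstoD(1)[OF lim_0 less_one[OF s]])
  then obtain d where d: "d > 0" "\<And>x. 0 < x \<Longrightarrow> x < d \<Longrightarrow> u x > u s" by (auto simp: eventually_at_right_field)
  define \<delta> where "\<delta> = min d r / 2"
  have \<delta>: "0 < \<delta>" "\<delta> < r" "u \<delta> > u s" using d(1) d(2)[of \<delta>] r by (auto simp: \<delta>_def)
  have cont: "continuous_on {a..b} u" if "a > 0" for a b
    using that isCont_u by (intro continuous_at_imp_continuous_on) auto
  obtain x where x: "x \<in> {\<delta>..s}" "\<And>y. y \<in> {\<delta>..s} \<Longrightarrow> u x \<le> u y"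
    using continuous_attains_inf[OF _ _ cont[OF \<delta>(1)], of s] \<delta> r by auto
  \<comment> \<open>If the minimum over \<open>{\<delta>..s}\<close> is attained at
    \<open>s\<close>, then \<open>u r \<le> u s\<close> makes \<open>r\<close> a minimum point too,
    and \<open>r\<close> is interior.\<close>
  define x1 where "x1 = (if x = s then r else x)"
  have x1: "x1 \<in> {\<delta>..s}" "x1 \<noteq> s" "\<And>y. y \<in> {\<delta>..s} \<Longrightarrow> u x1 \<le> u y"
    using x le \<delta> r by (auto simp: x1_def intro: order_trans)
  have "u x1 \<le> u s" using x1(3) \<delta> r by auto
  then have x1': "\<delta> < x1" "x1 < s" using x1(1,2) \<delta>(3) by (auto simp: order_less_le)
  have "- (Q x1 * u x1) \<le> 0"
  proof (rule interior_max_second_derivative[of "{\<delta><..<s}" x1 "\<lambda>r. - u r" "\<lambda>r. - u' r"])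
    show "((\<lambda>r. - u r) has_real_derivative - u' y) (at y)" if "y \<in> {\<delta><..<s}" for y
      using DERIV_minus[OF DERIV_u[of y]] that \<delta> by simp
    show "((\<lambda>r. - u' r) has_real_derivative - (Q x1 * u x1)) (at x1)"
      using DERIV_minus[OF DERIV_u'[of x1]] x1' \<delta> by simp
  qed (use x1 x1' in auto)
  then have Q1: "Q x1 \<ge> 0" using pos[of x1] x1' \<delta> by (simp add: zero_le_mult_iff)
  have "eventually (\<lambda>x. u x < u s) at_top" by (rule order_tendstoD(2)[OF lim_infinity pos[OF s]])
  then obtain R0 where R0: "\<And>x. x \<ge> R0 \<Longrightarrow> u x < u s" by (auto simp: eventually_at_top_linorder)
  \<comment> \<open>\<open>u R < u s\<close> keeps the maximum over \<open>{x1..R}\<close> away from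
    the right end.\<close>
  define R where "R = max R0 (s + 1)"
  have R: "R > s" "u R < u s" using R0[of R] by (auto simp: R_def)
  obtain y where y: "y \<in> {x1..R}" "\<And>z. z \<in> {x1..R} \<Longrightarrow> u z \<le> u y"
    using continuous_attains_sup[OF _ _ cont[of x1 R]] x1' \<delta> R by auto
  define x2 where "x2 = (if y = x1 then s else y)"
  have x2: "x2 \<in> {x1..R}" "x2 \<noteq> x1" "\<And>z. z \<in> {x1..R} \<Longrightarrow> u z \<le> u x2"
    using y \<open>u x1 \<le> u s\<close> x1' R by (auto simp: x2_def intro: order_trans)
  have "u s \<le> u x2" using x2(3) x1' R by auto
  then have x2': "x1 < x2" "x2 < R" using x2(1,2) R(2) by (auto simp: order_less_le)
  have x20: "x2 > 0" using x2' x1' \<delta> by simp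
  have "Q x2 * u x2 \<le> 0"
  proof (rule interior_max_second_derivative[of "{x1<..<R}" x2 u u'])
    show "(u has_real_derivative u' y) (at y)" if "y \<in> {x1<..<R}" for y
      using DERIV_u[of y] that \<delta> x1' by simp
  qed (use x2 x2' x20 DERIV_u' in auto)
  then have Q2: "Q x2 \<le> 0" using pos[OF x20] by (simp add: mult_le_0_iff)
  have x10: "x1 > 0" using x1' \<delta> by simp
  have "Q x * x\<^sup>2 = m\<^sup>2 * x\<^sup>2 + (u x)\<^sup>2 - 1" if "x > 0" for x
    using that by (simp add: field_simps)
  moreover have "Q x1 * x1\<^sup>2 \<ge> 0" "Q x2 * x2\<^sup>2 \<le> 0" using Q1 Q2 by (auto simp: mult_nonneg_nonneg mult_nonpos_nonneg)
  ultimately have "1 - (u x1)\<^sup>2 \<le> m\<^sup>2 * x1\<^sup>2" "m\<^sup>2 * x2\<^sup>2 \<le> 1 - (u x2)\<^sup>2"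
    using x10 x20 by force+
  moreover have "m\<^sup>2 * x1\<^sup>2 < m\<^sup>2 * x2\<^sup>2" using m x10 x2' by (intro mult_strict_left_mono power_strict_mono) auto
  moreover have "(u x1)\<^sup>2 \<le> (u x2)\<^sup>2"
    using \<open>u x1 \<le> u s\<close> \<open>u s \<le> u x2\<close> pos[OF x10] by (intro power_mono) auto
  ultimately show False by linarith
qed

lemma deriv_nonpos:
  assumes r: "r > 0" shows "u' r \<le> 0"
proof (rule ccontr)
  assume "\<not> u' r \<le> 0"
  then obtain d where "d > 0" "\<And>h. 0 < h \<Longrightarrow> h < d \<Longrightarrow> u r < u (r + h)"
    using DERIV_pos_inc_right[OF DERIV_u[OF r]] by auto
  then have "u r < u (r + d / 2)" by simp
  then show False using strictly_decreasing[OF r, of "r + d/2"] \<open>d > 0\<close> by simp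
qed

lemma deriv_bound: "r > 0 \<Longrightarrow> \<bar>u' r\<bar> \<le> m * u r"
  using deriv_gt[of r] deriv_nonpos[of r] by simp

end

section \<open>Existence of a nonnegative solution\<close>

lemma nn_integral_FTC_einterval:
  fixes F g :: "real \<Rightarrow> real" and a b :: ereal
  assumes "a < b" and F: "\<And>x. a < ereal x \<Longrightarrow> ereal x < b \<Longrightarrow> (F has_real_derivative g x) (at x)"
    and g: "\<And>x. a < ereal x \<Longrightarrow> ereal x < b \<Longrightarrow> isCont g x" "\<And>x. a < ereal x \<Longrightarrow> ereal x < b \<Longrightarrow> 0 \<le> g x"
    and A: "((F \<circ> real_of_ereal) \<longlongrightarrow> A) (at_right a)" and B: "((F \<circ> real_of_ereal) \<longlongrightarrow> B) (at_left b)"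
  shows "(\<integral>\<^sup>+x. ennreal (g x) * indicator (einterval a b) x \<partial>lborel) = ennreal (B - A)"
proof -
  have g0: "AE x in lborel. a < ereal x \<longrightarrow> ereal x < b \<longrightarrow> 0 \<le> g x" using g(2) by auto
  note FTC = interval_integral_FTC_nonneg[OF \<open>a < b\<close> F g(1) g0 A B]
  have "(\<integral>\<^sup>+x. ennreal (g x) * indicator (einterval a b) x \<partial>lborel) = (\<integral>\<^sup>+x. ennreal (indicator (einterval a b)
    x *\<^sub>R g x) \<partial>lborel)"
    by (intro nn_integral_cong) (auto simp: indicator_def)
  also have "\<dots> = ennreal (\<integral>x. indicator (einterval a b) x *\<^sub>R g x \<partial>lborel)"
    using FTC(1) g(2) unfolding set_integrable_def
    by (intro nn_integral_eq_integral) (auto simp: indicator_def einterval_def)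
  also have "(\<integral>x. indicator (einterval a b) x *\<^sub>R g x \<partial>lborel) = B - A"
    using FTC(2) less_imp_le[OF \<open>a < b\<close>] by (simp add: interval_lebesgue_integral_def set_lebesgue_integral_def)
  finally show ?thesis .
qed

lemma nn_integral_FTC_from_0:
  fixes F g :: "real \<Rightarrow> real"
  assumes r: "0 < r" and F: "\<And>x. 0 < x \<Longrightarrow> (F has_real_derivative g x) (at x)"
    and g: "\<And>x. 0 < x \<Longrightarrow> isCont g x" "\<And>x. 0 < x \<Longrightarrow> 0 \<le> g x" and A: "(F \<longlongrightarrow> A) (at_right 0)"
  shows "(\<integral>\<^sup>+x. ennreal (g x) * indicator {0<..<r} x \<partial>lborel) = ennreal (F r - A)"
proof -
  have "(F \<longlongrightarrow> F r) (at_left r)"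
    using DERIV_isCont[OF F[OF r]] by (auto simp: isCont_def intro: tendsto_within_subset
      filterlim_at_split[THEN iffD1, THEN conjunct1])
  then show ?thesis
    using nn_integral_FTC_einterval[of "ereal 0" "ereal r" F g A "F r"] assms
    by (simp add: ereal_tendsto_simps)
qed

lemma nn_integral_FTC_to_infinity:
  fixes F g :: "real \<Rightarrow> real"
  assumes r: "0 < r" and F: "\<And>x. 0 < x \<Longrightarrow> (F has_real_derivative g x) (at x)"
    and g: "\<And>x. 0 < x \<Longrightarrow> isCont g x" "\<And>x. 0 < x \<Longrightarrow> 0 \<le> g x" and B: "(F \<longlongrightarrow> B) at_top"
  shows "(\<integral>\<^sup>+x. ennreal (g x) * indicator {r<..} x \<partial>lborel) = ennreal (B - F r)"
proof -
  have "(F \<longlongrightarrow> F r) (at_right r)"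
    using DERIV_isCont[OF F[OF r]] by (auto simp: isCont_def intro: tendsto_within_subset
      filterlim_at_split[THEN iffD1, THEN conjunct2])
  then show ?thesis
    using nn_integral_FTC_einterval[of "ereal r" \<infinity> F g "F r" B] assms
    by (simp add: ereal_tendsto_simps einterval_eq_Ici)
qed

text \<open>\<open>sphk\<close> and \<open>sphi\<close> are (up to factors) the modified spherical Bessel functions of order one: the
  decaying and the regular solution of \<open>y'' = (1 + 2 / r\<^sup>2) y\<close>.\<close>

definition sphk :: "real \<Rightarrow> real" where "sphk r = exp (- r) * (1 + 1 / r)"
definition sphk' :: "real \<Rightarrow> real" where "sphk' r = - exp (- r) * (1 + 1 / r + 1 / r\<^sup>2)"
definition sphi :: "real \<Rightarrow> real" where "sphi r = cosh r - sinh r / r"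
definition sphi' :: "real \<Rightarrow> real" where "sphi' r = sinh r - cosh r / r + sinh r / r\<^sup>2"

lemma DERIV_sphk: "r > 0 \<Longrightarrow> (sphk has_real_derivative sphk' r) (at r)"
  unfolding sphk_def[abs_def] sphk'_def
  by (auto intro!: derivative_eq_intros simp: field_simps power2_eq_square)

lemma DERIV_sphk': "r > 0 \<Longrightarrow> (sphk' has_real_derivative ((1 + 2 / r\<^sup>2) * sphk r)) (at r)"
  unfolding sphk_def sphk'_def[abs_def]
  by (auto intro!: derivative_eq_intros simp: field_simps power2_eq_square eval_nat_numeral)

lemma DERIV_sphi: "r > 0 \<Longrightarrow> (sphi has_real_derivative sphi' r) (at r)"
  unfolding sphi_def[abs_def] sphi'_def
  by (auto intro!: derivative_eq_intros simp: field_simps power2_eq_square)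

lemma DERIV_sphi': "r > 0 \<Longrightarrow> (sphi' has_real_derivative ((1 + 2 / r\<^sup>2) * sphi r)) (at r)"
  unfolding sphi_def sphi'_def[abs_def]
  by (auto intro!: derivative_eq_intros simp: field_simps power2_eq_square eval_nat_numeral)

lemma sph_wronskian:
  assumes "r > 0" shows "sphk r * sphi' r - sphi r * sphk' r = 1"
proof -
  have e: "exp (- r) = cosh r - sinh r" by (simp add: cosh_minus_sinh)
  have c: "(cosh r)\<^sup>2 = 1 + (sinh r)\<^sup>2" using cosh_square_eq[of r] by simp
  have "sphk r * sphi' r - sphi r * sphk' r = (cosh r - sinh r) * (cosh r + sinh r)"
    unfolding sphk_def sphk'_def sphi_def sphi'_def e using assms
    by (simp add: field_simps power2_eq_square)
  also have "\<dots> = (cosh r)\<^sup>2 - (sinh r)\<^sup>2" by (simp add: algebra_simps power2_eq_square)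
  finally show ?thesis using c by simp
qed

lemma sphk_pos: "r > 0 \<Longrightarrow> sphk r > 0"
  by (simp add: sphk_def add_pos_pos)

lemma sphk_nonneg: "r > 0 \<Longrightarrow> sphk r \<ge> 0"
  using sphk_pos less_imp_le by blast

lemma sphi_limits: "(sphi \<longlongrightarrow> 0) (at_right 0)" "(sphi' \<longlongrightarrow> 0) (at_right 0)"
  unfolding sphi_def[abs_def] sphi'_def[abs_def] sinh_field_def cosh_field_def by real_asymp+

lemma sphk_limits: "(sphk \<longlongrightarrow> 0) at_top" "(sphk' \<longlongrightarrow> 0) at_top"
  unfolding sphk_def[abs_def] sphk'_def[abs_def] by real_asymp+

lemma sphi_nonneg:
  assumes "r > 0" shows "sphi r \<ge> 0"
proof -
  have "0 * cosh 0 - sinh 0 \<le> r * cosh r - sinh r"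
  proof (rule DERIV_nonneg_imp_nondecreasing[of 0 r "\<lambda>x. x * cosh x - sinh x"])
    fix x :: real assume "0 \<le> x" "x \<le> r"
    have "((\<lambda>x. x * cosh x - sinh x) has_real_derivative (x * sinh x)) (at x)"
      by (auto intro!: derivative_eq_intros)
    moreover have "x * sinh x \<ge> 0" using \<open>0 \<le> x\<close> by simp
    ultimately show "\<exists>y. ((\<lambda>x. x * cosh x - sinh x) has_real_derivative y) (at x) \<and> y \<ge> 0" by blast
  qed (use assms in simp)
  then show ?thesis using assms by (simp add: sphi_def field_simps)
qed

text \<open>Adding \<open>3 u / r^2\<close> to both sides of
  \<open>- u'' + u + (u^3 - u) / r^2 = 0\<close> gives
  \<open>- u'' + (1 + 2 / r^2) u = cubic u / r^2\<close>. The shift 3 is the least that makes the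
  right side nondecreasing on \<open>[0, 1]\<close>, and it leaves the coefficient
  \<open>2 = 1 * (1 + 1)\<close>, for which the homogeneous solutions are elementary.\<close>

definition cubic :: "real \<Rightarrow> real" where "cubic x = 3 * x - x ^ 3"

lemma cubic_mono: assumes "0 \<le> x" "x \<le> y" "y \<le> 1" shows "cubic x \<le> cubic y"
proof -
  have "x\<^sup>2 \<le> 1" "y\<^sup>2 \<le> 1" "x * y \<le> 1" using assms by (auto simp: power_le_one_iff intro: mult_le_one)
  then have "(y - x) * (3 - (x\<^sup>2 + x * y + y\<^sup>2)) \<ge> 0" using assms by simp
  then show ?thesis by (simp add: cubic_def power2_eq_square power3_eq_cube algebra_simps)
qed

text \<open>\<open>2 * x \<le> cubic x\<close> serves the subsolution \<open>exp (- r)\<close>,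
  \<open>cubic x \<le> 2\<close> the supersolution 1.\<close>

lemma cubic_bounds: assumes "0 \<le> x" "x \<le> 1" shows "2 * x \<le> cubic x" "cubic x \<le> 2" "0 \<le> cubic x"
proof -
  have "x * (1 - x\<^sup>2) \<ge> 0" using assms by (simp add: power_le_one_iff)
  then show "2 * x \<le> cubic x" by (simp add: cubic_def power2_eq_square power3_eq_cube algebra_simps)
  then show "0 \<le> cubic x" using assms by simp
  show "cubic x \<le> 2" using cubic_mono[OF assms order_refl] by (simp add: cubic_def)
qed

section \<open>The Green operator and its order properties\<close>

definition lowint :: "(real \<Rightarrow> real) \<Rightarrow> real \<Rightarrow> ennreal" where
  "lowint \<phi> r = (\<integral>\<^sup>+s. ennreal (sphi s * cubic (\<phi> s) / s\<^sup>2) * indicator {0<..<r} s \<partial>lborel)"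
definition uppint :: "(real \<Rightarrow> real) \<Rightarrow> real \<Rightarrow> ennreal" where
  "uppint \<phi> r = (\<integral>\<^sup>+s. ennreal (sphk s * cubic (\<phi> s) / s\<^sup>2) * indicator {r<..} s \<partial>lborel)"

text \<open>The Green operator of \<open>- y'' + (1 + 2 / r\<^sup>2) y = cubic \<phi> / r\<^sup>2\<close>. Being built from \<open>nn_integral\<close>, it is monotone
  on all functions with values in \<open>[0, 1]\<close>, measurable or not.\<close>

definition green :: "(real \<Rightarrow> real) \<Rightarrow> real \<Rightarrow> real" where
  "green \<phi> r = sphk r * enn2real (lowint \<phi> r) + sphi r * enn2real (uppint \<phi> r)"

definition unit_valued :: "(real \<Rightarrow> real) \<Rightarrow> bool" where
  "unit_valued \<phi> \<longleftrightarrow> (\<forall>r>0. 0 \<le> \<phi> r \<and> \<phi> r \<le> 1)"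

text \<open>The integrand is at most \<open>2 sphi / s^2 \<le> (1 + 2 / s^2) sphi\<close>, and the
  last term is the derivative of \<open>sphi'\<close>.\<close>

lemma lowint_le:
  assumes "unit_valued \<phi>" "r > 0" shows "lowint \<phi> r \<le> ennreal (sphi' r)"
proof -
  have "lowint \<phi> r \<le> (\<integral>\<^sup>+s. ennreal ((1 + 2 / s\<^sup>2) * sphi s) * indicator {0<..<r} s \<partial>lborel)"
    unfolding lowint_def
  proof (rule nn_integral_mono)
    fix s :: real
    have "sphi s * cubic (\<phi> s) / s\<^sup>2 \<le> (1 + 2 / s\<^sup>2) * sphi s" if s: "s > 0"
    proof -
      have "sphi s * cubic (\<phi> s) \<le> sphi s * 2"
        using cubic_bounds(2)[of "\<phi> s"] assms(1) s sphi_nonneg[OF s]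
          by (intro mult_left_mono) (auto simp: unit_valued_def)
      then have "sphi s * cubic (\<phi> s) / s\<^sup>2 \<le> sphi s * 2 / s\<^sup>2" by (intro divide_right_mono) auto
      also have "\<dots> \<le> (1 + 2 / s\<^sup>2) * sphi s" using sphi_nonneg[OF s] by (simp add: algebra_simps)
      finally show ?thesis .
    qed
    then show "ennreal (sphi s * cubic (\<phi> s) / s\<^sup>2) * indicator {0<..<r} s \<le> ennreal ((1 + 2 / s\<^sup>2) * sphi s) *
      indicator {0<..<r} s"
      by (auto simp: indicator_def intro: ennreal_leI)
  qed
  also have "\<dots> = ennreal (sphi' r - 0)"
    using assms(2) DERIV_sphi' sphi_limits(2) sphi_nonneg DERIV_isCont[OF DERIV_sphi]
    by (intro nn_integral_FTC_from_0) (auto intro!: continuous_intros)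
  finally show ?thesis by simp
qed

lemma uppint_le:
  assumes "unit_valued \<phi>" "r > 0" shows "uppint \<phi> r \<le> ennreal (- sphk' r)"
proof -
  have "uppint \<phi> r \<le> (\<integral>\<^sup>+s. ennreal ((1 + 2 / s\<^sup>2) * sphk s) * indicator {r<..} s \<partial>lborel)"
    unfolding uppint_def
  proof (rule nn_integral_mono)
    fix s :: real
    have "sphk s * cubic (\<phi> s) / s\<^sup>2 \<le> (1 + 2 / s\<^sup>2) * sphk s" if s: "s > 0"
    proof -
      have "sphk s * cubic (\<phi> s) \<le> sphk s * 2"
        using cubic_bounds(2)[of "\<phi> s"] assms(1) s sphk_pos[OF s]
          by (intro mult_left_mono) (auto simp: unit_valued_def)
      then have "sphk s * cubic (\<phi> s) / s\<^sup>2 \<le> sphk s * 2 / s\<^sup>2" by (intro divide_right_mono) auto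
      also have "\<dots> \<le> (1 + 2 / s\<^sup>2) * sphk s" using sphk_pos[OF s] by (simp add: algebra_simps)
      finally show ?thesis .
    qed
    then show "ennreal (sphk s * cubic (\<phi> s) / s\<^sup>2) * indicator {r<..} s \<le> ennreal ((1 + 2 / s\<^sup>2) * sphk s) *
      indicator {r<..} s"
      using assms(2) by (auto simp: indicator_def intro: ennreal_leI)
  qed
  also have "\<dots> = ennreal (0 - sphk' r)"
  proof (rule nn_integral_FTC_to_infinity[OF assms(2) DERIV_sphk' _ _ sphk_limits(2)])
    show "isCont (\<lambda>s. (1 + 2 / s\<^sup>2) * sphk s) x" if "x > 0" for x
      using that DERIV_isCont[OF DERIV_sphk] by (intro continuous_intros) auto
    show "0 \<le> (1 + 2 / x\<^sup>2) * sphk x" if "x > 0" for x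
      using sphk_pos[OF that] by simp
  qed
  finally show ?thesis by simp
qed

lemma lowint_finite: "unit_valued \<phi> \<Longrightarrow> r > 0 \<Longrightarrow> lowint \<phi> r < \<infinity>"
  and uppint_finite: "unit_valued \<phi> \<Longrightarrow> r > 0 \<Longrightarrow> uppint \<phi> r < \<infinity>"
  using lowint_le uppint_le by (metis ennreal_less_top infinity_ennreal_def le_less_trans)+

lemma green_mono:
  assumes "unit_valued \<phi>" "unit_valued \<psi>" "\<And>s. s > 0 \<Longrightarrow> \<phi> s \<le> \<psi> s" "r > 0"
  shows "green \<phi> r \<le> green \<psi> r"
proof -
  have c: "cubic (\<phi> s) \<le> cubic (\<psi> s)" if "s > 0" for s
    using assms that by (intro cubic_mono) (auto simp: unit_valued_def)
  have "lowint \<phi> r \<le> lowint \<psi> r" unfolding lowint_def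
    using c sphi_nonneg by (intro nn_integral_mono) (auto simp: indicator_def intro!: ennreal_leI
      divide_right_mono mult_left_mono)
  then have 1: "enn2real (lowint \<phi> r) \<le> enn2real (lowint \<psi> r)"
    using lowint_finite[OF assms(2,4)] by (intro enn2real_mono) auto
  have "uppint \<phi> r \<le> uppint \<psi> r" unfolding uppint_def
    using c sphk_nonneg assms(4) by (intro nn_integral_mono) (auto simp: indicator_def intro!: ennreal_leI
      divide_right_mono mult_left_mono)
  then have 2: "enn2real (uppint \<phi> r) \<le> enn2real (uppint \<psi> r)"
    using uppint_finite[OF assms(2,4)] by (intro enn2real_mono) auto
  show ?thesis unfolding green_def
    using 1 2 sphi_nonneg[OF assms(4)] sphk_pos[OF assms(4)] by (intro add_mono mult_left_mono) auto
qed

text \<open>These signs allow \<open>enn2real (ennreal _)\<close> to be removed from the bounds on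
  \<open>lowint\<close> and \<open>uppint\<close>.\<close>

lemma sph_deriv_signs: assumes "r > 0" shows "sphi' r \<ge> 0" "sphk' r \<le> 0"
proof -
  show "sphk' r \<le> 0" unfolding sphk'_def using assms by simp
  have "sphi' r \<ge> 0"
  proof (rule tendsto_upperbound[OF sphi_limits(2)])
    show "eventually (\<lambda>s. sphi' s \<le> sphi' r) (at_right 0)"
      unfolding eventually_at_right_field
    proof (intro exI[of _ r] conjI allI impI assms)
      fix s :: real assume s: "s > 0" "s < r"
      show "sphi' s \<le> sphi' r"
      proof (rule DERIV_nonneg_imp_nondecreasing[of s r sphi'])
        fix x assume "s \<le> x" "x \<le> r"
        then have "x > 0" using s by simp
        then have "(1 + 2 / x\<^sup>2) * sphi x \<ge> 0" using sphi_nonneg[of x] by simp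
        then show "\<exists>y. (sphi' has_real_derivative y) (at x) \<and> y \<ge> 0"
          using DERIV_sphi'[OF \<open>x > 0\<close>] by blast
      qed (use s in simp)
    qed
  qed simp
  then show "sphi' r \<ge> 0" .
qed

text \<open>The two integral bounds recombine to the Wronskian, which is 1; in effect, the constant
  1 is a supersolution.\<close>

lemma green_le_1:
  assumes "unit_valued \<phi>" "r > 0" shows "green \<phi> r \<le> 1"
proof -
  have "enn2real (lowint \<phi> r) \<le> sphi' r" "enn2real (uppint \<phi> r) \<le> - sphk' r"
    using enn2real_mono[OF lowint_le[OF assms]] enn2real_mono[OF uppint_le[OF assms]] sph_deriv_signs[OF
      assms(2)] by auto
  then have "green \<phi> r \<le> sphk r * sphi' r + sphi r * (- sphk' r)"
    unfolding green_def using sphi_nonneg[OF assms(2)] sphk_pos[OF assms(2)] by (intro add_mono mult_left_mono) auto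
  then show ?thesis using sph_wronskian[OF assms(2)] by simp
qed

lemma unit_valued_exp: "unit_valued (\<lambda>r. exp (- r))"
  by (simp add: unit_valued_def)

text \<open>\<open>exp (- r)\<close> is a subsolution: it satisfies \<open>- w'' + (1 + 2 / r\<^sup>2) w = 2 w / r\<^sup>2 \<le> cubic w / r\<^sup>2\<close>.\<close>

lemma green_exp_ge:
  assumes r: "r > 0" shows "exp (- r) \<le> green (\<lambda>r. exp (- r)) r"
proof -
  let ?w = "\<lambda>r::real. exp (- r)"
  \<comment> \<open>With \<open>w = exp (- s)\<close> this is the Wronskian expression
    \<open>sphi' w - sphi w'\<close>, whose derivative \<open>sphi'' w - sphi w''\<close> loses all
    but the \<open>2 / s^2\<close> part. \<open>U\<close> is the same with
    \<open>sphk\<close>.\<close>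
  have L: "((\<lambda>s. (sphi' s + sphi s) * ?w s) has_real_derivative (sphi s * (2 * ?w s) / s\<^sup>2)) (at s)" if "s > 0" for s
  proof -
    have "((\<lambda>s. (sphi' s + sphi s) * ?w s) has_real_derivative (((1 + 2 / s\<^sup>2) * sphi s + sphi' s) * ?w s + - ?w
      s * (sphi' s + sphi s))) (at s)"
      by (rule DERIV_mult[OF DERIV_add[OF DERIV_sphi'[OF that] DERIV_sphi[OF that]]]) (auto intro!:
        derivative_eq_intros)
    then show ?thesis by (rule DERIV_cong) (simp add: algebra_simps)
  qed
  have U: "((\<lambda>s. (sphk' s + sphk s) * ?w s) has_real_derivative (sphk s * (2 * ?w s) / s\<^sup>2)) (at s)" if "s > 0" for s
  proof -
    have "((\<lambda>s. (sphk' s + sphk s) * ?w s) has_real_derivative (((1 + 2 / s\<^sup>2) * sphk s + sphk' s) * ?w s + - ?w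
      s * (sphk' s + sphk s))) (at s)"
      by (rule DERIV_mult[OF DERIV_add[OF DERIV_sphk'[OF that] DERIV_sphk[OF that]]]) (auto intro!:
        derivative_eq_intros)
    then show ?thesis by (rule DERIV_cong) (simp add: algebra_simps)
  qed
  have cub: "2 * ?w s \<le> cubic (?w s)" if "s > 0" for s using that by (intro cubic_bounds) auto
  have "ennreal ((sphi' r + sphi r) * ?w r - 0) = (\<integral>\<^sup>+s. ennreal (sphi s * (2 * ?w s) / s\<^sup>2) * indicator
    {0<..<r} s \<partial>lborel)"
  proof (rule nn_integral_FTC_from_0[symmetric, OF r L])
    show "isCont (\<lambda>s. sphi s * (2 * ?w s) / s\<^sup>2) x" if "x > 0" for x
      using that DERIV_isCont[OF DERIV_sphi] by (intro continuous_intros) auto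
    have "((\<lambda>s. (sphi' s + sphi s) * ?w s) \<longlongrightarrow> (0 + 0) * exp (- 0)) (at_right 0)" by (intro tendsto_intros sphi_limits)
    then show "((\<lambda>s. (sphi' s + sphi s) * ?w s) \<longlongrightarrow> 0) (at_right 0)" by simp
  qed (use sphi_nonneg in auto)
  also have "\<dots> \<le> lowint ?w r" unfolding lowint_def
    using cub sphi_nonneg by (intro nn_integral_mono) (auto simp: indicator_def intro!: ennreal_leI
      divide_right_mono mult_left_mono)
  finally have "ennreal ((sphi' r + sphi r) * ?w r) \<le> lowint ?w r" by simp
  from enn2real_mono[OF this lowint_finite[OF unit_valued_exp r, unfolded infinity_ennreal_def]]
  have 1: "(sphi' r + sphi r) * ?w r \<le> enn2real (lowint ?w r)"
    using sph_deriv_signs[OF r] sphi_nonneg[OF r] by simp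
  have "ennreal (0 - (sphk' r + sphk r) * ?w r) = (\<integral>\<^sup>+s. ennreal (sphk s * (2 * ?w s) / s\<^sup>2) * indicator {r<..}
    s \<partial>lborel)"
  proof (rule nn_integral_FTC_to_infinity[symmetric, OF r U])
    show "isCont (\<lambda>s. sphk s * (2 * ?w s) / s\<^sup>2) x" if "x > 0" for x
      using that DERIV_isCont[OF DERIV_sphk] by (intro continuous_intros) auto
    have "((\<lambda>s. (sphk' s + sphk s) * ?w s) \<longlongrightarrow> (0 + 0) * 0) at_top"
    proof (intro tendsto_intros sphk_limits)
      show "(?w \<longlongrightarrow> 0) at_top" by real_asymp
    qed
    then show "((\<lambda>s. (sphk' s + sphk s) * ?w s) \<longlongrightarrow> 0) at_top" by simp
  qed (use sphk_nonneg in auto)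
  also have "\<dots> \<le> uppint ?w r" unfolding uppint_def
    using cub sphk_nonneg r by (intro nn_integral_mono) (auto simp: indicator_def intro!: ennreal_leI
      divide_right_mono mult_left_mono)
  finally have "ennreal (- ((sphk' r + sphk r) * ?w r)) \<le> uppint ?w r" by simp
  from enn2real_mono[OF this uppint_finite[OF unit_valued_exp r, unfolded infinity_ennreal_def]]
  have "enn2real (ennreal (- ((sphk' r + sphk r) * ?w r))) \<le> enn2real (uppint ?w r)" .
  \<comment> \<open>If the left side were negative, \<open>ennreal\<close> would truncate it to 0,
    and nonnegativity of \<open>enn2real\<close> already gives the bound.\<close>
  then have 2: "- ((sphk' r + sphk r) * ?w r) \<le> enn2real (uppint ?w r)"
    by (cases "- ((sphk' r + sphk r) * ?w r) \<ge> 0") (auto intro: order_trans[OF _ enn2real_nonneg])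
  have "sphk r * ((sphi' r + sphi r) * ?w r) + sphi r * (- ((sphk' r + sphk r) * ?w r)) \<le> green ?w r"
    unfolding green_def using 1 2 sphi_nonneg[OF r] sphk_pos[OF r] by (intro add_mono mult_left_mono) auto
  also have "sphk r * ((sphi' r + sphi r) * ?w r) + sphi r * (- ((sphk' r + sphk r) * ?w r))
      = (sphk r * sphi' r - sphi r * sphk' r) * ?w r" by (simp add: algebra_simps)
  finally show ?thesis using sph_wronskian[OF r] by simp
qed

text \<open>\<open>P\<close> consists of the post-fixed points between subsolution and
  supersolution. Its pointwise supremum is again one by monotonicity, and applying
  \<open>green\<close> stays in \<open>P\<close>, which gives the reverse inequality.\<close>

lemma green_fixed_point:
  obtains u where "\<And>r. r > 0 \<Longrightarrow> exp (- r) \<le> u r" "\<And>r. r > 0 \<Longrightarrow> u r \<le> 1" "\<And>r. r > 0 \<Longrightarrow> u r = green u r"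
proof -
  define P where "P = {\<phi>. \<forall>r>0. exp (- r) \<le> \<phi> r \<and> \<phi> r \<le> 1 \<and> \<phi> r \<le> green \<phi> r}"
  define u where "u r = (SUP \<phi>\<in>P. \<phi> r)" for r
  have w: "(\<lambda>r. exp (- r)) \<in> P" using green_exp_ge by (simp add: P_def)
  have up: "\<phi> r \<le> u r" if "\<phi> \<in> P" "r > 0" for \<phi> r
    unfolding u_def using that by (intro cSUP_upper bdd_aboveI[of _ 1]) (auto simp: P_def)
  have u: "exp (- r) \<le> u r" "u r \<le> 1" if "r > 0" for r
    using up[OF w that] w that unfolding u_def by (auto intro!: cSUP_least simp: P_def)
  have uv: "unit_valued u" unfolding unit_valued_def using u by (auto intro: order_trans[OF exp_ge_zero])
  have Pu: "unit_valued \<phi>" if "\<phi> \<in> P" for \<phi>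
    using that unfolding unit_valued_def P_def by (auto intro: order_trans[OF exp_ge_zero])
  have le: "u r \<le> green u r" if "r > 0" for r
    unfolding u_def[of r]
  proof (rule cSUP_least)
    fix \<phi> assume p: "\<phi> \<in> P"
    then have "\<phi> r \<le> green \<phi> r" using that by (simp add: P_def)
    also have "\<dots> \<le> green u r" using p that up by (intro green_mono Pu uv) auto
    finally show "\<phi> r \<le> green u r" .
  qed (use w in auto)
  have guv: "unit_valued (green u)"
    unfolding unit_valued_def using uv le green_le_1[OF uv] by (auto simp: unit_valued_def intro: order_trans)
  have "green u \<in> P"
    unfolding P_def using u le green_le_1[OF uv] green_mono[OF uv guv] by (auto intro: order_trans)
  then have ge: "green u r \<le> u r" if "r > 0" for r using up that by blast
  show ?thesis by (rule that[OF u]) (use le ge in \<open>auto intro: antisym\<close>)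
qed

section \<open>Regularity of the fixed point\<close>

lemma nn_integral_imp_has_integral_Icc:
  fixes h :: "real \<Rightarrow> real"
  assumes h: "h \<in> borel_measurable borel" "\<And>x. 0 \<le> h x" and S: "S \<in> sets borel" "{x<..<y} \<subseteq> S" "S \<subseteq> {x..y}"
    and fin: "(\<integral>\<^sup>+s. ennreal (h s) * indicator S s \<partial>lborel) < \<infinity>"
  shows "(h has_integral enn2real (\<integral>\<^sup>+s. ennreal (h s) * indicator S s \<partial>lborel)) {x..y}"
proof -
  let ?J = "\<integral>\<^sup>+s. ennreal (h s) * indicator S s \<partial>lborel"
  have "((\<lambda>s. h s * indicator S s) has_integral enn2real ?J) UNIV"
  proof (rule nn_integral_has_integral)
    show "(\<lambda>s. h s * indicator S s) \<in> borel_measurable borel" using h S(1) by measurable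
    have "(\<integral>\<^sup>+s. ennreal (h s * indicator S s) \<partial>lborel) = ?J"
      by (intro nn_integral_cong) (auto simp: indicator_def)
    then show "(\<integral>\<^sup>+s. ennreal (h s * indicator S s) \<partial>lborel) = ennreal (enn2real ?J)" using fin by simp
  qed (use h in auto)
  moreover have "(\<lambda>s. h s * indicator S s) = (\<lambda>s. if s \<in> S then h s else 0)" by (auto simp: indicator_def)
  ultimately have "(h has_integral enn2real ?J) S" by (simp only: has_integral_restrict_UNIV)
  moreover have "{s \<in> S - {x..y}. h s \<noteq> 0} = {}" using S(3) by blast
  then have "negligible {s \<in> S - {x..y}. h s \<noteq> 0}" by (simp only: negligible_empty)
  moreover have "{s \<in> {x..y} - S. h s \<noteq> 0} \<subseteq> {x, y}"
  proof
    fix s assume s: "s \<in> {s \<in> {x..y} - S. h s \<noteq> 0}"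
    then have "s \<notin> {x<..<y}" using S(2) by blast
    then show "s \<in> {x, y}" using s by auto
  qed
  then have "negligible {s \<in> {x..y} - S. h s \<noteq> 0}" by (rule negligible_subset[rotated]) simp
  ultimately show ?thesis using has_integral_spike_set_eq[of S "{x..y}" h] by blast
qed

text \<open>First stage of a bootstrap: integrability of \<open>h\<close> alone gives continuity of
  the coefficients, hence of the fixed point and of \<open>h\<close>; only then does
  \<open>DERIV_of_increments\<close> apply.\<close>

lemma continuous_of_increments:
  fixes A h :: "real \<Rightarrow> real"
  assumes A: "\<And>x y. 0 < x \<Longrightarrow> x \<le> y \<Longrightarrow> (h has_integral (A y - A x)) {x..y}" and r: "r > 0"
  shows "isCont A r"
proof -
  have int: "integral {r/2..x} h = A x - A (r/2)" if "r/2 \<le> x" for x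
    using integral_unique[OF A[of "r/2" x]] that r by simp
  have "continuous_on {r/2..r+1} (\<lambda>y. A (r/2) + integral {r/2..y} h)"
    using A[of "r/2" "r+1"] r by (intro continuous_intros indefinite_integral_continuous_1) (auto simp:
      has_integral_integrable)
  then have "continuous_on {r/2..r+1} A"
    by (rule continuous_on_eq) (use int r in auto)
  then show ?thesis by (rule continuous_on_interior) (use r in auto)
qed

lemma DERIV_of_increments:
  fixes A h :: "real \<Rightarrow> real"
  assumes A: "\<And>x y. 0 < x \<Longrightarrow> x \<le> y \<Longrightarrow> (h has_integral (A y - A x)) {x..y}"
    and h: "\<And>s. s > 0 \<Longrightarrow> isCont h s" and r: "r > 0"
  shows "(A has_real_derivative h r) (at r)"
proof -
  have int: "integral {r/2..x} h = A x - A (r/2)" if "r/2 \<le> x" for x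
    using integral_unique[OF A[of "r/2" x]] that r by simp
  have "continuous_on {r/2..r+1} h" using h r by (intro continuous_at_imp_continuous_on) auto
  then have "((\<lambda>y. integral {r/2..y} h) has_real_derivative h r) (at r within {r/2..r+1})"
    by (rule integral_has_real_derivative) (use r in auto)
  then have "((\<lambda>y. integral {r/2..y} h) has_real_derivative h r) (at r within {r/2<..<r+1})"
    by (rule has_field_derivative_subset) auto
  then have "((\<lambda>y. integral {r/2..y} h) has_real_derivative h r) (at r)"
    using at_within_open[of r "{r/2<..<r+1}"] r by simp
  from DERIV_add[OF DERIV_const[of "A (r/2)"] this]
  have "((\<lambda>y. A (r/2) + integral {r/2..y} h) has_real_derivative h r) (at r)" by simp
  then show ?thesis
    by (rule has_field_derivative_transform_within_open[where S = "{r/2<..<r+1}"])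
       (use int r in auto)
qed

text \<open>A fixed point \<open>u\<close> is measurable because \<open>lowint u\<close> and \<open>uppint u\<close> are monotone in \<open>r\<close> whatever \<open>u\<close> is.\<close>

lemma green_fixed_point_solution:
  assumes u: "\<And>r. r > 0 \<Longrightarrow> 0 \<le> u r" "\<And>r. r > 0 \<Longrightarrow> u r \<le> 1" and fp: "\<And>r. r > 0 \<Longrightarrow> u r = green u r"
  obtains u' where "\<And>r. r > 0 \<Longrightarrow> (u has_real_derivative u' r) (at r)"
    "\<And>r. r > 0 \<Longrightarrow> (u' has_real_derivative ((1 + ((u r)\<^sup>2 - 1) / r\<^sup>2) * u r)) (at r)"
proof -
  have uv: "unit_valued u" using u by (simp add: unit_valued_def)
  define A where "A r = enn2real (lowint u r)" for r
  define B where "B r = enn2real (uppint u r)" for r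
  have uAB: "u r = sphk r * A r + sphi r * B r" if "r > 0" for r
    using fp[OF that] by (simp add: green_def A_def B_def)
  have monoA: "mono_on {0<..} A"
  proof (rule mono_onI)
    fix r s :: real assume rs: "r \<in> {0<..}" "s \<in> {0<..}" "r \<le> s"
    have "lowint u r \<le> lowint u s" unfolding lowint_def using rs
      by (intro nn_integral_mono) (auto simp: indicator_def)
    then show "A r \<le> A s" unfolding A_def using lowint_finite[OF uv, of s] rs by (intro enn2real_mono) auto
  qed
  have monoB: "mono_on {0<..} (\<lambda>r. - B r)"
  proof (rule mono_onI)
    fix r s :: real assume rs: "r \<in> {0<..}" "s \<in> {0<..}" "r \<le> s"
    have "uppint u s \<le> uppint u r" unfolding uppint_def using rs
      by (intro nn_integral_mono) (auto simp: indicator_def)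
    then show "- B r \<le> - B s" unfolding B_def using uppint_finite[OF uv, of r] rs by (simp add: enn2real_mono)
  qed
  let ?M = "restrict_space borel {0<..} :: real measure"
  have Am: "A \<in> borel_measurable ?M" using borel_measurable_mono_on_fnc[OF monoA] .
  have Bm: "B \<in> borel_measurable ?M"
    using borel_measurable_uminus[OF borel_measurable_mono_on_fnc[OF monoB]] by simp
  have cm: "f \<in> borel_measurable ?M" if "\<And>r. r > 0 \<Longrightarrow> isCont f r" for f :: "real \<Rightarrow> real"
    using that by (intro borel_measurable_continuous_on_restrict continuous_at_imp_continuous_on) auto
  have km: "sphk \<in> borel_measurable ?M" and im: "sphi \<in> borel_measurable ?M"
    using DERIV_isCont[OF DERIV_sphk] DERIV_isCont[OF DERIV_sphi] by (auto intro: cm)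
  have "(\<lambda>r. sphk r * A r + sphi r * B r) \<in> borel_measurable ?M" using Am Bm km im by measurable
  then have um: "u \<in> borel_measurable ?M"
    by (rule measurable_cong[THEN iffD1, rotated]) (simp add: uAB space_restrict_space)
  have cub0: "0 \<le> cubic (u s)" if "s > 0" for s using u that by (intro cubic_bounds(3)) auto
  define ha where "ha s = indicator {0<..} s * (sphi s * cubic (u s) / s\<^sup>2)" for s
  define hb where "hb s = indicator {0<..} s * (sphk s * cubic (u s) / s\<^sup>2)" for s
  have idm: "(\<lambda>s::real. s) \<in> borel_measurable ?M" by (intro cm) auto
  have ham: "ha \<in> borel_measurable borel"
  proof -
    have "(\<lambda>s. sphi s * cubic (u s) / s\<^sup>2) \<in> borel_measurable ?M"
      unfolding cubic_def using um im idm by measurable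
    then show ?thesis by (subst (asm) borel_measurable_restrict_space_iff) (auto simp: ha_def[abs_def])
  qed
  have hbm: "hb \<in> borel_measurable borel"
  proof -
    have "(\<lambda>s. sphk s * cubic (u s) / s\<^sup>2) \<in> borel_measurable ?M"
      unfolding cubic_def using um km idm by measurable
    then show ?thesis by (subst (asm) borel_measurable_restrict_space_iff) (auto simp: hb_def[abs_def])
  qed
  have ha0: "0 \<le> ha s" for s using sphi_nonneg[of s] cub0[of s] by (auto simp: ha_def indicator_def)
  have hb0: "0 \<le> hb s" for s using sphk_nonneg[of s] cub0[of s] by (auto simp: hb_def indicator_def)
  have low: "lowint u r = (\<integral>\<^sup>+s. ennreal (ha s) * indicator {0<..<r} s \<partial>lborel)" for r
    unfolding lowint_def by (intro nn_integral_cong) (auto simp: ha_def indicator_def)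
  have upp: "uppint u r = (\<integral>\<^sup>+s. ennreal (hb s) * indicator {r<..} s \<partial>lborel)" if "r > 0" for r
    unfolding uppint_def using that by (intro nn_integral_cong) (auto simp: hb_def indicator_def)
  have incA: "(ha has_integral (A y - A x)) {x..y}" if xy: "0 < x" "x \<le> y" for x y
  proof -
    let ?J = "\<integral>\<^sup>+s. ennreal (ha s) * indicator {x..<y} s \<partial>lborel"
    have "lowint u y = (\<integral>\<^sup>+s. ennreal (ha s) * indicator {0<..<x} s + ennreal (ha s) * indicator {x..<y} s \<partial>lborel)"
      unfolding low using xy by (intro nn_integral_cong) (auto simp: indicator_def)
    also have "\<dots> = lowint u x + ?J" unfolding low using ham by (intro nn_integral_add) auto
    finally have eq: "lowint u y = lowint u x + ?J" .
    have fin: "lowint u y < \<infinity>" "lowint u x < \<infinity>" using lowint_finite[OF uv] xy by auto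
    then have "?J < \<infinity>" unfolding eq by (auto simp: less_top)
    then have "(ha has_integral enn2real ?J) {x..y}" by (intro nn_integral_imp_has_integral_Icc ham ha0) auto
    moreover have "A y = A x + enn2real ?J" unfolding A_def eq using fin \<open>?J < \<infinity>\<close> by (intro enn2real_plus) auto
    ultimately show ?thesis by simp
  qed
  have incB: "(hb has_integral (- B y - (- B x))) {x..y}" if xy: "0 < x" "x \<le> y" for x y
  proof -
    let ?J = "\<integral>\<^sup>+s. ennreal (hb s) * indicator {x<..y} s \<partial>lborel"
    have y: "y > 0" using xy by simp
    have "uppint u x = (\<integral>\<^sup>+s. ennreal (hb s) * indicator {y<..} s + ennreal (hb s) * indicator {x<..y} s \<partial>lborel)"
      unfolding upp[OF xy(1)] using xy by (intro nn_integral_cong) (auto simp: indicator_def)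
    also have "\<dots> = uppint u y + ?J" unfolding upp[OF y] using hbm by (intro nn_integral_add) auto
    finally have eq: "uppint u x = uppint u y + ?J" .
    have fin: "uppint u y < \<infinity>" "uppint u x < \<infinity>" using uppint_finite[OF uv] xy by auto
    then have "?J < \<infinity>" unfolding eq by (auto simp: less_top)
    then have "(hb has_integral enn2real ?J) {x..y}" by (intro nn_integral_imp_has_integral_Icc hbm hb0) auto
    moreover have "B x = B y + enn2real ?J" unfolding B_def eq using fin \<open>?J < \<infinity>\<close> by (intro enn2real_plus) auto
    ultimately show ?thesis by simp
  qed
  have contA: "isCont A r" if "r > 0" for r using continuous_of_increments[OF incA that] .
  have contB: "isCont B r" if "r > 0" for r
    using continuous_minus[OF continuous_of_increments[OF incB that]] by simp
  have contu: "isCont u r" if r: "r > 0" for r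
  proof -
    have "isCont (\<lambda>r. sphk r * A r + sphi r * B r) r"
      using contA contB DERIV_isCont[OF DERIV_sphk] DERIV_isCont[OF DERIV_sphi] r by (intro continuous_intros) auto
    moreover have "eventually (\<lambda>s. u s = sphk s * A s + sphi s * B s) (nhds r)"
      using eventually_nhds_in_open[of "{0<..}" r] r by (auto elim!: eventually_mono simp: uAB)
    ultimately show ?thesis by (simp add: isCont_cong)
  qed
  have conth: "isCont (\<lambda>s. p s * cubic (u s) / s\<^sup>2) r" if "isCont p r" "r > 0" for p r
    unfolding cubic_def using that contu by (intro continuous_intros) auto
  have ind: "eventually (\<lambda>s. indicator {0<..} s * p s = p s) (nhds r)" if "r > 0" for p :: "real \<Rightarrow> real" and r
    using eventually_nhds_in_open[of "{0<..}" r] that by (auto elim!: eventually_mono)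
  have contha: "isCont ha r" if "r > 0" for r
    unfolding ha_def[abs_def] 
    by (rule isCont_cong[OF ind[OF that], THEN iffD2, OF conth[OF DERIV_isCont[OF DERIV_sphi[OF that]] that]])
  have conthb: "isCont hb r" if "r > 0" for r
    unfolding hb_def[abs_def] 
    by (rule isCont_cong[OF ind[OF that], THEN iffD2, OF conth[OF DERIV_isCont[OF DERIV_sphk[OF that]] that]])
  have dA: "(A has_real_derivative (sphi r * cubic (u r) / r\<^sup>2)) (at r)" if "r > 0" for r
    using DERIV_of_increments[OF incA contha that] that by (simp add: ha_def)
  have dB: "(B has_real_derivative (- (sphk r * cubic (u r) / r\<^sup>2))) (at r)" if "r > 0" for r
    using DERIV_minus[OF DERIV_of_increments[OF incB conthb that]] that by (simp add: hb_def)
  \<comment> \<open>Variation of parameters: the derivatives of \<open>A\<close> and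
    \<open>B\<close> satisfy \<open>sphk A' + sphi B' = 0\<close>, so they do not show up in the
    first derivative.\<close>
  define u' where "u' r = sphk' r * A r + sphi' r * B r" for r
  show ?thesis
  proof (rule that[of u'])
    fix r :: real assume r: "r > 0"
    have "((\<lambda>r. sphk r * A r + sphi r * B r) has_real_derivative u' r) (at r)"
      by (rule DERIV_cong[OF DERIV_add[OF DERIV_mult[OF DERIV_sphk[OF r] dA[OF r]] DERIV_mult[OF DERIV_sphi[OF
        r] dB[OF r]]]])
         (simp add: u'_def algebra_simps)
    then show "(u has_real_derivative u' r) (at r)"
      by (rule has_field_derivative_transform_within_open[where S = "{0<..}"]) (use r uAB in auto)
    define c where "c = cubic (u r) / r\<^sup>2"
    have "((\<lambda>r. sphk' r * A r + sphi' r * B r) has_real_derivative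
        ((1 + 2 / r\<^sup>2) * sphk r * A r + sphi r * cubic (u r) / r\<^sup>2 * sphk' r
          + ((1 + 2 / r\<^sup>2) * sphi r * B r + - (sphk r * cubic (u r) / r\<^sup>2) * sphi' r))) (at r)"
      by (rule DERIV_add[OF DERIV_mult[OF DERIV_sphk'[OF r] dA[OF r]] DERIV_mult[OF DERIV_sphi'[OF r] dB[OF r]]])
    moreover have "(1 + 2 / r\<^sup>2) * sphk r * A r + sphi r * cubic (u r) / r\<^sup>2 * sphk' r
          + ((1 + 2 / r\<^sup>2) * sphi r * B r + - (sphk r * cubic (u r) / r\<^sup>2) * sphi' r)
        = (1 + 2 / r\<^sup>2) * (sphk r * A r + sphi r * B r) - (sphk r * sphi' r - sphi r * sphk' r) * c"
      by (simp add: c_def algebra_simps)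
    moreover have "\<dots> = (1 + ((u r)\<^sup>2 - 1) / r\<^sup>2) * u r"
      unfolding uAB[OF r, symmetric] sph_wronskian[OF r] c_def cubic_def using r
      by (simp add: field_simps power2_eq_square power3_eq_cube)
    ultimately show "(u' has_real_derivative ((1 + ((u r)\<^sup>2 - 1) / r\<^sup>2) * u r)) (at r)"
      unfolding u'_def[abs_def] by simp
  qed
qed

text \<open>The scaling \<open>r \<mapsto> m r\<close> reduces everything to \<open>m = 1\<close>.
  Both barriers equal 1 at the origin, which gives the limit there by squeezing; the limit at
  infinity needs the decay estimate, as the upper barrier is constant.\<close>

lemma nonneg_profile_exists:
  assumes m: "m > 0"
  obtains u u' where "nonneg_profile m u u'"
proof -
  obtain u where u: "\<And>r. r > 0 \<Longrightarrow> exp (- r) \<le> u r" "\<And>r. r > 0 \<Longrightarrow> u r \<le> 1" "\<And>r. r > 0 \<Longrightarrow> u r = green u r"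
    using green_fixed_point by blast
  have u0: "0 \<le> u r" if "r > 0" for r using u(1)[OF that] by (rule order_trans[rotated]) simp
  obtain u' where u': "\<And>r. r > 0 \<Longrightarrow> (u has_real_derivative u' r) (at r)"
    "\<And>r. r > 0 \<Longrightarrow> (u' has_real_derivative ((1 + ((u r)\<^sup>2 - 1) / r\<^sup>2) * u r)) (at r)"
    using green_fixed_point_solution[OF u0 u(2,3)] by blast
  have lim0: "(u \<longlongrightarrow> 1) (at_right 0)"
  proof (rule tendsto_sandwich)
    show "eventually (\<lambda>r. exp (- r) \<le> u r) (at_right 0)" "eventually (\<lambda>r. u r \<le> 1) (at_right 0)"
      using u(1,2) by (auto simp: eventually_at_right_field intro: exI[of _ 1])
    have "((\<lambda>r::real. exp (- r)) \<longlongrightarrow> exp (- 0)) (at_right 0)" by (intro tendsto_intros)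
    then show "((\<lambda>r::real. exp (- r)) \<longlongrightarrow> 1) (at_right 0)" by simp
  qed simp
  \<comment> \<open>For \<open>s \<ge> 2\<close> the potential is at least \<open>1 - 1/4\<close>,
    above \<open>(1/2)^2\<close>; any rate giving decay would do here.\<close>
  have bd: "\<bar>u r\<bar> \<le> \<bar>u 2\<bar> * exp (- (1/2) * (r - 2))" if "r \<ge> 2" for r
  proof (rule decay_bound[of "1/2" 2 u u' "\<lambda>r. 1 + ((u r)\<^sup>2 - 1) / r\<^sup>2" 1, OF _ _ _ _ _ that])
    fix s :: real assume s: "s \<ge> 2"
    then have "s\<^sup>2 \<ge> 2\<^sup>2" by (intro power_mono) auto
    then have "1 / s\<^sup>2 \<le> 1 / 4" by (intro divide_left_mono) auto
    moreover have "((u s)\<^sup>2 - 1) / s\<^sup>2 \<ge> - 1 / s\<^sup>2" by (intro divide_right_mono) auto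
    moreover have "(1/2)\<^sup>2 = (1/4::real)" by (simp add: power2_eq_square)
    ultimately show "(1/2)\<^sup>2 \<le> 1 + ((u s)\<^sup>2 - 1) / s\<^sup>2" by linarith
    show "\<bar>u s\<bar> \<le> 1" using u0[of s] u(2)[of s] s by simp
  qed (use u' in auto)
  have liminf: "(u \<longlongrightarrow> 0) at_top"
  proof (rule Lim_null_comparison)
    show "eventually (\<lambda>r. norm (u r) \<le> \<bar>u 2\<bar> * exp (- (1/2) * (r - 2))) at_top"
      using eventually_ge_at_top[of 2] by eventually_elim (use bd in auto)
    have "((\<lambda>r::real. exp (- (1/2) * (r - 2))) \<longlongrightarrow> 0) at_top" by real_asymp
    from tendsto_mult_right_zero[OF this] show "((\<lambda>r. \<bar>u 2\<bar> * exp (- (1/2) * (r - 2))) \<longlongrightarrow> 0) at_top" .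
  qed
  have "nonneg_profile m (\<lambda>r. u (m * r)) (\<lambda>r. m * u' (m * r))"
  proof
    fix r :: real assume r: "r > 0"
    then have mr: "m * r > 0" using m by simp
    have lin: "((\<lambda>r. m * r) has_real_derivative m) (at r)" by (auto intro!: derivative_eq_intros)
    show "((\<lambda>r. u (m * r)) has_real_derivative m * u' (m * r)) (at r)"
      using DERIV_chain2[OF u'(1)[OF mr] lin] by (simp add: mult.commute)
    from DERIV_cmult[OF DERIV_chain2[OF u'(2)[OF mr] lin], of m]
    show "((\<lambda>r. m * u' (m * r)) has_real_derivative (m\<^sup>2 + ((u (m * r))\<^sup>2 - 1) / r\<^sup>2) * u (m * r)) (at r)"
      by (rule DERIV_cong) (use m r in \<open>simp add: field_simps power2_eq_square\<close>)
    show "0 \<le> u (m * r)" using u0[OF mr] .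
  next
    show "((\<lambda>r. u (m * r)) \<longlongrightarrow> 1) (at_right 0)"
      by (rule filterlim_compose[OF lim0]) (use m in real_asymp)
    show "((\<lambda>r. u (m * r)) \<longlongrightarrow> 0) at_top"
      by (rule filterlim_compose[OF liminf]) (use m in real_asymp)
  qed (rule m)
  then show ?thesis by (rule that)
qed

section \<open>Energy bounds and uniqueness\<close>

lemma continuous_imp_nn_measurable:
  assumes "continuous_on {0<..} (g :: real \<Rightarrow> real)"
  shows "(\<lambda>x. ennreal (g x) * indicator {0<..} x) \<in> borel_measurable lebesgue"
proof -
  have "(\<lambda>x. indicator {0<..} x *\<^sub>R g x) \<in> borel_measurable borel"
    using assms by (intro borel_measurable_continuous_on_indicator) auto
  then have "(\<lambda>x. ennreal (indicator {0<..} x *\<^sub>R g x)) \<in> borel_measurable lebesgue"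
    by (intro measurable_compose[OF _ measurable_ennreal] measurable_completion) simp
  moreover have "(\<lambda>x. ennreal (indicator {0<..} x *\<^sub>R g x)) = (\<lambda>x. ennreal (g x) * indicator {0<..} x)"
    by (auto simp: indicator_def)
  ultimately show ?thesis by simp
qed

lemma nn_integral_continuous_add:
  assumes "continuous_on {0<..} (f :: real \<Rightarrow> real)" "continuous_on {0<..} g"
    and "\<And>x. x > 0 \<Longrightarrow> 0 \<le> f x" "\<And>x. x > 0 \<Longrightarrow> 0 \<le> g x"
  shows "(\<integral>\<^sup>+x\<in>{0<..}. ennreal (f x + g x) \<partial>lebesgue) =
    (\<integral>\<^sup>+x\<in>{0<..}. ennreal (f x) \<partial>lebesgue) + (\<integral>\<^sup>+x\<in>{0<..}. ennreal (g x) \<partial>lebesgue)"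
proof -
  have "(\<integral>\<^sup>+x\<in>{0<..}. ennreal (f x + g x) \<partial>lebesgue)
      = (\<integral>\<^sup>+x. ennreal (f x) * indicator {0<..} x + ennreal (g x) * indicator {0<..} x \<partial>lebesgue)"
    using assms(3,4) by (intro nn_integral_cong) (auto simp: indicator_def)
  also have "\<dots> = (\<integral>\<^sup>+x\<in>{0<..}. ennreal (f x) \<partial>lebesgue) + (\<integral>\<^sup>+x\<in>{0<..}. ennreal (g x) \<partial>lebesgue)"
    by (intro nn_integral_add continuous_imp_nn_measurable assms)
  finally show ?thesis .
qed

lemma nn_integral_continuous_pos:
  assumes g: "continuous_on {0<..} (g :: real \<Rightarrow> real)" and r: "r > 0" "g r > 0"
  shows "(\<integral>\<^sup>+x\<in>{0<..}. ennreal (g x) \<partial>lebesgue) > 0"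
proof -
  have "isCont g r" using g r by (simp add: continuous_on_eq_continuous_at)
  then have "eventually (\<lambda>x. g x > g r / 2) (at r)"
    unfolding isCont_def by (rule order_tendstoD(1)) (use r in simp)
  then obtain d where d: "d > 0" "\<And>x. x \<noteq> r \<Longrightarrow> dist x r < d \<Longrightarrow> g x > g r / 2" by (auto simp: eventually_at)
  have d': "g r / 2 \<le> g x" if "r \<le> x" "x \<le> r + d / 2" for x
    using d(2)[of x] that d(1) r by (cases "x = r") (auto simp: dist_real_def intro: less_imp_le)
  have "0 < ennreal (g r / 2) * ennreal (d / 2)" using r d by (simp add: ennreal_zero_less_mult_iff)
  also have "\<dots> = (\<integral>\<^sup>+x. ennreal (g r / 2) * indicator {r..r + d / 2} x \<partial>lborel)"
    using d by (simp add: nn_integral_cmult_indicator)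
  also have "\<dots> \<le> (\<integral>\<^sup>+x\<in>{0<..}. ennreal (g x) \<partial>lborel)"
    using d' r by (intro nn_integral_mono) (auto simp: indicator_def intro!: ennreal_leI)
  finally show ?thesis by (simp add: nn_integral_completion)
qed

section \<open>Solutions as admissible profiles\<close>

lemma profile_of_solution:
  assumes "\<alpha> > 0" "\<beta> > 0" "is_solution \<alpha> \<beta> u"
  shows "profile (sqrt (\<alpha> * \<beta> / 2)) u (deriv u)"
proof
  show "sqrt (\<alpha> * \<beta> / 2) > 0" using assms by simp
  fix r :: real assume r: "r > 0"
  show "(u has_real_derivative deriv u r) (at r)"
    using assms(3) r by (auto simp: is_solution_def DERIV_deriv_iff_real_differentiable)
  have "(deriv u has_real_derivative (1/2 * \<alpha> * \<beta> * u r + 1 / r\<^sup>2 * ((u r)\<^sup>2 - 1) * u r)) (at r)"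
    using assms(3) r by (auto simp: is_solution_def)
  then show "(deriv u has_real_derivative (((sqrt (\<alpha> * \<beta> / 2))\<^sup>2 + ((u r)\<^sup>2 - 1) / r\<^sup>2) * u r)) (at r)"
    by (rule DERIV_cong) (use assms in \<open>simp add: distrib_right\<close>)
qed (use assms in \<open>auto simp: is_solution_def\<close>)

lemma (in profile) abs_cont:
  assumes "0 < a" shows "abs_cont_on {a..b} u"
proof (rule abs_cont_on_continuous_derivative)
  show "(u has_real_derivative u' x) (at x within {a..b})" if "x \<in> {a..b}" for x
    by (rule has_field_derivative_at_within[OF DERIV_u]) (use that assms in auto)
  show "continuous_on {a..b} u'"
    using assms isCont_u' by (intro continuous_at_imp_continuous_on) auto
qed

lemma (in profile) solution:
  assumes "\<alpha> * \<beta> = 2 * m\<^sup>2" shows "is_solution \<alpha> \<beta> u"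
  unfolding is_solution_def
proof (intro conjI allI impI lim_0 lim_infinity)
  fix r :: real assume r: "r > 0"
  show "u differentiable at r" using DERIV_u[OF r] by (auto simp: real_differentiable_def)
  have "(u' has_real_derivative (1/2 * \<alpha> * \<beta> * u r + 1 / r\<^sup>2 * ((u r)\<^sup>2 - 1) * u r)) (at r)"
    by (rule DERIV_cong[OF DERIV_u'[OF r]]) (use assms in \<open>simp add: distrib_right\<close>)
  then show "(deriv u has_real_derivative (1/2 * \<alpha> * \<beta> * u r + 1 / r\<^sup>2 * ((u r)\<^sup>2 - 1) * u r)) (at r)"
    by (rule has_field_derivative_transform_within_open[where S = "{0<..}"])
       (use r DERIV_imp_deriv[OF DERIV_u] in auto)
qed

lemma (in profile) admissible:
  assumes "\<alpha> * \<beta> \<ge> 0" shows "admissible \<alpha> \<beta> u"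
  using abs_cont energy_finite[OF assms] lim_0 lim_infinity by (auto simp: admissible_def)

lemma (in profile) decay_bigo:
  assumes "0 < \<epsilon>" "\<epsilon> < 1"
  shows "u \<in> O[at_top](\<lambda>r. exp (- m * (1 - \<epsilon>) * r))" "u' \<in> O[at_top](\<lambda>r. exp (- m * (1 - \<epsilon>) * r))"
proof -
  have k: "0 < m * (1 - \<epsilon>)" "m * (1 - \<epsilon>) < m" using m assms by (auto simp: mult_less_cancel_left2)
  obtain A R where AR: "\<And>r. r \<ge> R \<Longrightarrow> \<bar>u r\<bar> \<le> A * exp (- (m * (1 - \<epsilon>)) * r)"
      "\<And>r. r \<ge> R \<Longrightarrow> \<bar>u' r\<bar> \<le> A * exp (- (m * (1 - \<epsilon>)) * r)"
    using exponential_decay[OF k] by metis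
  show "u \<in> O[at_top](\<lambda>r. exp (- m * (1 - \<epsilon>) * r))"
    by (rule bigoI[of _ A]) (use eventually_ge_at_top[of R] in \<open>eventually_elim, use AR(1) in simp\<close>)
  show "u' \<in> O[at_top](\<lambda>r. exp (- m * (1 - \<epsilon>) * r))"
    by (rule bigoI[of _ A]) (use eventually_ge_at_top[of R] in \<open>eventually_elim, use AR(2) in simp\<close>)
qed

section \<open>Minimality, uniqueness and the lower energy bound\<close>

context nonneg_profile
begin

text \<open>Splitting off the remainder turns the calibrated bound into a quantitative gap, from
  which both minimality and uniqueness are read.\<close>

lemma energy_gap:
  assumes c: "\<alpha> * \<beta> = 2 * m\<^sup>2"
    and v: "\<And>a b. 0 < a \<Longrightarrow> a \<le> b \<Longrightarrow> abs_cont_on {a..b} v" and vl: "(v \<longlongrightarrow> 1) (at_right 0)" "(v \<longlongrightarrow> 0) at_top"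
  shows "energy \<alpha> \<beta> u + (\<integral>\<^sup>+r\<in>{0<..}. ennreal (((u r)\<^sup>2 - (v r)\<^sup>2)\<^sup>2 / r\<^sup>2) \<partial>lebesgue) \<le> energy \<alpha> \<beta> v"
proof -
  have c0: "\<alpha> * \<beta> \<ge> 0" using c by simp
  have cu: "continuous_on {0<..} u" "continuous_on {0<..} u'"
    using isCont_u isCont_u' by (auto intro: continuous_at_imp_continuous_on)
  have cv: "continuous_on {0<..} v" by (rule continuous_on_of_locally_abs_cont[OF v])
  have "continuous_on {0<..} (\<lambda>r. 2 * (u' r)\<^sup>2 + (1 - (u r)\<^sup>2)\<^sup>2 / r\<^sup>2 + \<alpha> * \<beta> * (u r)\<^sup>2)"
    by (intro continuous_intros cu) auto
  then have cd: "continuous_on {0<..} (energy_density (\<alpha> * \<beta>) u)"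
    by (rule continuous_on_eq) (use DERIV_imp_deriv[OF DERIV_u] in auto)
  have "energy \<alpha> \<beta> u + (\<integral>\<^sup>+r\<in>{0<..}. ennreal (((u r)\<^sup>2 - (v r)\<^sup>2)\<^sup>2 / r\<^sup>2) \<partial>lebesgue)
    = (\<integral>\<^sup>+r\<in>{0<..}. ennreal (energy_density (\<alpha> * \<beta>) u r + ((u r)\<^sup>2 - (v r)\<^sup>2)\<^sup>2 / r\<^sup>2) \<partial>lebesgue)"
    unfolding energy_def
    by (rule nn_integral_continuous_add[symmetric, OF cd])
       (use c0 in \<open>auto intro!: continuous_intros cu cv\<close>)
  also have "\<dots> \<le> energy \<alpha> \<beta> v"
    by (rule energy_ge_calibrated[OF DERIV_u _ pos deriv_bound lim_0 lim_infinity v vl c0])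
       (use DERIV_u' c in auto)
  finally show "energy \<alpha> \<beta> u + (\<integral>\<^sup>+r\<in>{0<..}. ennreal (((u r)\<^sup>2 - (v r)\<^sup>2)\<^sup>2 / r\<^sup>2) \<partial>lebesgue) \<le> energy \<alpha> \<beta> v" .
qed

lemma minimal:
  assumes "\<alpha> * \<beta> = 2 * m\<^sup>2" "admissible \<alpha> \<beta> v" shows "energy \<alpha> \<beta> u \<le> energy \<alpha> \<beta> v"
  using energy_gap[OF assms(1), of v] assms(2) unfolding admissible_def
  by (meson add_increasing2 order_refl order_trans zero_le)

text \<open>If \<open>v\<close> does no worse than \<open>u\<close>, the gap integral vanishes and
  \<open>v^2 = u^2\<close> by continuity. Since \<open>u\<close> has no zero and \<open>v\<close> is
  positive near the origin, \<open>v\<close> cannot change sign.\<close>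

lemma unique:
  assumes c: "\<alpha> * \<beta> = 2 * m\<^sup>2" and v: "admissible \<alpha> \<beta> v" and le: "energy \<alpha> \<beta> v \<le> energy \<alpha> \<beta> u" and r: "r > 0"
  shows "v r = u r"
proof -
  let ?D = "\<integral>\<^sup>+r\<in>{0<..}. ennreal (((u r)\<^sup>2 - (v r)\<^sup>2)\<^sup>2 / r\<^sup>2) \<partial>lebesgue"
  have v1: "\<And>a b. 0 < a \<Longrightarrow> a \<le> b \<Longrightarrow> abs_cont_on {a..b} v" and vl: "(v \<longlongrightarrow> 1) (at_right 0)" "(v \<longlongrightarrow> 0) at_top"
    using v by (auto simp: admissible_def)
  note gap = energy_gap[OF c v1 vl] and cv = continuous_on_of_locally_abs_cont[OF v1]
  have fin: "energy \<alpha> \<beta> u < \<infinity>" using energy_finite c by simp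
  have "energy \<alpha> \<beta> u + ?D \<le> energy \<alpha> \<beta> u + 0" using order_trans[OF gap le] unfolding add_0_right .
  \<comment> \<open>Cancelling a summand in the extended reals is legitimate only because the energy
    of \<open>u\<close> is finite.\<close>
  then have "energy \<alpha> \<beta> u = top \<or> ?D \<le> 0" by (simp only: ennreal_add_left_cancel_le infinity_ennreal_def)
  then have "?D \<le> 0" using fin by (elim disjE) simp_all
  then have D: "?D = 0" by (rule antisym) (rule zero_le)
  have cu: "continuous_on {0<..} u" using isCont_u by (auto intro: continuous_at_imp_continuous_on)
  have sq: "(u s)\<^sup>2 = (v s)\<^sup>2" if "s > 0" for s
  proof (rule ccontr)
    assume "(u s)\<^sup>2 \<noteq> (v s)\<^sup>2"
    then have "((u s)\<^sup>2 - (v s)\<^sup>2)\<^sup>2 / s\<^sup>2 > 0" using that by simp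
    then have "?D > 0"
      by (intro nn_integral_continuous_pos[OF _ that] continuous_intros cu cv) auto
    then show False using D by simp
  qed
  have "v r > 0"
  proof (rule ccontr)
    assume "\<not> v r > 0"
    have "eventually (\<lambda>s. v s > 0) (at_right 0)" by (rule order_tendstoD(1)[OF vl(1)]) simp
    then obtain d where d: "d > 0" "\<And>s. 0 < s \<Longrightarrow> s < d \<Longrightarrow> v s > 0" by (auto simp: eventually_at_right_field)
    define s where "s = min d r / 2"
    have s: "0 < s" "s < d" "s < r" using d r by (auto simp: s_def)
    have "continuous_on {s..r} v" using cv by (rule continuous_on_subset) (use s in auto)
    then obtain x where "s \<le> x" "x \<le> r" "v x = 0"
      using IVT2'[of v r 0 s] d(2)[OF s(1,2)] s \<open>\<not> v r > 0\<close> by force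
    then have "(u x)\<^sup>2 = 0" using sq[of x] s by simp
    then show False using pos[of x] s \<open>s \<le> x\<close> by simp
  qed
  then show ?thesis using sq[OF r] pos[OF r] by (simp add: power2_eq_iff_nonneg)
qed

text \<open>\<open>2 u'\<^sup>2 + 2 m\<^sup>2 u\<^sup>2 \<ge> - 4 m u u' = - (2 m u\<^sup>2)'\<close>, whose integral is \<open>2 m\<close>.\<close>

lemma energy_lower_bound:
  assumes c: "\<alpha> * \<beta> = 2 * m\<^sup>2"
  shows "ennreal (2 * m) < energy \<alpha> \<beta> u"
proof -
  let ?g = "\<lambda>r. - 4 * m * u r * u' r"
  let ?h = "\<lambda>r. (1 - (u r)\<^sup>2)\<^sup>2 / r\<^sup>2"
  have cu: "continuous_on {0<..} u" "continuous_on {0<..} u'"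
    using isCont_u isCont_u' by (auto intro: continuous_at_imp_continuous_on)
  have g0: "0 \<le> ?g r" if "r > 0" for r
    using m pos[OF that] deriv_nonpos[OF that] by (auto simp: mult_nonneg_nonpos zero_le_mult_iff)
  have "(\<integral>\<^sup>+x. ennreal (?g x) * indicator (einterval 0 \<infinity>) x \<partial>lborel) = ennreal (0 - (- 2 * m))"
  proof (rule nn_integral_FTC_einterval[where F = "\<lambda>r. - 2 * m * (u r)\<^sup>2"])
    show "((\<lambda>r. - 2 * m * (u r)\<^sup>2) has_real_derivative ?g x) (at x)" if "0 < ereal x" for x
      using that DERIV_u[of x] by (auto intro!: derivative_eq_intros)
    show "isCont ?g x" if "0 < ereal x" for x
      using that isCont_u isCont_u' by (intro continuous_intros) auto
    have "((\<lambda>r. - 2 * m * (u r)\<^sup>2) \<longlongrightarrow> - 2 * m * 1\<^sup>2) (at_right 0)" by (intro tendsto_intros lim_0)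
    then show "(((\<lambda>r. - 2 * m * (u r)\<^sup>2) \<circ> real_of_ereal) \<longlongrightarrow> - 2 * m) (at_right 0)"
      by (simp add: ereal_tendsto_simps zero_ereal_def)
    have "((\<lambda>r. - 2 * m * (u r)\<^sup>2) \<longlongrightarrow> - 2 * m * 0\<^sup>2) at_top" by (intro tendsto_intros lim_infinity)
    then show "(((\<lambda>r. - 2 * m * (u r)\<^sup>2) \<circ> real_of_ereal) \<longlongrightarrow> 0) (at_left \<infinity>)"
      by (simp add: ereal_tendsto_simps)
  qed (use g0 in auto)
  moreover have "einterval 0 \<infinity> = {0<..}" by (auto simp: einterval_def)
  ultimately have G: "(\<integral>\<^sup>+x\<in>{0<..}. ennreal (?g x) \<partial>lebesgue) = ennreal (2 * m)" by (simp add: nn_integral_completion)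
  \<comment> \<open>The discarded potential term is positive at \<open>r = 1\<close>, which makes
    the bound strict.\<close>
  have H: "(\<integral>\<^sup>+x\<in>{0<..}. ennreal (?h x) \<partial>lebesgue) > 0"
  proof (rule nn_integral_continuous_pos[of _ 1])
    have "(u 1)\<^sup>2 < 1" using less_one[of 1] pos[of 1] by (simp add: power_less_one_iff)
    then show "0 < (1 - (u 1)\<^sup>2)\<^sup>2 / 1\<^sup>2" by simp
  qed (auto intro!: continuous_intros cu)
  have "ennreal (2 * m) + 0 < ennreal (2 * m) + (\<integral>\<^sup>+x\<in>{0<..}. ennreal (?h x) \<partial>lebesgue)"
    using H by (intro ennreal_add_left_cancel_less[THEN iffD2]) auto
  also have "\<dots> = (\<integral>\<^sup>+x\<in>{0<..}. ennreal (?g x + ?h x) \<partial>lebesgue)"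
    unfolding G[symmetric]
    by (rule nn_integral_continuous_add[symmetric]) (use g0 in \<open>auto intro!: continuous_intros cu\<close>)
  also have "\<dots> \<le> energy \<alpha> \<beta> u"
    unfolding energy_def
  proof (rule nn_integral_mono)
    fix r :: real
    have "?g r + ?h r \<le> energy_density (\<alpha> * \<beta>) u r" if "r > 0"
    proof -
      have "0 \<le> 2 * (u' r + m * u r)\<^sup>2" by simp
      then show ?thesis unfolding DERIV_imp_deriv[OF DERIV_u[OF that]] c by (simp add: power2_eq_square algebra_simps)
    qed
    then show "ennreal (?g r + ?h r) * indicator {0<..} r \<le> ennreal (energy_density (\<alpha> * \<beta>) u r) * indicator {0<..} r"
      by (auto simp: indicator_def intro: ennreal_leI)
  qed
  finally show ?thesis by simp
qed

end

text \<open>An antiderivative of \<open>(1 - exp (- t))\<^sup>2 / t\<^sup>2\<close> is \<open>- (1 - exp (- t))\<^sup>2 / t - 2 \<Phi> t\<close>, where \<open>\<Phi> t\<close> is the integral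
  of \<open>exp (- s) / s\<close> over \<open>[t, 2 t]\<close>, which tends to \<open>ln 2\<close> at the origin.\<close>

lemma trial_antiderivative:
  obtains P :: "real \<Rightarrow> real" where "\<And>t. t > 0 \<Longrightarrow> (P has_real_derivative ((1 - exp (- t))\<^sup>2 / t\<^sup>2)) (at t)"
    "(P \<longlongrightarrow> - 2 * ln 2) (at_right 0)" "(P \<longlongrightarrow> 0) at_top"
proof -
  \<comment> \<open>An exponential integral; only its differences over \<open>[t, 2 t]\<close> are
    used, so the constant of integration is immaterial.\<close>
  have "\<exists>F. \<forall>x. ereal 0 < ereal x \<longrightarrow> ereal x < \<infinity> \<longrightarrow> (F has_vector_derivative (exp (- x) / x)) (at x)"
    by (rule einterval_antiderivative) (auto intro!: continuous_intros)
  then obtain g where g: "\<And>x. x > 0 \<Longrightarrow> (g has_real_derivative (exp (- x) / x)) (at x)"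
    by (auto simp: has_real_derivative_iff_has_vector_derivative)
  define \<Phi> where "\<Phi> t = g (2 * t) - g t" for t
  have d\<Phi>: "(\<Phi> has_real_derivative ((exp (- 2 * t) - exp (- t)) / t)) (at t)" if t: "t > 0" for t
  proof -
    have "((\<lambda>t. g (2 * t)) has_real_derivative exp (- (2 * t)) / (2 * t) * 2) (at t)"
      by (rule DERIV_chain2[OF g]) (use t in \<open>auto intro!: derivative_eq_intros\<close>)
    from DERIV_diff[OF this g[OF t]] show ?thesis unfolding \<Phi>_def[abs_def]
      by (rule DERIV_cong) (use t in \<open>simp add: field_simps\<close>)
  qed
  \<comment> \<open>Compared with \<open>ln\<close>, the derivative of \<open>g - ln\<close> is
    \<open>(exp (- x) - 1) / x\<close>, which lies in \<open>[- 1, 0]\<close>; over an interval of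
    length \<open>t\<close> this costs at most \<open>t\<close>.\<close>
  have near: "ln 2 - t \<le> \<Phi> t \<and> \<Phi> t \<le> ln 2" if t: "t > 0" for t
  proof -
    have "((\<lambda>x. g x - ln x) has_real_derivative exp (- x) / x - 1 / x) (at x)" if "x > 0" for x
      using DERIV_diff[OF g[OF that] DERIV_ln_divide[OF that]] .
    then obtain \<xi> where \<xi>: "t < \<xi>" "(g (2 * t) - ln (2 * t)) - (g t - ln t) = (2 * t - t) * (exp (- \<xi>) / \<xi> - 1 / \<xi>)"
      using MVT2[of t "2 * t" "\<lambda>x. g x - ln x" "\<lambda>x. exp (- x) / x - 1 / x"] t by auto
    have "1 - \<xi> \<le> exp (- \<xi>)" using exp_ge_add_one_self[of "- \<xi>"] by simp
    then have "- 1 \<le> (exp (- \<xi>) - 1) / \<xi>" using \<xi>(1) t by (simp add: field_simps)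
    moreover have "(exp (- \<xi>) - 1) / \<xi> \<le> 0" using \<xi>(1) t by (intro divide_nonpos_pos) auto
    ultimately have "t * (- 1) \<le> t * ((exp (- \<xi>) - 1) / \<xi>)" "t * ((exp (- \<xi>) - 1) / \<xi>) \<le> t * 0"
      using t by (intro mult_left_mono; simp)+
    moreover have "\<Phi> t - ln 2 = t * ((exp (- \<xi>) - 1) / \<xi>)"
      using \<xi>(2) t by (simp add: \<Phi>_def ln_mult diff_divide_distrib)
    ultimately show ?thesis by simp
  qed
  have far: "0 \<le> \<Phi> t \<and> \<Phi> t \<le> exp (- t)" if t: "t > 0" for t
  proof -
    obtain \<xi> where \<xi>: "t < \<xi>" "g (2 * t) - g t = (2 * t - t) * (exp (- \<xi>) / \<xi>)"
      using MVT2[of t "2 * t" g "\<lambda>x. exp (- x) / x"] t g by auto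
    have "t / \<xi> \<le> 1" using \<xi>(1) t by simp
    then have "t / \<xi> * exp (- \<xi>) \<le> 1 * exp (- t)" using \<xi>(1) t by (intro mult_mono) auto
    moreover have "0 \<le> t / \<xi> * exp (- \<xi>)" using \<xi>(1) t by simp
    moreover have "\<Phi> t = t / \<xi> * exp (- \<xi>)" using \<xi>(2) by (simp add: \<Phi>_def)
    ultimately show ?thesis by simp
  qed
  have \<Phi>0: "(\<Phi> \<longlongrightarrow> ln 2) (at_right 0)"
  proof (rule tendsto_sandwich)
    show "eventually (\<lambda>t. ln 2 - t \<le> \<Phi> t) (at_right 0)" "eventually (\<lambda>t. \<Phi> t \<le> ln 2) (at_right 0)"
      using near by (auto simp: eventually_at_right_field intro: exI[of _ 1])
    have "((\<lambda>t. ln 2 - t) \<longlongrightarrow> ln 2 - 0) (at_right (0::real))" by (intro tendsto_intros)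
    then show "((\<lambda>t. ln 2 - t) \<longlongrightarrow> ln 2) (at_right (0::real))" by simp
  qed simp
  have \<Phi>inf: "(\<Phi> \<longlongrightarrow> 0) at_top"
  proof (rule tendsto_sandwich)
    show "eventually (\<lambda>t. 0 \<le> \<Phi> t) at_top" "eventually (\<lambda>t. \<Phi> t \<le> exp (- t)) at_top"
      using eventually_gt_at_top[of 0] by (eventually_elim, use far in simp)+
    show "((\<lambda>t::real. exp (- t)) \<longlongrightarrow> 0) at_top" by real_asymp
  qed simp
  define P where "P t = - (1 - exp (- t))\<^sup>2 / t - 2 * \<Phi> t" for t
  show ?thesis
  proof (rule that[of P])
    fix t :: real assume t: "t > 0"
    have "((\<lambda>t. - (1 - exp (- t))\<^sup>2 / t) has_real_derivative
        ((1 - exp (- t))\<^sup>2 / t\<^sup>2 - 2 * (1 - exp (- t)) * exp (- t) / t)) (at t)"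
      using t by (auto intro!: derivative_eq_intros simp: field_simps power2_eq_square)
    from DERIV_diff[OF this DERIV_cmult[OF d\<Phi>[OF t], of 2]]
    show "(P has_real_derivative ((1 - exp (- t))\<^sup>2 / t\<^sup>2)) (at t)" unfolding P_def[abs_def]
    proof (rule DERIV_cong)
      have "exp (- 2 * t) = exp (- t) * exp (- t)" by (simp add: exp_add[symmetric])
      then show "(1 - exp (- t))\<^sup>2 / t\<^sup>2 - 2 * (1 - exp (- t)) * exp (- t) / t - 2 * ((exp (- 2 * t) - exp (- t)) / t)
          = (1 - exp (- t))\<^sup>2 / t\<^sup>2"
        using t by (simp add: field_simps)
    qed
  next
    have "((\<lambda>t::real. - (1 - exp (- t))\<^sup>2 / t) \<longlongrightarrow> 0) (at_right 0)" by real_asymp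
    from tendsto_diff[OF this tendsto_mult[OF tendsto_const \<Phi>0, of 2]]
    show "(P \<longlongrightarrow> - 2 * ln 2) (at_right 0)" by (simp add: P_def[abs_def])
    have "((\<lambda>t::real. - (1 - exp (- t))\<^sup>2 / t) \<longlongrightarrow> 0) at_top" by real_asymp
    from tendsto_diff[OF this tendsto_mult[OF tendsto_const \<Phi>inf, of 2]]
    show "(P \<longlongrightarrow> 0) at_top" by (simp add: P_def[abs_def])
  qed
qed

text \<open>Substituting \<open>t = 2 l r\<close>, the potential term integrates to
  \<open>2 l * 2 ln 2\<close>; the gradient and mass terms give \<open>l\<close> and
  \<open>m^2 / l\<close>.\<close>

lemma energy_trial:
  assumes l: "l > 0" and c: "\<alpha> * \<beta> = 2 * m\<^sup>2"
  shows "energy \<alpha> \<beta> (\<lambda>r. exp (- l * r)) = ennreal (l * (1 + 4 * ln 2) + m\<^sup>2 / l)"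
proof -
  obtain P where P: "\<And>t. t > 0 \<Longrightarrow> (P has_real_derivative ((1 - exp (- t))\<^sup>2 / t\<^sup>2)) (at t)"
    "(P \<longlongrightarrow> - 2 * ln 2) (at_right 0)" "(P \<longlongrightarrow> 0) at_top"
    using trial_antiderivative by blast
  let ?v = "\<lambda>r. exp (- l * r)"
  let ?d = "\<lambda>r. 2 * (l * ?v r)\<^sup>2 + (1 - (?v r)\<^sup>2)\<^sup>2 / r\<^sup>2 + \<alpha> * \<beta> * (?v r)\<^sup>2"
  define F where "F r = 2 * l * P (2 * l * r) - (l + m\<^sup>2 / l) * exp (- 2 * l * r)" for r
  have dv: "deriv ?v r = - l * ?v r" for r
    by (rule DERIV_imp_deriv) (auto intro!: derivative_eq_intros)
  have sq: "(?v r)\<^sup>2 = exp (- 2 * l * r)" for r by (simp add: power2_eq_square exp_add[symmetric])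
  have "einterval 0 \<infinity> = {0<..}" by (auto simp: einterval_def)
  then have "energy \<alpha> \<beta> ?v = (\<integral>\<^sup>+x. ennreal (?d x) * indicator (einterval 0 \<infinity>) x \<partial>lborel)"
    unfolding energy_def dv by (simp add: nn_integral_completion)
  also have "\<dots> = ennreal (0 - (2 * l * (- 2 * ln 2) - (l + m\<^sup>2 / l) * 1))"
  proof (rule nn_integral_FTC_einterval[where F = F])
    fix x assume "0 < ereal x"
    then have x: "x > 0" by simp
    have "((\<lambda>r. P (2 * l * r)) has_real_derivative (1 - exp (- (2 * l * x)))\<^sup>2 / (2 * l * x)\<^sup>2 * (2 * l)) (at x)"
      by (rule DERIV_chain2[OF P(1)]) (use x l in \<open>auto intro!: derivative_eq_intros\<close>)
    moreover have "((\<lambda>r. exp (- 2 * l * r)) has_real_derivative - 2 * l * exp (- 2 * l * x)) (at x)"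
      by (auto intro!: derivative_eq_intros)
    ultimately show "(F has_real_derivative ?d x) (at x)" unfolding F_def[abs_def]
      by (rule DERIV_cong[OF DERIV_diff[OF DERIV_cmult DERIV_cmult]])
         (use x l c sq[of x] in \<open>simp add: power_mult_distrib field_simps power2_eq_square\<close>)
    show "isCont ?d x" using x by (intro continuous_intros) auto
    show "0 \<le> ?d x" using c by auto
  next
    have "((\<lambda>r. P (2 * l * r)) \<longlongrightarrow> - 2 * ln 2) (at_right 0)"
      by (rule filterlim_compose[OF P(2)]) (use l in real_asymp)
    moreover have "((\<lambda>r. exp (- 2 * l * r)) \<longlongrightarrow> exp (- 2 * l * 0)) (at_right 0)" by (intro tendsto_intros)
    ultimately have "(F \<longlongrightarrow> 2 * l * (- 2 * ln 2) - (l + m\<^sup>2 / l) * exp (- 2 * l * 0)) (at_right 0)"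
      unfolding F_def[abs_def] by (intro tendsto_diff tendsto_mult tendsto_const)
    then show "((F \<circ> real_of_ereal) \<longlongrightarrow> 2 * l * (- 2 * ln 2) - (l + m\<^sup>2 / l) * 1) (at_right 0)"
      by (simp add: ereal_tendsto_simps zero_ereal_def)
    have "((\<lambda>r. P (2 * l * r)) \<longlongrightarrow> 0) at_top"
      by (rule filterlim_compose[OF P(3)]) (use l in real_asymp)
    moreover have "((\<lambda>r. exp (- 2 * l * r)) \<longlongrightarrow> 0) at_top" using l by real_asymp
    ultimately have "(F \<longlongrightarrow> 2 * l * 0 - (l + m\<^sup>2 / l) * 0) at_top"
      unfolding F_def[abs_def] by (intro tendsto_diff tendsto_mult tendsto_const)
    then show "((F \<circ> real_of_ereal) \<longlongrightarrow> 0) (at_left \<infinity>)"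
      by (simp add: ereal_tendsto_simps)
  qed simp
  also have "0 - (2 * l * (- 2 * ln 2) - (l + m\<^sup>2 / l) * 1) = l * (1 + 4 * ln 2) + m\<^sup>2 / l"
    by (simp add: algebra_simps)
  finally show ?thesis .
qed

text \<open>\<open>l = m / \<kappa>\<close> minimizes \<open>l \<kappa>^2 + m^2 / l\<close>, with
  minimum \<open>2 m \<kappa>\<close>. The inequality is strict because equality would identify
  \<open>u\<close> with the trial function, whose slope tends to \<open>- l\<close> at the origin,
  against \<open>deriv_lim_0\<close>.\<close>

lemma (in nonneg_profile) energy_upper_bound:
  assumes c: "\<alpha> * \<beta> = 2 * m\<^sup>2"
  shows "energy \<alpha> \<beta> u < ennreal (2 * m * sqrt (1 + 4 * ln 2))"
proof -
  define \<kappa> where "\<kappa> = sqrt (1 + 4 * ln (2::real))"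
  have \<kappa>: "\<kappa> > 0" "\<kappa>\<^sup>2 = 1 + 4 * ln 2" by (auto simp: \<kappa>_def add_pos_nonneg)
  define l where "l = m / \<kappa>"
  have l: "l > 0" using m \<kappa> by (simp add: l_def)
  let ?v = "\<lambda>r. exp (- l * r)"
  have "l * (1 + 4 * ln 2) + m\<^sup>2 / l = 2 * m * \<kappa>"
    unfolding \<kappa>(2)[symmetric] l_def using \<kappa>(1) m by (simp add: field_simps power2_eq_square)
  then have E: "energy \<alpha> \<beta> ?v = ennreal (2 * m * \<kappa>)" using energy_trial[OF l c] by simp
  have adm: "admissible \<alpha> \<beta> ?v" unfolding admissible_def
  proof (intro conjI allI impI)
    fix a b :: real
    show "abs_cont_on {a..b} ?v"
      by (rule abs_cont_on_continuous_derivative[where f = "\<lambda>r. - l * ?v r"])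
         (auto intro!: derivative_eq_intros continuous_intros)
    show "energy \<alpha> \<beta> ?v < \<infinity>" unfolding E by simp
    have "(?v \<longlongrightarrow> exp (- l * 0)) (at_right 0)" by (intro tendsto_intros)
    then show "(?v \<longlongrightarrow> 1) (at_right 0)" by simp
    show "(?v \<longlongrightarrow> 0) at_top" using l by real_asymp
  qed
  have "\<not> energy \<alpha> \<beta> ?v \<le> energy \<alpha> \<beta> u"
  proof
    assume "energy \<alpha> \<beta> ?v \<le> energy \<alpha> \<beta> u"
    then have uv: "u r = ?v r" if "r > 0" for r using unique[OF c adm _ that] by simp
    have "u' r = - l * ?v r" if r: "r > 0" for r
    proof -
      have "(?v has_real_derivative - l * ?v r) (at r)" by (auto intro!: derivative_eq_intros)
      then have "(u has_real_derivative - l * ?v r) (at r)"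
        by (rule has_field_derivative_transform_within_open[where S = "{0<..}"]) (use r uv in auto)
      then show ?thesis using DERIV_unique[OF DERIV_u[OF r]] by blast
    qed
    then have "eventually (\<lambda>r. u' r = - l * ?v r) (at_right 0)"
      by (auto simp: eventually_at_right_field intro: exI[of _ 1])
    then have "((\<lambda>r. - l * ?v r) \<longlongrightarrow> 0) (at_right 0)"
      using deriv_lim_0 by (simp add: filterlim_cong)
    moreover have "((\<lambda>r. - l * ?v r) \<longlongrightarrow> - l * exp (- l * 0)) (at_right 0)" by (intro tendsto_intros)
    ultimately have "- l * exp (- l * 0) = 0" by (intro tendsto_unique[rotated]) auto
    then show False using l by simp
  qed
  then show ?thesis unfolding E \<kappa>_def by simp
qed

theorem theorem5p1:
  fixes \<alpha> \<beta> :: real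
  assumes "\<alpha> > 0" and "\<beta> > 0"
  shows
    \<comment> \<open>(a)\<close>
    "(\<exists>u. is_solution \<alpha> \<beta> u \<and> admissible \<alpha> \<beta> u \<and>
          (\<forall>v. admissible \<alpha> \<beta> v \<longrightarrow> energy \<alpha> \<beta> u \<le> energy \<alpha> \<beta> v) \<and>
          (\<forall>r>0. 0 < u r \<and> u r < 1) \<and>
          (\<forall>r s. 0 < r \<longrightarrow> r < s \<longrightarrow> u s < u r) \<and>
          1 < enn2real (energy \<alpha> \<beta> u) / sqrt (2 * \<alpha> * \<beta>) \<and>
          enn2real (energy \<alpha> \<beta> u) / sqrt (2 * \<alpha> * \<beta>) < sqrt (1 + 4 * ln 2))
     \<and>
     \<comment> \<open>(b)\<close>
     (\<forall>u. is_solution \<alpha> \<beta> u \<and> energy \<alpha> \<beta> u < \<infinity> \<longrightarrow>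
          (deriv u \<longlongrightarrow> 0) (at_right 0) \<and>
          (\<forall>\<epsilon>. 0 < \<epsilon> \<and> \<epsilon> < 1 \<longrightarrow>
             u \<in> O[at_top](\<lambda>r. exp (- sqrt (\<alpha> * \<beta> / 2) * (1 - \<epsilon>) * r)) \<and>
             deriv u \<in> O[at_top](\<lambda>r. exp (- sqrt (\<alpha> * \<beta> / 2) * (1 - \<epsilon>) * r))))
     \<and>
     \<comment> \<open>(c)\<close>
     (\<forall>u. is_solution \<alpha> \<beta> u \<and> (\<forall>r>0. 0 \<le> u r) \<longrightarrow>
          (\<forall>r>0. exp (- sqrt (\<alpha> * \<beta> / 2) * r) < u r \<and> u r < 1))
     \<and>
     (\<forall>u v. is_solution \<alpha> \<beta> u \<and> (\<forall>r>0. 0 \<le> u r) \<and> energy \<alpha> \<beta> u < \<infinity> \<and>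
            is_solution \<alpha> \<beta> v \<and> (\<forall>r>0. 0 \<le> v r) \<and> energy \<alpha> \<beta> v < \<infinity> \<longrightarrow>
            (\<forall>r>0. u r = v r))
     \<and>
     (\<forall>u v. admissible \<alpha> \<beta> u \<and> (\<forall>w. admissible \<alpha> \<beta> w \<longrightarrow> energy \<alpha> \<beta> u \<le> energy \<alpha> \<beta> w) \<and>
            admissible \<alpha> \<beta> v \<and> (\<forall>w. admissible \<alpha> \<beta> w \<longrightarrow> energy \<alpha> \<beta> v \<le> energy \<alpha> \<beta> w) \<longrightarrow>
            (\<forall>r>0. u r = v r))"
    (is "?A \<and> ?B \<and> ?C \<and> ?D \<and> ?E")
proof -
  define m where "m = sqrt (\<alpha> * \<beta> / 2)"
  have m: "m > 0" and c: "\<alpha> * \<beta> = 2 * m\<^sup>2" and c0: "\<alpha> * \<beta> \<ge> 0" using assms by (auto simp: m_def)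
  have m2: "sqrt (2 * \<alpha> * \<beta>) = 2 * m"
    using m c by (intro real_sqrt_unique) (auto simp: power2_eq_square)
  have prof: "profile m u (deriv u)" if "is_solution \<alpha> \<beta> u" for u
    using profile_of_solution[OF assms that] by (simp add: m_def)
  have nprof: "nonneg_profile m u (deriv u)" if "is_solution \<alpha> \<beta> u" "\<forall>r>0. 0 \<le> u r" for u
    using prof[OF that(1)] that(2) by (simp add: nonneg_profile_def nonneg_profile_axioms_def)
  obtain U U' where U: "nonneg_profile m U U'" using nonneg_profile_exists[OF m] by blast
  then interpret U: nonneg_profile m U U' .
  define E where "E = enn2real (energy \<alpha> \<beta> U)"
  have E: "energy \<alpha> \<beta> U = ennreal E" "E \<ge> 0" using U.energy_finite[OF c0] by (auto simp: E_def)
  have "2 * m < E" using U.energy_lower_bound[OF c] m E by (simp add: ennreal_less_iff)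
  then have lower: "1 < E / (2 * m)" using m by simp
  have "E < 2 * m * sqrt (1 + 4 * ln 2)" using U.energy_upper_bound[OF c] E by (simp add: ennreal_less_iff)
  then have upper: "E / (2 * m) < sqrt (1 + 4 * ln 2)" using m by (simp add: field_simps)
  have b: "(deriv u \<longlongrightarrow> 0) (at_right 0) \<and> (\<forall>\<epsilon>. 0 < \<epsilon> \<and> \<epsilon> < 1 \<longrightarrow>
             u \<in> O[at_top](\<lambda>r. exp (- m * (1 - \<epsilon>) * r)) \<and> deriv u \<in> O[at_top](\<lambda>r. exp (- m * (1 - \<epsilon>) * r)))"
    if "is_solution \<alpha> \<beta> u" for u
    using profile.deriv_lim_0[OF prof[OF that]] profile.decay_bigo[OF prof[OF that]] by blast
  have c1: "exp (- m * r) < u r \<and> u r < 1" if "is_solution \<alpha> \<beta> u" "\<forall>r>0. 0 \<le> u r" "r > 0" for u r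
    using nonneg_profile.gt_exp[OF nprof[OF that(1,2)] that(3)] nonneg_profile.less_one[OF nprof[OF that(1,2)]
      that(3)] by blast
  have c2: "u r = v r" if "is_solution \<alpha> \<beta> u" "\<forall>r>0. 0 \<le> u r" "is_solution \<alpha> \<beta> v" "\<forall>r>0. 0 \<le> v r" "r > 0" for u v r
  proof -
    note u = nprof[OF that(1,2)] and v = nprof[OF that(3,4)]
    have au: "admissible \<alpha> \<beta> u" "admissible \<alpha> \<beta> v"
      using profile.admissible[OF prof[OF that(1)] c0] profile.admissible[OF prof[OF that(3)] c0] by auto
    \<comment> \<open>The two energies are comparable; whichever is no larger, its function is
      matched against the other solution.\<close>
    show ?thesis
      using nonneg_profile.unique[OF u c au(2) _ that(5)] nonneg_profile.unique[OF v c au(1) _ that(5)]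
      by (metis linear)
  qed
  \<comment> \<open>\<open>U\<close> is admissible, so a minimizer has energy at most that of
    \<open>U\<close> and must coincide with it.\<close>
  have c3: "u r = U r" if "admissible \<alpha> \<beta> u" "\<forall>w. admissible \<alpha> \<beta> w \<longrightarrow> energy \<alpha> \<beta> u \<le> energy \<alpha> \<beta> w" "r > 0" for u r
    using U.unique[OF c that(1) _ that(3)] that(2) U.admissible[OF c0] by blast
  show ?thesis
  proof (intro conjI[of ?A] conjI[of ?B] conjI[of ?C] conjI[of ?D])
    show ?A
      using U.solution[OF c] U.admissible[OF c0] U.minimal[OF c] U.pos U.less_one U.strictly_decreasing lower upper
      unfolding m2 E_def by (intro exI[of _ U]) blast
    show ?B using b unfolding m_def by blast
    show ?C using c1 unfolding m_def by blast
    show ?D using c2 by blast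
    show ?E
    proof (intro allI impI, elim conjE)
      fix u v and r :: real
      assume "admissible \<alpha> \<beta> u" "\<forall>w. admissible \<alpha> \<beta> w \<longrightarrow> energy \<alpha> \<beta> u \<le> energy \<alpha> \<beta> w" "0 < r"
        "admissible \<alpha> \<beta> v" "\<forall>w. admissible \<alpha> \<beta> w \<longrightarrow> energy \<alpha> \<beta> v \<le> energy \<alpha> \<beta> w"
      then show "u r = v r" using c3[of u r] c3[of v r] by simp
    qed
  qed
qed

end
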